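(* The Banach lattice $\mathfrak{BL}$ is the limit of an increasing sequence of $\ell_\infty^m(\ell_1^n)$ lattices: there are an increasing sequence $\mathcal A_1\subseteq\mathcal A_2\subseteq\cdots$ of closed sublattices of $\mathfrak{BL}$ and $m_k,n_k\in\mathbb N$ such that each $\mathcal A_k$ is lattice isometric to $\ell_\infty^{m_k}(\ell_1^{n_k})$ and $\overline{\bigcup_k\mathcal A_k}=\mathfrak{BL}$. In particular, $\mathfrak{BL}$ is finitely branchable.
   Context: All Banach lattices are real. An embedding is an isometric lattice homomorphism (not necessarily onto); a lattice isometry is a surjective embedding. For a finite tuple $\overline a$, $\langle\overline a\rangle$ is the closed sublattice generated by $\overline a$; a Banach lattice is finitely generated if it is of this form. $\mathfrak{BL}$ denotes the Fraïssé limit of the class of finitely generated Banach lattices: the separable Banach lattice, unique up to lattice isometry, such that every finitely generated (equivalently, every separable) Banach lattice embeds into it, and which is approximately ultra-homogeneous: for every finite tuple $\overline a=(a_1,\dots,a_n)$ in $\mathfrak{BL}$, every embedding $f:\langle\overline a\rangle\to\mathfrak{BL}$ and every $\varepsilon>0$ there is a lattice isometry $\phi$ of $\mathfrak{BL}$ onto itself with $\max_i\|f(a_i)-\phi(a_i)\|<\varepsilon$. $\ell_\infty^m(\ell_1^n)$ is $\mathbb R^{m\times n}$ with coordinatewise order and norm $\|(c_{ij})\|=\max_{i\le m}\sum_{j\le n}|c_{ij}|$. A Banach lattice $E$ is finitely branchable if there are finite non-empty sets $A_1,A_2,\dots$ and, with $T=\bigcup_{k\ge0}\prod_{n=1}^kA_n$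 the tree of finite sequences, a family $(x_\sigma)_{\sigma\in T}$ in the positive cone $E_+$ such that for every $k\ge 0$ the elements $x_{\tau}$ with $|\tau|=k+1$ are pairwise disjoint, $x_\sigma=\sum_{b\in A_{k+1}}x_{\sigma^\frown b}$ for every $\sigma$ with $|\sigma|=k$, and $\mathrm{span}\{x_\sigma:\sigma\in T\}$ is dense in $E$. *)

theory Defs
  imports "HOL-Analysis.Analysis" "HOL-Library.Lattice_Algebras"
begin

class banach_lattice = banach + ordered_real_vector + lattice_ab_group_add_abs +
  assumes norm_mono: "\<bar>x\<bar> \<le> \<bar>y\<bar> \<Longrightarrow> norm x \<le> norm y"

definition closed_sublattice :: "'a::banach_lattice set \<Rightarrow> bool" where
  "closed_sublattice S \<longleftrightarrow>
     subspace S \<and> closed S \<and> (\<forall>x\<in>S. \<forall>y\<in>S. sup x y \<in> S \<and> inf x y \<in> S)"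

definition gen_sublattice :: "'a::banach_lattice list \<Rightarrow> 'a set" where
  "gen_sublattice as = \<Inter> {S. closed_sublattice S \<and> set as \<subseteq> S}"

text \<open>
  The universal property of the Fraisse limit quantifies over Banach lattices inside a formula,
  which a type class cannot do. So we also need Banach lattices as values: a carrier set with
  operations, whose axioms are those of the class above relativised to the carrier.
\<close>

record 'b blat =
  bcarrier :: "'b set"
  bzero :: 'b
  badd :: "'b \<Rightarrow> 'b \<Rightarrow> 'b"
  bscale :: "real \<Rightarrow> 'b \<Rightarrow> 'b"
  ble :: "'b \<Rightarrow> 'b \<Rightarrow> bool"
  bsup :: "'b \<Rightarrow> 'b \<Rightarrow> 'b"
  binf :: "'b \<Rightarrow> 'b \<Rightarrow> 'b"
  bnorm :: "'b \<Rightarrow> real"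

definition bdiff :: "'b blat \<Rightarrow> 'b \<Rightarrow> 'b \<Rightarrow> 'b" where
  "bdiff E x y = badd E x (bscale E (-1) y)"

definition babs :: "'b blat \<Rightarrow> 'b \<Rightarrow> 'b" where
  "babs E x = bsup E x (bscale E (-1) x)"

locale banach_lattice_on =
  fixes E :: "'b blat"
  assumes zero_closed: "bzero E \<in> bcarrier E"
    and add_closed: "\<lbrakk>x \<in> bcarrier E; y \<in> bcarrier E\<rbrakk> \<Longrightarrow> badd E x y \<in> bcarrier E"
    and scale_closed: "x \<in> bcarrier E \<Longrightarrow> bscale E a x \<in> bcarrier E"
    and sup_closed: "\<lbrakk>x \<in> bcarrier E; y \<in> bcarrier E\<rbrakk> \<Longrightarrow> bsup E x y \<in> bcarrier E"
    and inf_closed: "\<lbrakk>x \<in> bcarrier E; y \<in> bcarrier E\<rbrakk> \<Longrightarrow> binf E x y \<in> bcarrier E"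
    and add_assoc: "\<lbrakk>x \<in> bcarrier E; y \<in> bcarrier E; z \<in> bcarrier E\<rbrakk>
          \<Longrightarrow> badd E (badd E x y) z = badd E x (badd E y z)"
    and add_commute: "\<lbrakk>x \<in> bcarrier E; y \<in> bcarrier E\<rbrakk> \<Longrightarrow> badd E x y = badd E y x"
    and add_zero: "x \<in> bcarrier E \<Longrightarrow> badd E (bzero E) x = x"
    and add_inverse: "x \<in> bcarrier E \<Longrightarrow> badd E x (bscale E (-1) x) = bzero E"
    and scale_add_right: "\<lbrakk>x \<in> bcarrier E; y \<in> bcarrier E\<rbrakk>
          \<Longrightarrow> bscale E a (badd E x y) = badd E (bscale E a x) (bscale E a y)"
    and scale_add_left: "x \<in> bcarrier E
          \<Longrightarrow> bscale E (a + b) x = badd E (bscale E a x) (bscale E b x)"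
    and scale_scale: "x \<in> bcarrier E \<Longrightarrow> bscale E a (bscale E b x) = bscale E (a * b) x"
    and scale_one: "x \<in> bcarrier E \<Longrightarrow> bscale E 1 x = x"
    and le_refl: "x \<in> bcarrier E \<Longrightarrow> ble E x x"
    and le_antisym: "\<lbrakk>x \<in> bcarrier E; y \<in> bcarrier E; ble E x y; ble E y x\<rbrakk> \<Longrightarrow> x = y"
    and le_trans: "\<lbrakk>x \<in> bcarrier E; y \<in> bcarrier E; z \<in> bcarrier E; ble E x y; ble E y z\<rbrakk>
          \<Longrightarrow> ble E x z"
    and add_mono: "\<lbrakk>x \<in> bcarrier E; y \<in> bcarrier E; z \<in> bcarrier E; ble E x y\<rbrakk>
          \<Longrightarrow> ble E (badd E z x) (badd E z y)"
    and scale_mono: "\<lbrakk>x \<in> bcarrier E; y \<in> bcarrier E; ble E x y; 0 \<le> a\<rbrakk>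
          \<Longrightarrow> ble E (bscale E a x) (bscale E a y)"
    and sup_ge1: "\<lbrakk>x \<in> bcarrier E; y \<in> bcarrier E\<rbrakk> \<Longrightarrow> ble E x (bsup E x y)"
    and sup_ge2: "\<lbrakk>x \<in> bcarrier E; y \<in> bcarrier E\<rbrakk> \<Longrightarrow> ble E y (bsup E x y)"
    and sup_least: "\<lbrakk>x \<in> bcarrier E; y \<in> bcarrier E; z \<in> bcarrier E; ble E x z; ble E y z\<rbrakk>
          \<Longrightarrow> ble E (bsup E x y) z"
    and inf_le1: "\<lbrakk>x \<in> bcarrier E; y \<in> bcarrier E\<rbrakk> \<Longrightarrow> ble E (binf E x y) x"
    and inf_le2: "\<lbrakk>x \<in> bcarrier E; y \<in> bcarrier E\<rbrakk> \<Longrightarrow> ble E (binf E x y) y"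
    and inf_greatest: "\<lbrakk>x \<in> bcarrier E; y \<in> bcarrier E; z \<in> bcarrier E; ble E z x; ble E z y\<rbrakk>
          \<Longrightarrow> ble E z (binf E x y)"
    and norm_eq_zero: "x \<in> bcarrier E \<Longrightarrow> bnorm E x = 0 \<longleftrightarrow> x = bzero E"
    and norm_triangle: "\<lbrakk>x \<in> bcarrier E; y \<in> bcarrier E\<rbrakk>
          \<Longrightarrow> bnorm E (badd E x y) \<le> bnorm E x + bnorm E y"
    and norm_scale: "x \<in> bcarrier E \<Longrightarrow> bnorm E (bscale E a x) = \<bar>a\<bar> * bnorm E x"
    and norm_mono: "\<lbrakk>x \<in> bcarrier E; y \<in> bcarrier E; ble E (babs E x) (babs E y)\<rbrakk>
          \<Longrightarrow> bnorm E x \<le> bnorm E y"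
    and complete: "\<lbrakk>\<And>n::nat. X n \<in> bcarrier E;
           \<And>e. 0 < e \<Longrightarrow> \<exists>N. \<forall>i\<ge>N. \<forall>j\<ge>N. bnorm E (bdiff E (X i) (X j)) < e\<rbrakk>
          \<Longrightarrow> \<exists>x\<in>bcarrier E. (\<lambda>n. bnorm E (bdiff E (X n) x)) \<longlonglongrightarrow> 0"

definition closed_sublattice_in :: "'b blat \<Rightarrow> 'b set \<Rightarrow> bool" where
  "closed_sublattice_in E S \<longleftrightarrow>
     S \<subseteq> bcarrier E \<and> bzero E \<in> S \<and>
     (\<forall>x\<in>S. \<forall>y\<in>S. badd E x y \<in> S \<and> bsup E x y \<in> S \<and> binf E x y \<in> S) \<and>
     (\<forall>a. \<forall>x\<in>S. bscale E a x \<in> S) \<and>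
     (\<forall>X x. (\<forall>n::nat. X n \<in> S) \<longrightarrow> x \<in> bcarrier E \<longrightarrow>
        (\<lambda>n. bnorm E (bdiff E (X n) x)) \<longlonglongrightarrow> 0 \<longrightarrow> x \<in> S)"

definition finitely_generated :: "'b blat \<Rightarrow> bool" where
  "finitely_generated E \<longleftrightarrow>
     (\<exists>as. set as \<subseteq> bcarrier E \<and>
        \<Inter> {S. closed_sublattice_in E S \<and> set as \<subseteq> S} = bcarrier E)"

definition bl_embedding :: "'b blat \<Rightarrow> 'c blat \<Rightarrow> ('b \<Rightarrow> 'c) \<Rightarrow> bool" where
  "bl_embedding E F f \<longleftrightarrow>
     (\<forall>x\<in>bcarrier E. f x \<in> bcarrier F \<and> bnorm F (f x) = bnorm E x) \<and>
     (\<forall>a. \<forall>x\<in>bcarrier E. f (bscale E a x) = bscale F a (f x)) \<and>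
     (\<forall>x\<in>bcarrier E. \<forall>y\<in>bcarrier E.
        f (badd E x y) = badd F (f x) (f y) \<and>
        f (bsup E x y) = bsup F (f x) (f y) \<and>
        f (binf E x y) = binf F (f x) (f y))"

definition lattice_isometry :: "'b blat \<Rightarrow> 'c blat \<Rightarrow> ('b \<Rightarrow> 'c) \<Rightarrow> bool" where
  "lattice_isometry E F f \<longleftrightarrow> bl_embedding E F f \<and> f ` bcarrier E = bcarrier F"

definition blat_of :: "'a::banach_lattice set \<Rightarrow> 'a blat" where
  "blat_of S = \<lparr>bcarrier = S, bzero = 0, badd = (+), bscale = (*\<^sub>R), ble = (\<le>),
                bsup = sup, binf = inf, bnorm = norm\<rparr>"

text \<open>The two presentations agree.\<close>

lemma closed_sublattice_in_blat_of:
  fixes S :: "'a::banach_lattice set"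
  shows "closed_sublattice_in (blat_of UNIV) S \<longleftrightarrow> closed_sublattice S"
proof -
  have "(\<lambda>n. norm (X n - x)) \<longlonglongrightarrow> 0 \<longleftrightarrow> X \<longlonglongrightarrow> x" for X :: "nat \<Rightarrow> 'a" and x
    by (metis LIM_zero_iff tendsto_norm_zero_iff)
  then show ?thesis
    unfolding closed_sublattice_in_def closed_sublattice_def subspace_def closed_sequential_limits
    by (auto simp: blat_of_def bdiff_def)
qed

lemma banach_lattice_on_blat_of:
  fixes S :: "'a::banach_lattice set"
  assumes "closed_sublattice S"
  shows "banach_lattice_on (blat_of S)"
proof -
  have S: "subspace S" "closed S" "\<And>x y. x \<in> S \<Longrightarrow> y \<in> S \<Longrightarrow> sup x y \<in> S \<and> inf x y \<in> S"
    using assms by (auto simp: closed_sublattice_def)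
  have complete: "\<exists>x\<in>S. (\<lambda>n. norm (X n - x)) \<longlonglongrightarrow> 0"
    if "\<And>n. X n \<in> S" and "\<And>e. 0 < e \<Longrightarrow> \<exists>N. \<forall>i\<ge>N. \<forall>j\<ge>N. norm (X i - X j) < e"
    for X :: "nat \<Rightarrow> 'a"
  proof -
    have "Cauchy X" using that(2) by (simp add: Cauchy_iff)
    then obtain x where "X \<longlonglongrightarrow> x" by (auto simp: Cauchy_convergent_iff convergent_def)
    moreover from this have "x \<in> S" using S(2) that(1) by (auto simp: closed_sequential_limits)
    ultimately show ?thesis by (auto intro!: bexI[of _ x] tendsto_norm_zero simp: LIM_zero_iff)
  qed
  show ?thesis
    by (unfold_locales)
       (use S complete in \<open>auto simp: blat_of_def bdiff_def babs_def subspace_def algebra_simps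
          norm_triangle_ineq scaleR_left_mono intro: banach_lattice_class.norm_mono
          simp flip: abs_lattice\<close>)
qed

text \<open>
  An \<open>m \<times> n\<close> matrix is a function vanishing outside \<open>{..<m} \<times> {..<n}\<close>. This is meant for
  positive \<open>m\<close> (and \<open>n\<close>) only, as \<open>Max {}\<close> is unspecified.
\<close>

definition linf_l1 :: "nat \<Rightarrow> nat \<Rightarrow> (nat \<Rightarrow> nat \<Rightarrow> real) blat" where
  "linf_l1 m n =
     \<lparr>bcarrier = {c. \<forall>i j. \<not> (i < m \<and> j < n) \<longrightarrow> c i j = 0},
      bzero = (\<lambda>i j. 0),
      badd = (\<lambda>c d i j. c i j + d i j),
      bscale = (\<lambda>a c i j. a * c i j),
      ble = (\<lambda>c d. \<forall>i j. c i j \<le> d i j),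
      bsup = (\<lambda>c d i j. max (c i j) (d i j)),
      binf = (\<lambda>c d i j. min (c i j) (d i j)),
      bnorm = (\<lambda>c. Max ((\<lambda>i. \<Sum>j<n. \<bar>c i j\<bar>) ` {..<m}))\<rparr>"

text \<open>
  A finitely generated Banach lattice is separable, so it has at most continuum many elements and
  is lattice isometric to one whose carrier is a set of real sequences. Restricting the carrier
  type in the universal property is therefore no restriction on the lattices considered; the
  operations on the sequences are arbitrary.
\<close>

definition universal_fg :: "'a::banach_lattice itself \<Rightarrow> bool" where
  "universal_fg _ \<longleftrightarrow>
     (\<forall>E :: (nat \<Rightarrow> real) blat. banach_lattice_on E \<and> finitely_generated E \<longrightarrow>
        (\<exists>f. bl_embedding E (blat_of (UNIV :: 'a set)) f))"

definition approx_ultrahomogeneous :: "'a::banach_lattice itself \<Rightarrow> bool" where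
  "approx_ultrahomogeneous _ \<longleftrightarrow>
     (\<forall>(as :: 'a list) (f :: 'a \<Rightarrow> 'a) (\<epsilon> :: real).
        bl_embedding (blat_of (gen_sublattice as)) (blat_of UNIV) f \<and> 0 < \<epsilon> \<longrightarrow>
        (\<exists>\<phi> :: 'a \<Rightarrow> 'a. lattice_isometry (blat_of UNIV) (blat_of UNIV) \<phi> \<and>
             (\<forall>a\<in>set as. norm (f a - \<phi> a) < \<epsilon>)))"

definition is_BL :: "'a::banach_lattice itself \<Rightarrow> bool" where
  "is_BL T \<longleftrightarrow>
     separable_space (euclidean :: 'a topology) \<and> universal_fg T \<and> approx_ultrahomogeneous T"

text \<open>
  The sets \<open>A\<^sub>1, A\<^sub>2, \<dots>\<close> are taken to be sets of natural numbers, without loss of generality as they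
  are finite, and are indexed from \<open>0\<close>: \<open>A k\<close> here is \<open>A\<^sub>k\<^sub>+\<^sub>1\<close>.
\<close>

definition tree_level :: "(nat \<Rightarrow> nat set) \<Rightarrow> nat \<Rightarrow> nat list set" where
  "tree_level A k = {\<sigma>. length \<sigma> = k \<and> (\<forall>i<k. \<sigma> ! i \<in> A i)}"

definition finitely_branchable :: "'a::banach_lattice itself \<Rightarrow> bool" where
  "finitely_branchable _ \<longleftrightarrow>
     (\<exists>(A :: nat \<Rightarrow> nat set) (x :: nat list \<Rightarrow> 'a).
        (\<forall>k. finite (A k) \<and> A k \<noteq> {}) \<and>
        (\<forall>k. \<forall>\<sigma>\<in>tree_level A k. 0 \<le> x \<sigma>) \<and>
        (\<forall>k. \<forall>\<sigma>\<in>tree_level A (Suc k). \<forall>\<tau>\<in>tree_level A (Suc k).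
            \<sigma> \<noteq> \<tau> \<longrightarrow> inf \<bar>x \<sigma>\<bar> \<bar>x \<tau>\<bar> = 0) \<and>
        (\<forall>k. \<forall>\<sigma>\<in>tree_level A k. x \<sigma> = (\<Sum>b\<in>A k. x (\<sigma> @ [b]))) \<and>
        closure (span (x ` (\<Union>k. tree_level A k))) = UNIV)"

end

theory Submission
  imports Defs
begin

text \<open>
  It suffices to extend a given embedding \<open>g\<close> of a lattice of matrices into the limit approximately, so
  that a given \<open>d\<close> is nearly reached: the isometric inclusions obtained in this way form a direct
  system, and the embeddings converge along it to embeddings with increasing ranges.

  For the extension step let \<open>e\<close> be the sum of the images of the matrix units and of \<open>\<bar>d\<bar>\<close>. The order
  ideal generated by \<open>e\<close> consists of functions on the set of its real lattice homomorphisms \<open>\<omega>\<close> with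
  \<open>\<omega> e = 1\<close>. Rounding the values of the finitely many elements in question partitions this set into
  finitely many pieces. The functions constant on the pieces form a finite-dimensional lattice,
  normed by majorants in the ideal. By the theorem of Hahn and Banach this norm is, up to a
  factor close to 1, a maximum of finitely many positive functionals, some of which extend the rows
  of the given matrix lattice, so that the old norm is attained exactly. These functionals are the
  rows of the new matrix lattice. It is amalgamated with the ideal by an infimal convolution of the
  norms on a lattice of functions; the completion of the sublattice generated there is finitely
  generated, hence embeds into the limit, and approximate ultrahomogeneity moves this
  embedding close to \<open>g\<close> and \<open>d\<close>.

  If all weights of the inclusions are positive, every matrix unit splits into multiples of the
  units of the next level and each of those occurs in a splitting, which yields the tree.
\<close>

section \<open>Completion of seminormed function lattices\<close>

text \<open>The defining properties of the limit only accept exact isometries, whereas rounding and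
  the choice of finitely many functionals both distort norms. The distortion is removed in two
  places. On the matrix side, the old rows are bounded, after rounding, by
  \<open>1 + \<delta>\<close> times the new norm; they are extended with this constant and kept as
  rows. In the amalgam, an ideal element and the matrix meant to agree with it are compared at two
  kinds of points. At the first kind matrices are reduced by \<open>1 - \<delta>\<close>, so that
  they cannot majorise ideal elements too cheaply; at the second kind ideal elements are reduced by
  \<open>1 / (1 + \<delta>)\<close>, which protects the matrices. Both norms then extend exactly,
  and the price is that the two elements are only close: their difference has a majorant
  \<open>2 (\<theta> e + \<delta> \<bar>a\<bar>)\<close> of small norm. Values are rounded downwards
  because disjoint positive elements then have disjoint roundings; this is what makes the passage
  from matrices to functions on the pieces a lattice homomorphism.\<close>

locale fun_lattice =
  fixes M :: "('t \<Rightarrow> real) set" and N :: "('t \<Rightarrow> real) \<Rightarrow> real"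
  assumes zero_mem: "(\<lambda>_. 0) \<in> M"
    and add_mem: "u \<in> M \<Longrightarrow> v \<in> M \<Longrightarrow> (\<lambda>t. u t + v t) \<in> M"
    and scale_mem: "u \<in> M \<Longrightarrow> (\<lambda>t. r * u t) \<in> M"
    and max_mem: "u \<in> M \<Longrightarrow> v \<in> M \<Longrightarrow> (\<lambda>t. max (u t) (v t)) \<in> M"
    and N_triangle: "u \<in> M \<Longrightarrow> v \<in> M \<Longrightarrow> N (\<lambda>t. u t + v t) \<le> N u + N v"
    and N_scale: "u \<in> M \<Longrightarrow> N (\<lambda>t. r * u t) = \<bar>r\<bar> * N u"
    and N_mono: "u \<in> M \<Longrightarrow> v \<in> M \<Longrightarrow> (\<And>t. \<bar>u t\<bar> \<le> \<bar>v t\<bar>) \<Longrightarrow> N u \<le> N v"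
begin

lemma uminus_mem: "u \<in> M \<Longrightarrow> (\<lambda>t. - u t) \<in> M"
  using scale_mem[of u "-1"] by simp

lemma diff_mem: "u \<in> M \<Longrightarrow> v \<in> M \<Longrightarrow> (\<lambda>t. u t - v t) \<in> M"
  using add_mem[OF _ uminus_mem] by simp

lemma min_mem:
  assumes "u \<in> M" "v \<in> M"
  shows "(\<lambda>t. min (u t) (v t)) \<in> M"
proof -
  have "(\<lambda>t. min (u t) (v t)) = (\<lambda>t. - max (- u t) (- v t))" by (auto simp: min_def max_def)
  then show ?thesis using uminus_mem[OF max_mem[OF uminus_mem uminus_mem]] assms by simp
qed

lemma abs_mem:
  assumes "u \<in> M" shows "(\<lambda>t. \<bar>u t\<bar>) \<in> M"
proof -
  have "(\<lambda>t. \<bar>u t\<bar>) = (\<lambda>t. max (u t) (- u t))" by (auto simp: max_def)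
  then show ?thesis using max_mem[OF assms uminus_mem[OF assms]] by simp
qed

lemmas mem_intros = zero_mem add_mem scale_mem max_mem uminus_mem diff_mem min_mem abs_mem

lemma N_zero [simp]: "N (\<lambda>_. 0) = 0"
  using N_scale[OF zero_mem, of 0] by simp

lemma N_uminus: "u \<in> M \<Longrightarrow> N (\<lambda>t. - u t) = N u"
  using N_scale[of u "-1"] by simp

lemma N_nonneg: "u \<in> M \<Longrightarrow> 0 \<le> N u"
  using N_triangle[of u "\<lambda>t. - u t"] uminus_mem[of u] N_uminus[of u] by simp

lemma N_minus_commute: "u \<in> M \<Longrightarrow> v \<in> M \<Longrightarrow> N (\<lambda>t. u t - v t) = N (\<lambda>t. v t - u t)"
  using N_uminus[OF diff_mem[of u v]] by simp

lemma N_abs: "u \<in> M \<Longrightarrow> N (\<lambda>t. \<bar>u t\<bar>) = N u"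
  by (rule antisym; rule N_mono) (auto intro: mem_intros)

lemma N_dominated:
  assumes "u \<in> M" "v \<in> M" "w \<in> M" "\<And>t. \<bar>u t\<bar> \<le> \<bar>v t\<bar> + \<bar>w t\<bar>"
  shows "N u \<le> N v + N w"
proof -
  have "N u \<le> N (\<lambda>t. \<bar>v t\<bar> + \<bar>w t\<bar>)"
    using assms by (intro N_mono) (auto intro: mem_intros order_trans[OF _ abs_ge_self])
  also have "\<dots> \<le> N v + N w"
    using N_triangle[of "\<lambda>t. \<bar>v t\<bar>" "\<lambda>t. \<bar>w t\<bar>"] assms by (auto simp: N_abs intro: mem_intros)
  finally show ?thesis .
qed

lemma N_diff_triangle:
  "u \<in> M \<Longrightarrow> v \<in> M \<Longrightarrow> w \<in> M \<Longrightarrow> N (\<lambda>t. u t - w t) \<le> N (\<lambda>t. u t - v t) + N (\<lambda>t. v t - w t)"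
  by (rule N_dominated) (auto intro: mem_intros)

lemma N_diff_ge: "u \<in> M \<Longrightarrow> v \<in> M \<Longrightarrow> \<bar>N u - N v\<bar> \<le> N (\<lambda>t. u t - v t)"
  using N_dominated[of u "\<lambda>t. u t - v t" v] N_dominated[of v "\<lambda>t. u t - v t" u]
  by (simp add: mem_intros abs_diff_le_iff) linarith

definition cauchy_in :: "(nat \<Rightarrow> 't \<Rightarrow> real) \<Rightarrow> bool" where
  "cauchy_in X \<longleftrightarrow> (\<forall>e>0. \<exists>K. \<forall>i\<ge>K. \<forall>j\<ge>K. N (\<lambda>t. X i t - X j t) < e)"

lemma cauchy_inD: "cauchy_in X \<Longrightarrow> 0 < e \<Longrightarrow> \<exists>K. \<forall>i\<ge>K. \<forall>j\<ge>K. N (\<lambda>t. X i t - X j t) < e"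
  by (auto simp: cauchy_in_def)

text \<open>Sums, multiples and maxima are all Lipschitz in their arguments pointwise, so a single
  domination hypothesis shows that each of them preserves Cauchy sequences.\<close>

lemma cauchy_in_combine:
  assumes "\<And>n. X n \<in> M" "\<And>n. Y n \<in> M" "\<And>n. Z n \<in> M" "cauchy_in X" "cauchy_in Y" and C: "0 < C"
    and dom: "\<And>i j t. \<bar>Z i t - Z j t\<bar> \<le> C * \<bar>X i t - X j t\<bar> + C * \<bar>Y i t - Y j t\<bar>"
  shows "cauchy_in Z"
  unfolding cauchy_in_def
proof (intro allI impI)
  fix e :: real assume "0 < e"
  then have e: "0 < e / (2 * C)" using C by simp
  obtain K where K: "\<And>i j. i \<ge> K \<Longrightarrow> j \<ge> K \<Longrightarrow> N (\<lambda>t. X i t - X j t) < e / (2 * C)"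
    using cauchy_inD[OF assms(4) e] by blast
  obtain L where L: "\<And>i j. i \<ge> L \<Longrightarrow> j \<ge> L \<Longrightarrow> N (\<lambda>t. Y i t - Y j t) < e / (2 * C)"
    using cauchy_inD[OF assms(5) e] by blast
  have "N (\<lambda>t. Z i t - Z j t) < e" if "i \<ge> max K L" "j \<ge> max K L" for i j
  proof -
    have "N (\<lambda>t. Z i t - Z j t) \<le> N (\<lambda>t. C * (X i t - X j t)) + N (\<lambda>t. C * (Y i t - Y j t))"
      by (rule N_dominated) (use C dom in \<open>auto intro!: mem_intros assms(1-3) simp: abs_mult\<close>)
    also have "\<dots> = C * N (\<lambda>t. X i t - X j t) + C * N (\<lambda>t. Y i t - Y j t)"
      using C by (subst (1 2) N_scale) (auto intro!: mem_intros assms(1-3))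
    also have "\<dots> < C * (e / (2 * C)) + C * (e / (2 * C))"
      using K[of i j] L[of i j] that C by (intro add_strict_mono mult_strict_left_mono) auto
    also have "\<dots> = e" using C by (simp add: field_simps)
    finally show ?thesis .
  qed
  then show "\<exists>K. \<forall>i\<ge>K. \<forall>j\<ge>K. N (\<lambda>t. Z i t - Z j t) < e" by blast
qed

end

locale complete_fun_lattice = fun_lattice M N for M :: "('t \<Rightarrow> real) set" and N +
  fixes d :: "nat \<Rightarrow> 't \<Rightarrow> real"
  assumes d_mem: "d n \<in> M"
    and d_dense: "u \<in> M \<Longrightarrow> 0 < e \<Longrightarrow> \<exists>n. N (\<lambda>t. u t - d n t) < e"
    and complete: "(\<And>n. X n \<in> M) \<Longrightarrow> cauchy_in X \<Longrightarrow> \<exists>x\<in>M. (\<lambda>n. N (\<lambda>t. X n t - x t)) \<longlonglongrightarrow> 0"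
begin

text \<open>The distances to a dense sequence determine an element up to the kernel of \<open>N\<close>.\<close>

definition cls :: "('t \<Rightarrow> real) \<Rightarrow> nat \<Rightarrow> real" where
  "cls u = (\<lambda>n. N (\<lambda>t. u t - d n t))"

definition rep :: "(nat \<Rightarrow> real) \<Rightarrow> 't \<Rightarrow> real" where
  "rep \<xi> = (SOME u. u \<in> M \<and> cls u = \<xi>)"

text \<open>Classes are named by sequences of distances because \<open>universal_fg\<close>
  quantifies over lattices of real sequences. The pointwise order of representatives would depend on
  their choice, hence the order is defined through the seminorm.\<close>

definition quot :: "(nat \<Rightarrow> real) blat" where
  "quot = \<lparr>bcarrier = cls ` M, bzero = cls (\<lambda>_. 0),
     badd = (\<lambda>\<xi> \<eta>. cls (\<lambda>t. rep \<xi> t + rep \<eta> t)),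
     bscale = (\<lambda>r \<xi>. cls (\<lambda>t. r * rep \<xi> t)),
     ble = (\<lambda>\<xi> \<eta>. N (\<lambda>t. max (rep \<xi> t - rep \<eta> t) 0) = 0),
     bsup = (\<lambda>\<xi> \<eta>. cls (\<lambda>t. max (rep \<xi> t) (rep \<eta> t))),
     binf = (\<lambda>\<xi> \<eta>. cls (\<lambda>t. min (rep \<xi> t) (rep \<eta> t))),
     bnorm = (\<lambda>\<xi>. N (rep \<xi>))\<rparr>"

text \<open>If the distance were positive, a member of the dense sequence within half of it of
  \<open>u\<close> would be equally close to \<open>v\<close>, against the triangle
  inequality.\<close>

lemma cls_eq_iff:
  assumes "u \<in> M" "v \<in> M"
  shows "cls u = cls v \<longleftrightarrow> N (\<lambda>t. u t - v t) = 0"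
proof
  assume eq: "cls u = cls v"
  show "N (\<lambda>t. u t - v t) = 0"
  proof (rule ccontr)
    assume "N (\<lambda>t. u t - v t) \<noteq> 0"
    then have pos: "0 < N (\<lambda>t. u t - v t)"
      using N_nonneg[OF diff_mem[OF assms]] by simp
    obtain n where n: "N (\<lambda>t. u t - d n t) < N (\<lambda>t. u t - v t) / 2"
      using d_dense[OF assms(1), of "N (\<lambda>t. u t - v t) / 2"] pos by auto
    have "N (\<lambda>t. v t - d n t) = N (\<lambda>t. u t - d n t)" using fun_cong[OF eq, of n] by (simp add: cls_def)
    then show False
      using N_diff_triangle[OF assms(1) d_mem assms(2), of n] n
        N_minus_commute[OF d_mem assms(2), of n] by simp
  qed
next
  assume eq: "N (\<lambda>t. u t - v t) = 0"
  have "N (\<lambda>t. u t - d n t) = N (\<lambda>t. v t - d n t)" for n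
    using N_diff_triangle[OF assms(1) assms(2) d_mem, of n] N_diff_triangle[OF assms(2) assms(1) d_mem, of n]
      eq N_minus_commute[OF assms] by simp
  then show "cls u = cls v" by (simp add: cls_def)
qed

lemma rep: assumes "u \<in> M" shows "rep (cls u) \<in> M" "N (\<lambda>t. rep (cls u) t - u t) = 0"
proof -
  have "rep (cls u) \<in> M \<and> cls (rep (cls u)) = cls u"
    unfolding rep_def by (rule someI[of _ u]) (use assms in simp)
  then show "rep (cls u) \<in> M" "N (\<lambda>t. rep (cls u) t - u t) = 0"
    using cls_eq_iff assms by auto
qed

text \<open>Makes the operations on classes well defined: changing representatives by null functions
  changes the result by a function that null functions dominate.\<close>

lemma N_eq_zero_dominated:
  assumes "u \<in> M" "v \<in> M" "w \<in> M" "\<And>t. \<bar>u t\<bar> \<le> \<bar>v t\<bar> + \<bar>w t\<bar>" "N v = 0" "N w = 0"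
  shows "N u = 0"
  using N_dominated[OF assms(1-4)] N_nonneg[OF assms(1)] assms(5,6) by simp

lemma quot_carrier [simp]: "bcarrier quot = cls ` M"
  and quot_zero [simp]: "bzero quot = cls (\<lambda>_. 0)"
  by (simp_all add: quot_def)

lemma quot_add [simp]:
  assumes "u \<in> M" "v \<in> M" shows "badd quot (cls u) (cls v) = cls (\<lambda>t. u t + v t)"
proof -
  have "N (\<lambda>t. (rep (cls u) t + rep (cls v) t) - (u t + v t)) = 0"
    by (rule N_eq_zero_dominated[OF _ _ _ _ rep(2)[OF assms(1)] rep(2)[OF assms(2)]])
      (auto intro!: mem_intros rep assms)
  then show ?thesis by (simp add: quot_def cls_eq_iff rep assms mem_intros)
qed

lemma quot_scale [simp]:
  assumes "u \<in> M" shows "bscale quot r (cls u) = cls (\<lambda>t. r * u t)"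
proof -
  have "N (\<lambda>t. r * rep (cls u) t - r * u t) = N (\<lambda>t. r * (rep (cls u) t - u t))"
    by (simp add: algebra_simps)
  also have "\<dots> = 0" using N_scale[OF diff_mem[OF rep(1)[OF assms] assms]] rep(2)[OF assms] by simp
  finally show ?thesis by (simp add: quot_def cls_eq_iff rep assms mem_intros)
qed

lemma quot_sup [simp]:
  assumes "u \<in> M" "v \<in> M" shows "bsup quot (cls u) (cls v) = cls (\<lambda>t. max (u t) (v t))"
proof -
  have "N (\<lambda>t. max (rep (cls u) t) (rep (cls v) t) - max (u t) (v t)) = 0"
    by (rule N_eq_zero_dominated[OF _ _ _ _ rep(2)[OF assms(1)] rep(2)[OF assms(2)]])
      (auto intro!: mem_intros rep assms)
  then show ?thesis by (simp add: quot_def cls_eq_iff rep assms mem_intros)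
qed

lemma quot_inf [simp]:
  assumes "u \<in> M" "v \<in> M" shows "binf quot (cls u) (cls v) = cls (\<lambda>t. min (u t) (v t))"
proof -
  have "N (\<lambda>t. min (rep (cls u) t) (rep (cls v) t) - min (u t) (v t)) = 0"
    by (rule N_eq_zero_dominated[OF _ _ _ _ rep(2)[OF assms(1)] rep(2)[OF assms(2)]])
      (auto intro!: mem_intros rep assms)
  then show ?thesis by (simp add: quot_def cls_eq_iff rep assms mem_intros)
qed

lemma quot_le [simp]:
  assumes "u \<in> M" "v \<in> M" shows "ble quot (cls u) (cls v) \<longleftrightarrow> N (\<lambda>t. max (u t - v t) 0) = 0"
proof -
  have "\<bar>N (\<lambda>t. max (rep (cls u) t - rep (cls v) t) 0) - N (\<lambda>t. max (u t - v t) 0)\<bar>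
     \<le> N (\<lambda>t. max (rep (cls u) t - rep (cls v) t) 0 - max (u t - v t) 0)"
    by (rule N_diff_ge) (auto intro!: mem_intros rep assms)
  also have "\<dots> = 0"
    by (rule N_eq_zero_dominated[OF _ _ _ _ rep(2)[OF assms(1)] rep(2)[OF assms(2)]])
      (auto intro!: mem_intros rep assms)
  finally show ?thesis by (simp add: quot_def)
qed

lemma quot_norm [simp]: assumes "u \<in> M" shows "bnorm quot (cls u) = N u"
  using N_diff_ge[OF rep(1)[OF assms] assms] rep(2)[OF assms] by (simp add: quot_def)

lemma quot_diff [simp]:
  assumes "u \<in> M" "v \<in> M" shows "bdiff quot (cls u) (cls v) = cls (\<lambda>t. u t - v t)"
  using assms by (simp add: bdiff_def mem_intros)

lemma quot_abs [simp]:
  assumes "u \<in> M" shows "babs quot (cls u) = cls (\<lambda>t. \<bar>u t\<bar>)"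
proof -
  have "(\<lambda>t. max (u t) (- u t)) = (\<lambda>t. \<bar>u t\<bar>)" by (auto simp: max_def)
  then show ?thesis using assms by (simp add: babs_def mem_intros)
qed

lemma banach_lattice_on_quot: "banach_lattice_on quot"
proof
  show "bzero quot \<in> bcarrier quot" by (simp add: mem_intros)
next
  fix x y z assume "x \<in> bcarrier quot" "y \<in> bcarrier quot" "z \<in> bcarrier quot"
  then obtain u v w where u: "u \<in> M" "x = cls u" and v: "v \<in> M" "y = cls v" and w: "w \<in> M" "z = cls w"
    by auto
  note uvw = u v w
  show "badd quot (badd quot x y) z = badd quot x (badd quot y z)"
    using uvw by (simp add: mem_intros add.assoc)
  show "ble quot x y \<Longrightarrow> ble quot (badd quot z x) (badd quot z y)"
    using uvw by (simp add: mem_intros)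
  show "ble quot x z" if "ble quot x y" "ble quot y z"
  proof -
    have "N (\<lambda>t. max (u t - w t) 0) = 0"
      by (rule N_eq_zero_dominated[of _ "\<lambda>t. max (u t - v t) 0" "\<lambda>t. max (v t - w t) 0"])
        (use that uvw in \<open>auto intro!: mem_intros\<close>)
    then show ?thesis using uvw by simp
  qed
  show "ble quot (bsup quot x y) z" if "ble quot x z" "ble quot y z"
  proof -
    have "N (\<lambda>t. max (max (u t) (v t) - w t) 0) = 0"
      by (rule N_eq_zero_dominated[of _ "\<lambda>t. max (u t - w t) 0" "\<lambda>t. max (v t - w t) 0"])
        (use that uvw in \<open>auto intro!: mem_intros\<close>)
    then show ?thesis using uvw by (simp add: mem_intros)
  qed
  show "ble quot z (binf quot x y)" if "ble quot z x" "ble quot z y"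
  proof -
    have "N (\<lambda>t. max (w t - min (u t) (v t)) 0) = 0"
      by (rule N_eq_zero_dominated[of _ "\<lambda>t. max (w t - u t) 0" "\<lambda>t. max (w t - v t) 0"])
        (use that uvw in \<open>auto intro!: mem_intros\<close>)
    then show ?thesis using uvw by (simp add: mem_intros)
  qed
next
  fix x y and a b :: real assume "x \<in> bcarrier quot" "y \<in> bcarrier quot"
  then obtain u v where u: "u \<in> M" "x = cls u" and v: "v \<in> M" "y = cls v"
    by auto
  note uv = u v
  show "badd quot x y \<in> bcarrier quot" "bscale quot a x \<in> bcarrier quot"
    "bsup quot x y \<in> bcarrier quot" "binf quot x y \<in> bcarrier quot"
    using uv by (auto simp: mem_intros)
  show "badd quot x y = badd quot y x" "badd quot (bzero quot) x = x"
    "badd quot x (bscale quot (-1) x) = bzero quot"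
    "bscale quot a (badd quot x y) = badd quot (bscale quot a x) (bscale quot a y)"
    "bscale quot (a + b) x = badd quot (bscale quot a x) (bscale quot b x)"
    "bscale quot a (bscale quot b x) = bscale quot (a * b) x"
    "bscale quot 1 x = x"
    using uv by (simp_all add: mem_intros algebra_simps)
  have [simp]: "max (a - max a b) 0 = 0" "max (b - max a b) 0 = 0"
    "max (min a b - a) 0 = 0" "max (min a b - b) 0 = 0" for a b :: real by auto
  show "ble quot x x" "ble quot x (bsup quot x y)" "ble quot y (bsup quot x y)"
     "ble quot (binf quot x y) x" "ble quot (binf quot x y) y"
    using uv by (simp_all add: mem_intros)
  show "x = y" if "ble quot x y" "ble quot y x"
  proof -
    have "N (\<lambda>t. u t - v t) = 0"
      by (rule N_eq_zero_dominated[of _ "\<lambda>t. max (u t - v t) 0" "\<lambda>t. max (v t - u t) 0"])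
        (use that uv in \<open>auto intro!: mem_intros\<close>)
    then show ?thesis using uv by (simp add: cls_eq_iff)
  qed
  show "ble quot (bscale quot a x) (bscale quot a y)" if "ble quot x y" "0 \<le> a"
  proof -
    have "(\<lambda>t. max (a * u t - a * v t) 0) = (\<lambda>t. a * max (u t - v t) 0)"
      using that(2) by (simp add: max_mult_distrib_left right_diff_distrib)
    then show ?thesis using that(1) uv N_scale[of "\<lambda>t. max (u t - v t) 0" a]
      by (simp add: mem_intros)
  qed
  show "bnorm quot x = 0 \<longleftrightarrow> x = bzero quot"
    using uv by (simp add: cls_eq_iff mem_intros)
  show "bnorm quot (badd quot x y) \<le> bnorm quot x + bnorm quot y"
    using uv by (simp add: mem_intros N_triangle)
  show "bnorm quot (bscale quot a x) = \<bar>a\<bar> * bnorm quot x"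
    using uv by (simp add: mem_intros N_scale)
  show "bnorm quot x \<le> bnorm quot y" if "ble quot (babs quot x) (babs quot y)"
  proof -
    \<comment> \<open>The inequality of absolute values is known modulo null functions only, hence
      the extra term.\<close>
    have "N u \<le> N v + N (\<lambda>t. max (\<bar>u t\<bar> - \<bar>v t\<bar>) 0)"
      by (rule N_dominated) (use uv in \<open>auto intro!: mem_intros\<close>)
    then show ?thesis using that uv by (simp add: mem_intros)
  qed
next
  fix X :: "nat \<Rightarrow> nat \<Rightarrow> real"
  assume X: "\<And>n. X n \<in> bcarrier quot"
    "\<And>e. 0 < e \<Longrightarrow> \<exists>N. \<forall>i\<ge>N. \<forall>j\<ge>N. bnorm quot (bdiff quot (X i) (X j)) < e"
  have "\<forall>n. \<exists>u. u \<in> M \<and> X n = cls u" using X(1) by auto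
  then obtain u where u: "\<And>n. u n \<in> M" "\<And>n. X n = cls (u n)" by metis
  have "cauchy_in u" using X(2) u by (simp add: cauchy_in_def mem_intros)
  then obtain x where "x \<in> M" "(\<lambda>n. N (\<lambda>t. u n t - x t)) \<longlonglongrightarrow> 0" using complete u(1) by blast
  then show "\<exists>x\<in>bcarrier quot. (\<lambda>n. bnorm quot (bdiff quot (X n) x)) \<longlonglongrightarrow> 0"
    using u by (auto simp: mem_intros intro!: bexI[of _ x])
qed

end

section \<open>Completion by Cauchy sequences\<close>

context fun_lattice
begin

text \<open>A sequence of functions is coded as one function on pairs, so that the Cauchy sequences
  form a function lattice again and the quotient construction above applies to them.\<close>

definition cauchy_seqs :: "(nat \<times> 't \<Rightarrow> real) set" where
  "cauchy_seqs = {s. (\<forall>k. (\<lambda>t. s (k, t)) \<in> M) \<and> cauchy_in (\<lambda>k t. s (k, t))}"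

definition N_lim :: "(nat \<times> 't \<Rightarrow> real) \<Rightarrow> real" where
  "N_lim s = lim (\<lambda>k. N (\<lambda>t. s (k, t)))"

lemma cauchy_seqsD: "s \<in> cauchy_seqs \<Longrightarrow> (\<lambda>t. s (k, t)) \<in> M"
  "s \<in> cauchy_seqs \<Longrightarrow> cauchy_in (\<lambda>k t. s (k, t))"
  by (auto simp: cauchy_seqs_def)

lemma N_lim:
  assumes "s \<in> cauchy_seqs"
  shows "(\<lambda>k. N (\<lambda>t. s (k, t))) \<longlonglongrightarrow> N_lim s"
proof -
  have "Cauchy (\<lambda>k. N (\<lambda>t. s (k, t)))"
  proof (rule metric_CauchyI)
    fix e :: real assume "0 < e"
    then obtain K where "\<forall>i\<ge>K. \<forall>j\<ge>K. N (\<lambda>t. s (i, t) - s (j, t)) < e"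
      using cauchy_inD[OF cauchy_seqsD(2)[OF assms]] by blast
    moreover have "dist (N (\<lambda>t. s (i, t))) (N (\<lambda>t. s (j, t))) \<le> N (\<lambda>t. s (i, t) - s (j, t))" for i j
      unfolding dist_real_def by (intro N_diff_ge cauchy_seqsD assms)
    ultimately show "\<exists>K. \<forall>i\<ge>K. \<forall>j\<ge>K. dist (N (\<lambda>t. s (i, t))) (N (\<lambda>t. s (j, t))) < e"
      by (meson le_less_trans)
  qed
  then show ?thesis
    by (simp add: N_lim_def Cauchy_convergent_iff convergent_LIMSEQ_iff)
qed

lemma N_lim_eq: "s \<in> cauchy_seqs \<Longrightarrow> (\<lambda>k. N (\<lambda>t. s (k, t))) \<longlonglongrightarrow> l \<Longrightarrow> N_lim s = l"
  using N_lim LIMSEQ_unique by blast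

lemma const_cauchy_seqs: "u \<in> M \<Longrightarrow> (\<lambda>(k, t). u t) \<in> cauchy_seqs"
  by (auto simp: cauchy_seqs_def cauchy_in_def)

lemma N_lim_const: "u \<in> M \<Longrightarrow> N_lim (\<lambda>(k, t). u t) = N u"
  by (rule N_lim_eq) (auto simp: const_cauchy_seqs)

lemma fun_lattice_cauchy_seqs: "fun_lattice cauchy_seqs N_lim"
proof
  show zero: "(\<lambda>_. 0) \<in> cauchy_seqs"
    using const_cauchy_seqs[OF zero_mem] by (simp add: case_prod_unfold)
  fix u v :: "nat \<times> 't \<Rightarrow> real" and r :: real
  assume u: "u \<in> cauchy_seqs" 
  have r: "\<bar>r * x - r * y\<bar> \<le> 2 * ((\<bar>r\<bar> + 1) * \<bar>x - y\<bar>)" for x y :: real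
  proof -
    have "\<bar>r * x - r * y\<bar> = \<bar>r\<bar> * \<bar>x - y\<bar>" by (metis abs_mult right_diff_distrib)
    also have "\<dots> \<le> (\<bar>r\<bar> + 1) * \<bar>x - y\<bar>" by (rule mult_right_mono) auto
    also have "\<dots> \<le> 2 * ((\<bar>r\<bar> + 1) * \<bar>x - y\<bar>)" by simp
    finally show ?thesis .
  qed
  \<comment> \<open>\<open>cauchy_in_combine\<close> takes two sequences and a positive constant:
    \<open>u\<close> serves as both sequences, and \<open>\<bar>r\<bar> + 1\<close> is positive even
    for \<open>r = 0\<close>.\<close>
  have "cauchy_in (\<lambda>k t. r * u (k, t))"
    by (rule cauchy_in_combine[of "\<lambda>k t. u (k, t)" "\<lambda>k t. u (k, t)" _ "\<bar>r\<bar> + 1"])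
      (auto simp: r cauchy_seqsD u scale_mem)
  then show scale: "(\<lambda>t. r * u t) \<in> cauchy_seqs"
    by (simp add: cauchy_seqs_def scale_mem[OF cauchy_seqsD(1)[OF u]])
  show "N_lim (\<lambda>t. r * u t) = \<bar>r\<bar> * N_lim u"
    by (rule N_lim_eq[OF scale]) (use N_lim[OF u] in \<open>auto intro!: tendsto_intros simp: N_scale cauchy_seqsD u\<close>)
  assume v: "v \<in> cauchy_seqs"
  note uv = cauchy_seqsD[OF u] cauchy_seqsD[OF v]
  have "cauchy_in (\<lambda>k t. u (k, t) + v (k, t))"
    by (rule cauchy_in_combine[of "\<lambda>k t. u (k, t)" "\<lambda>k t. v (k, t)" _ 1])
      (auto simp: uv add_mem max_mem)
  then show add: "(\<lambda>t. u t + v t) \<in> cauchy_seqs"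
    by (auto simp: cauchy_seqs_def uv add_mem max_mem)
  have "cauchy_in (\<lambda>k t. max (u (k, t)) (v (k, t)))"
    by (rule cauchy_in_combine[of "\<lambda>k t. u (k, t)" "\<lambda>k t. v (k, t)" _ 1])
      (auto simp: uv add_mem max_mem)
  then show "(\<lambda>t. max (u t) (v t)) \<in> cauchy_seqs"
    by (auto simp: cauchy_seqs_def uv add_mem max_mem)
  show "N_lim (\<lambda>t. u t + v t) \<le> N_lim u + N_lim v"
    by (rule LIMSEQ_le[OF N_lim[OF add] tendsto_add[OF N_lim[OF u] N_lim[OF v]]])
      (auto intro!: N_triangle simp: uv)
  show "N_lim u \<le> N_lim v" if "\<And>t. \<bar>u t\<bar> \<le> \<bar>v t\<bar>"
    by (rule LIMSEQ_le[OF N_lim[OF u] N_lim[OF v]]) (auto intro!: N_mono simp: uv that)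
qed

end

locale separable_fun_lattice = fun_lattice M N for M :: "('t \<Rightarrow> real) set" and N +
  fixes d :: "nat \<Rightarrow> 't \<Rightarrow> real"
  assumes d_mem: "d n \<in> M"
    and d_dense: "u \<in> M \<Longrightarrow> 0 < e \<Longrightarrow> \<exists>n. N (\<lambda>t. u t - d n t) < e"
begin

text \<open>The Cauchy condition survives the limit in \<open>k\<close>: a Cauchy sequence is close
  to the constant sequences of its late terms. Both the density of the constants and the
  completeness below rest on this.\<close>

lemma cauchy_seqs_tail:
  assumes "s \<in> cauchy_seqs" "0 < e"
  shows "\<exists>K. \<forall>i\<ge>K. N_lim (\<lambda>(k, t). s (k, t) - s (i, t)) \<le> e"
proof -
  interpret C: fun_lattice cauchy_seqs N_lim by (rule fun_lattice_cauchy_seqs)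
  obtain K where K: "\<forall>i\<ge>K. \<forall>j\<ge>K. N (\<lambda>t. s (i, t) - s (j, t)) < e"
    using cauchy_inD[OF cauchy_seqsD(2)[OF assms(1)] assms(2)] by blast
  have "N_lim (\<lambda>(k, t). s (k, t) - s (i, t)) \<le> e" if "i \<ge> K" for i
  proof -
    have "(\<lambda>(k, t). s (k, t) - s (i, t)) \<in> cauchy_seqs"
      using C.diff_mem[OF assms(1) const_cauchy_seqs[OF cauchy_seqsD(1)[OF assms(1), of i]]]
      by (simp add: case_prod_unfold)
    from N_lim[OF this] show ?thesis
      by (rule LIMSEQ_le_const2) (use K that in \<open>auto intro!: exI[of _ K] less_imp_le\<close>)
  qed
  then show ?thesis by blast
qed

sublocale completion: complete_fun_lattice cauchy_seqs N_lim "\<lambda>n (k, t). d n t"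
proof -
  interpret C: fun_lattice cauchy_seqs N_lim by (rule fun_lattice_cauchy_seqs)
  show "complete_fun_lattice cauchy_seqs N_lim (\<lambda>n (k, t). d n t)"
  proof
    show "(\<lambda>(k, t). d n t) \<in> cauchy_seqs" for n by (rule const_cauchy_seqs[OF d_mem])
  next
    fix s and e :: real assume s: "s \<in> cauchy_seqs" and "0 < e"
    then obtain K where K: "\<And>i. i \<ge> K \<Longrightarrow> N_lim (\<lambda>(k, t). s (k, t) - s (i, t)) \<le> e / 2"
      using cauchy_seqs_tail[of s "e / 2"] by auto
    have sK: "(\<lambda>t. s (K, t)) \<in> M" using s by (rule cauchy_seqsD)
    obtain n where n: "N (\<lambda>t. s (K, t) - d n t) < e / 2"
      using d_dense[OF sK, of "e / 2"] \<open>0 < e\<close> by auto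
    have "N_lim (\<lambda>t. s t - (case t of (k, t) \<Rightarrow> d n t)) \<le>
       N_lim (\<lambda>x. s x - (case x of (k, t) \<Rightarrow> s (K, t))) +
       N_lim (\<lambda>x. (case x of (k, t) \<Rightarrow> s (K, t)) - (case x of (k, t) \<Rightarrow> d n t))"
      by (intro C.N_diff_triangle s const_cauchy_seqs sK d_mem)
    also have "\<dots> < e"
      using K[of K] n N_lim_const[OF diff_mem[OF sK d_mem[of n]]] by (simp add: case_prod_unfold)
    finally show "\<exists>n. N_lim (\<lambda>t. s t - (case t of (k, t) \<Rightarrow> d n t)) < e" by blast
  next
    fix X assume X: "\<And>n. X n \<in> cauchy_seqs" and cau: "C.cauchy_in X"
    \<comment> \<open>Completeness by a diagonal choice: \<open>X n\<close> is replaced by the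
      constant sequence of one of its terms \<open>y n\<close>, at distance at most
      \<open>1 / (n + 1)\<close>. Then \<open>y\<close> is Cauchy in \<open>M\<close>, and
      \<open>y\<close> itself, read as a member of \<open>cauchy_seqs\<close>, is the limit.\<close>
    have "\<exists>K. N_lim (\<lambda>(k, t). X n (k, t) - X n (K, t)) \<le> inverse (Suc n)" for n
      using cauchy_seqs_tail[OF X, of "inverse (Suc n)" n] by fastforce
    then obtain K where K: "\<And>n. N_lim (\<lambda>(k, t). X n (k, t) - X n (K n, t)) \<le> inverse (Suc n)"
      by metis
    define y where "y = (\<lambda>n t. X n (K n, t))"
    have yM: "y n \<in> M" for n unfolding y_def by (rule cauchy_seqsD[OF X])
    have yC: "(\<lambda>(k, t). y n t) \<in> cauchy_seqs" for n by (rule const_cauchy_seqs[OF yM])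
    have Ky: "N_lim (\<lambda>x. X n x - (case x of (k, t) \<Rightarrow> y n t)) \<le> inverse (Suc n)" for n
      using K[of n] by (simp add: y_def case_prod_unfold)
    have small: "\<exists>L. \<forall>n\<ge>L. inverse (real (Suc n)) < e" if "0 < e" for e
    proof -
      obtain L where L: "inverse (real (Suc L)) < e" using reals_Archimedean[OF \<open>0 < e\<close>] by blast
      have "inverse (real (Suc n)) < e" if "n \<ge> L" for n
        using that by (intro le_less_trans[OF _ L] le_imp_inverse_le) auto
      then show ?thesis by blast
    qed
    have ycau: "cauchy_in y"
      unfolding cauchy_in_def
    proof (intro allI impI)
      fix e :: real assume "0 < e"
      then obtain L1 L2 where L1: "\<And>i j. i \<ge> L1 \<Longrightarrow> j \<ge> L1 \<Longrightarrow> N_lim (\<lambda>t. X i t - X j t) < e / 3"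
        and L2: "\<And>n. n \<ge> L2 \<Longrightarrow> inverse (real (Suc n)) < e / 3"
        using C.cauchy_inD[OF cau, of "e / 3"] small[of "e / 3"] by auto
      have "N (\<lambda>t. y i t - y j t) < e" if "i \<ge> max L1 L2" "j \<ge> max L1 L2" for i j
      proof -
        have "N (\<lambda>t. y i t - y j t) = N_lim (\<lambda>x. (case x of (k, t) \<Rightarrow> y i t) - (case x of (k, t) \<Rightarrow> y j t))"
          using N_lim_const[OF diff_mem[OF yM[of i] yM[of j]]] by (simp add: case_prod_unfold)
        also have "\<dots> \<le> N_lim (\<lambda>x. (case x of (k, t) \<Rightarrow> y i t) - X i x) + N_lim (\<lambda>x. X i x - (case x of (k, t) \<Rightarrow> y j t))"
          by (rule C.N_diff_triangle[OF yC X yC])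
        also have "\<dots> \<le> N_lim (\<lambda>x. X i x - (case x of (k, t) \<Rightarrow> y i t)) + (N_lim (\<lambda>x. X i x - X j x) + N_lim (\<lambda>x. X j x - (case x of (k, t) \<Rightarrow> y j t)))"
          using C.N_diff_triangle[OF X[of i] X[of j] yC[of j]] C.N_minus_commute[OF X[of i] yC[of i]] by simp
        also have "\<dots> < e / 3 + (e / 3 + e / 3)"
          using Ky[of i] Ky[of j] L1[of i j] L2[of i] L2[of j] that by (intro add_strict_mono) auto
        finally show ?thesis by simp
      qed
      then show "\<exists>K. \<forall>i\<ge>K. \<forall>j\<ge>K. N (\<lambda>t. y i t - y j t) < e" by blast
    qed
    define z where "z = (\<lambda>(k, t). y k t)"
    have z: "z \<in> cauchy_seqs" using ycau yM by (auto simp: cauchy_seqs_def z_def)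
    have "(\<lambda>n. N_lim (\<lambda>t. X n t - z t)) \<longlonglongrightarrow> 0"
    proof (rule LIMSEQ_I)
      fix e :: real assume "0 < e"
      then obtain L1 L2 where L1: "\<And>i. i \<ge> L1 \<Longrightarrow> N_lim (\<lambda>(k, t). z (k, t) - z (i, t)) \<le> e / 3"
        and L2: "\<And>n. n \<ge> L2 \<Longrightarrow> inverse (real (Suc n)) < e / 3"
        using cauchy_seqs_tail[OF z, of "e / 3"] small[of "e / 3"] by auto
      have "norm (N_lim (\<lambda>t. X n t - z t) - 0) < e" if "n \<ge> max L1 L2" for n
      proof -
        have "N_lim (\<lambda>t. X n t - z t) \<le> N_lim (\<lambda>x. X n x - (case x of (k, t) \<Rightarrow> y n t)) + N_lim (\<lambda>x. (case x of (k, t) \<Rightarrow> y n t) - z x)"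
          by (rule C.N_diff_triangle[OF X yC z])
        also have "\<dots> \<le> e / 3 + e / 3"
          using Ky[of n] L1[of n] L2[of n] that C.N_minus_commute[OF z yC[of n]]
          by (intro add_mono) (auto simp: z_def case_prod_unfold)
        finally show ?thesis using C.N_nonneg[OF C.diff_mem[OF X z]] \<open>0 < e\<close> by simp
      qed
      then show "\<exists>L. \<forall>n\<ge>L. norm (N_lim (\<lambda>t. X n t - z t) - 0) < e" by blast
    qed
    then show "\<exists>x\<in>cauchy_seqs. (\<lambda>n. N_lim (\<lambda>t. X n t - x t)) \<longlonglongrightarrow> 0" using z by blast
  qed
qed

end

section \<open>Separability and finite generation\<close>

inductive_set fun_gen :: "('t \<Rightarrow> real) set \<Rightarrow> ('t \<Rightarrow> real) set" for G where
  zero: "(\<lambda>_. 0) \<in> fun_gen G"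
| gen: "g \<in> G \<Longrightarrow> g \<in> fun_gen G"
| add: "u \<in> fun_gen G \<Longrightarrow> v \<in> fun_gen G \<Longrightarrow> (\<lambda>t. u t + v t) \<in> fun_gen G"
| scale: "u \<in> fun_gen G \<Longrightarrow> (\<lambda>t. r * u t) \<in> fun_gen G"
| max: "u \<in> fun_gen G \<Longrightarrow> v \<in> fun_gen G \<Longrightarrow> (\<lambda>t. max (u t) (v t)) \<in> fun_gen G"

text \<open>A countable syntax for lattice polynomials with rational coefficients, whose values will
  be the dense sequence.\<close>

datatype rat_term = RZero | RGen nat | RAdd rat_term rat_term | RScale rat rat_term | RMax rat_term rat_term

instance rat_term :: countable by countable_datatype

fun rat_eval :: "('t \<Rightarrow> real) list \<Rightarrow> rat_term \<Rightarrow> 't \<Rightarrow> real" where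
  "rat_eval gs RZero = (\<lambda>_. 0)"
| "rat_eval gs (RGen i) = (if i < length gs then gs ! i else (\<lambda>_. 0))"
| "rat_eval gs (RAdd p q) = (\<lambda>t. rat_eval gs p t + rat_eval gs q t)"
| "rat_eval gs (RScale r p) = (\<lambda>t. of_rat r * rat_eval gs p t)"
| "rat_eval gs (RMax p q) = (\<lambda>t. max (rat_eval gs p t) (rat_eval gs q t))"

lemma rat_eval_mem: "rat_eval gs p \<in> fun_gen (set gs)"
  by (induction p) (auto intro: fun_gen.intros)

text \<open>All operations are continuous for \<open>N\<close>, so induction over the generation
  suffices. Only multiples, where a real factor becomes rational, need errors of two kinds.\<close>

lemma separable_fun_gen:
  assumes "fun_lattice (fun_gen (set gs)) N"
  shows "separable_fun_lattice (fun_gen (set gs)) N (\<lambda>n. rat_eval gs (from_nat n))"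
proof -
  interpret fun_lattice "fun_gen (set gs)" N by fact
  have dense: "\<exists>p. N (\<lambda>t. u t - rat_eval gs p t) < e" if "u \<in> fun_gen (set gs)" "0 < e" for u e
    using that
  proof (induction arbitrary: e)
    case zero
    then show ?case by (intro exI[of _ RZero]) simp
  next
    case (gen g)
    then obtain i where "i < length gs" "g = gs ! i" by (auto simp: in_set_conv_nth)
    then show ?case using gen by (intro exI[of _ "RGen i"]) simp
  next
    case (add u v)
    obtain p q where p: "N (\<lambda>t. u t - rat_eval gs p t) < e / 2" and q: "N (\<lambda>t. v t - rat_eval gs q t) < e / 2"
      using add.IH[of "e / 2"] add.prems by auto
    have "N (\<lambda>t. u t + v t - rat_eval gs (RAdd p q) t)
        \<le> N (\<lambda>t. u t - rat_eval gs p t) + N (\<lambda>t. v t - rat_eval gs q t)"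
      by (rule N_dominated) (auto intro!: mem_intros rat_eval_mem add.hyps)
    also have "\<dots> < e" using p q by simp
    finally show ?case by blast
  next
    case (max u v)
    obtain p q where p: "N (\<lambda>t. u t - rat_eval gs p t) < e / 2" and q: "N (\<lambda>t. v t - rat_eval gs q t) < e / 2"
      using max.IH[of "e / 2"] max.prems by auto
    have "N (\<lambda>t. Orderings.max (u t) (v t) - rat_eval gs (RMax p q) t)
        \<le> N (\<lambda>t. u t - rat_eval gs p t) + N (\<lambda>t. v t - rat_eval gs q t)"
      by (rule N_dominated) (auto intro!: mem_intros rat_eval_mem max.hyps)
    also have "\<dots> < e" using p q by simp
    finally show ?case by blast
  next
    case (scale u r)
    have Nu: "0 \<le> N u" by (rule N_nonneg[OF scale.hyps])
    \<comment> \<open>\<open>\<bar>r - q\<bar> * N u\<close> has to stay below \<open>e / 2\<close>;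
      the summand 1 avoids a division by zero. The tolerance for \<open>p\<close> depends on the
      chosen \<open>q\<close> in the same way.\<close>
    obtain q where q: "r < real_of_rat q" "real_of_rat q < r + e / (2 * (N u + 1))"
      using of_rat_dense[of r "r + e / (2 * (N u + 1))"] scale.prems Nu by auto
    have "0 < e / (2 * (\<bar>real_of_rat q\<bar> + 1))"
      using scale.prems by (intro divide_pos_pos mult_pos_pos) (simp_all add: add_nonneg_pos)
    then obtain p where p: "N (\<lambda>t. u t - rat_eval gs p t) < e / (2 * (\<bar>real_of_rat q\<bar> + 1))"
      using scale.IH by blast
    have "N (\<lambda>t. r * u t - rat_eval gs (RScale q p) t)
        \<le> N (\<lambda>t. (r - real_of_rat q) * u t) + N (\<lambda>t. real_of_rat q * (u t - rat_eval gs p t))"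
    proof (rule N_dominated)
      fix t
      have "r * u t - rat_eval gs (RScale q p) t
          = (r - real_of_rat q) * u t + real_of_rat q * (u t - rat_eval gs p t)"
        by (simp add: algebra_simps)
      then show "\<bar>r * u t - rat_eval gs (RScale q p) t\<bar>
          \<le> \<bar>(r - real_of_rat q) * u t\<bar> + \<bar>real_of_rat q * (u t - rat_eval gs p t)\<bar>"
        by (simp only: abs_triangle_ineq)
    qed (intro mem_intros rat_eval_mem scale.hyps)+
    also have "\<dots> = \<bar>r - real_of_rat q\<bar> * N u + \<bar>real_of_rat q\<bar> * N (\<lambda>t. u t - rat_eval gs p t)"
      by (subst (1 2) N_scale) (intro mem_intros rat_eval_mem scale.hyps refl)+
    also have "\<dots> \<le> e / (2 * (N u + 1)) * N u + \<bar>real_of_rat q\<bar> * (e / (2 * (\<bar>real_of_rat q\<bar> + 1)))"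
      using p q Nu by (intro add_mono mult_right_mono mult_left_mono) auto
    also have "\<dots> < e / 2 + e / 2"
    proof (rule add_strict_mono)
      have aux: "e / (2 * (c + 1)) * c < e / 2" if "0 \<le> c" for c
        using that scale.prems by (simp add: field_simps)
      show "e / (2 * (N u + 1)) * N u < e / 2" by (rule aux[OF Nu])
      show "\<bar>real_of_rat q\<bar> * (e / (2 * (\<bar>real_of_rat q\<bar> + 1))) < e / 2"
        using aux[of "\<bar>real_of_rat q\<bar>"] by (simp only: mult.commute abs_ge_zero simp_thms True_implies_equals)
    qed
    finally show ?case by (intro exI[of _ "RScale q p"]) simp
  qed
  show ?thesis
  proof
    fix u and e :: real assume "u \<in> fun_gen (set gs)" "0 < e"
    then obtain p where "N (\<lambda>t. u t - rat_eval gs p t) < e" using dense by blast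
    then show "\<exists>n. N (\<lambda>t. u t - rat_eval gs (from_nat n) t) < e"
      by (intro exI[of _ "to_nat p"]) simp
  qed (rule rat_eval_mem)
qed

context separable_fun_lattice
begin

abbreviation embed :: "('t \<Rightarrow> real) \<Rightarrow> nat \<Rightarrow> real" where
  "embed u \<equiv> completion.cls (\<lambda>(k, t). u t)"

lemma embed_add:
  assumes "u \<in> M" "v \<in> M"
  shows "badd completion.quot (embed u) (embed v) = embed (\<lambda>t. u t + v t)"
proof -
  have "(\<lambda>x. (case x of (k, t) \<Rightarrow> u t) + (case x of (k, t) \<Rightarrow> v t)) = (\<lambda>(k :: nat, t). u t + v t)" by auto
  then show ?thesis using completion.quot_add[OF const_cauchy_seqs const_cauchy_seqs, OF assms] by simp
qed

lemma embed_scale: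
  assumes "u \<in> M"
  shows "bscale completion.quot r (embed u) = embed (\<lambda>t. r * u t)"
proof -
  have "(\<lambda>x. r * (case x of (k, t) \<Rightarrow> u t)) = (\<lambda>(k :: nat, t). r * u t)" by auto
  then show ?thesis using completion.quot_scale[OF const_cauchy_seqs, OF assms] by simp
qed

lemma embed_sup:
  assumes "u \<in> M" "v \<in> M"
  shows "bsup completion.quot (embed u) (embed v) = embed (\<lambda>t. max (u t) (v t))"
proof -
  have "(\<lambda>x. max (case x of (k, t) \<Rightarrow> u t) (case x of (k, t) \<Rightarrow> v t)) = (\<lambda>(k :: nat, t). max (u t) (v t))"
    by auto
  then show ?thesis using completion.quot_sup[OF const_cauchy_seqs const_cauchy_seqs, OF assms] by simp
qed

lemma embed_inf:
  assumes "u \<in> M" "v \<in> M"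
  shows "binf completion.quot (embed u) (embed v) = embed (\<lambda>t. min (u t) (v t))"
proof -
  have "(\<lambda>x. min (case x of (k, t) \<Rightarrow> u t) (case x of (k, t) \<Rightarrow> v t)) = (\<lambda>(k :: nat, t). min (u t) (v t))"
    by auto
  then show ?thesis using completion.quot_inf[OF const_cauchy_seqs const_cauchy_seqs, OF assms] by simp
qed

lemma embed_norm: "u \<in> M \<Longrightarrow> bnorm completion.quot (embed u) = N u"
  by (simp add: const_cauchy_seqs N_lim_const)

text \<open>A closed sublattice containing the generators contains the constant sequences over
  \<open>fun_gen\<close>, by induction, and every Cauchy sequence is the limit of the constant
  sequences of its terms.\<close>

lemma finitely_generated_completion:
  assumes "M = fun_gen (set gs)"
  shows "finitely_generated completion.quot"
  unfolding finitely_generated_def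
proof (intro exI[of _ "map embed gs"] conjI)
  have gM: "g \<in> M" if "g \<in> set gs" for g using that assms by (auto intro: fun_gen.gen)
  then show sub: "set (map embed gs) \<subseteq> bcarrier completion.quot"
    by (auto intro!: imageI const_cauchy_seqs)
  let ?Y = "{S. closed_sublattice_in completion.quot S \<and> set (map embed gs) \<subseteq> S}"
  show "\<Inter> ?Y = bcarrier completion.quot"
  proof
    interpret B: banach_lattice_on completion.quot by (rule completion.banach_lattice_on_quot)
    have "bcarrier completion.quot \<in> ?Y"
      using sub B.zero_closed B.add_closed B.sup_closed B.inf_closed B.scale_closed
      by (auto simp: closed_sublattice_in_def simp del: completion.quot_carrier completion.quot_zero)
    then show "\<Inter> ?Y \<subseteq> bcarrier completion.quot" by blast
    show "bcarrier completion.quot \<subseteq> \<Inter> ?Y"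
    proof clarify
      fix x S assume x: "x \<in> bcarrier completion.quot"
        and S: "closed_sublattice_in completion.quot S" "set (map embed gs) \<subseteq> S"
      have S_ops: "bzero completion.quot \<in> S"
        "\<And>x y. x \<in> S \<Longrightarrow> y \<in> S \<Longrightarrow> badd completion.quot x y \<in> S"
        "\<And>x y. x \<in> S \<Longrightarrow> y \<in> S \<Longrightarrow> bsup completion.quot x y \<in> S"
        "\<And>r x. x \<in> S \<Longrightarrow> bscale completion.quot r x \<in> S"
        "\<And>X x. (\<And>n::nat. X n \<in> S) \<Longrightarrow> x \<in> bcarrier completion.quot \<Longrightarrow>
          (\<lambda>n. bnorm completion.quot (bdiff completion.quot (X n) x)) \<longlonglongrightarrow> 0 \<Longrightarrow> x \<in> S"
        using S(1) unfolding closed_sublattice_in_def by blast+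
      have const: "embed u \<in> S" if "u \<in> fun_gen (set gs)" for u
        using that
      proof induction
        case zero
        have "(\<lambda>(k :: nat, t :: 't). 0 :: real) = (\<lambda>_. 0)" by auto
        then show ?case using S_ops(1) by simp
      next
        case (gen g)
        then show ?case using S(2) by auto
      next
        case (add u v)
        then show ?case using S_ops(2)[OF add.IH] embed_add[of u v] assms by simp
      next
        case (scale u r)
        then show ?case using S_ops(4)[OF scale.IH, of r] embed_scale[of u r] assms by simp
      next
        case (max u v)
        then show ?case using S_ops(3)[OF max.IH] embed_sup[of u v] assms by simp
      qed
      obtain s where s: "s \<in> cauchy_seqs" "x = completion.cls s" using x by auto
      have sM: "(\<lambda>t. s (n, t)) \<in> M" for n using s(1) by (rule cauchy_seqsD)
      show "x \<in> S"
      proof (rule S_ops(5))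
        show "embed (\<lambda>t. s (n, t)) \<in> S" for n using const sM assms by simp
        show "x \<in> bcarrier completion.quot" by (rule x)
        have split: "(\<lambda>x. s x - (case x of (k, t) \<Rightarrow> s (n, t))) = (\<lambda>(k, t). s (k, t) - s (n, t))" for n
          by auto
        have eq: "bnorm completion.quot (bdiff completion.quot (embed (\<lambda>t. s (n, t))) x)
            = N_lim (\<lambda>(k, t). s (k, t) - s (n, t))" for n
          using completion.N_minus_commute[OF s(1) const_cauchy_seqs[OF sM[of n]]]
            completion.diff_mem[OF const_cauchy_seqs[OF sM[of n]] s(1)]
          by (simp add: s const_cauchy_seqs[OF sM] split)
        show "(\<lambda>n. bnorm completion.quot (bdiff completion.quot (embed (\<lambda>t. s (n, t))) x)) \<longlonglongrightarrow> 0"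
          unfolding eq
        proof (rule LIMSEQ_I)
          fix e :: real assume "0 < e"
          then obtain K where K: "\<And>n. n \<ge> K \<Longrightarrow> N_lim (\<lambda>(k, t). s (k, t) - s (n, t)) \<le> e / 2"
            using cauchy_seqs_tail[OF s(1), of "e / 2"] by auto
          have "0 \<le> N_lim (\<lambda>(k, t). s (k, t) - s (n, t))" for n
            using completion.N_nonneg[OF completion.diff_mem[OF s(1) const_cauchy_seqs[OF sM[of n]]]]
            by (simp add: split)
          then show "\<exists>L. \<forall>n\<ge>L. norm (N_lim (\<lambda>(k, t). s (k, t) - s (n, t)) - 0) < e"
            using \<open>0 < e\<close> by (intro exI[of _ K]) (auto intro: le_less_trans[OF K])
        qed
      qed
    qed
  qed
qed

end

section \<open>Real-valued lattice homomorphisms\<close>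

lemma norm_abs_eq: "norm \<bar>x\<bar> = norm (x::'a::banach_lattice)"
  by (rule antisym; rule norm_mono) simp_all

lemma norm_le_dominated: "\<bar>x\<bar> \<le> y \<Longrightarrow> norm x \<le> norm (y::'a::banach_lattice)"
  by (rule norm_mono) (simp add: abs_of_nonneg[OF order_trans[OF abs_ge_zero]])

lemma norm_mono_nonneg: "0 \<le> x \<Longrightarrow> x \<le> y \<Longrightarrow> norm x \<le> norm (y::'a::banach_lattice)"
  by (rule norm_le_dominated) simp

text \<open>Makes the supremum continuous in norm, and compatible with congruence modulo an order
  ideal.\<close>

lemma sup_diff_le:
  fixes x :: "'a::banach_lattice"
  shows "\<bar>sup x y - sup x' y'\<bar> \<le> \<bar>x - x'\<bar> + \<bar>y - y'\<bar>"
proof -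
  have *: "sup x y \<le> sup x' y' + (\<bar>x - x'\<bar> + \<bar>y - y'\<bar>)" for x y x' y' :: 'a
  proof (rule sup_least)
    have "x - x' \<le> \<bar>x - x'\<bar> + \<bar>y - y'\<bar>" by (intro add_increasing2 abs_ge_zero abs_ge_self)
    from add_mono[OF sup_ge1[of x' y'] this] show "x \<le> sup x' y' + (\<bar>x - x'\<bar> + \<bar>y - y'\<bar>)" by simp
    have "y - y' \<le> \<bar>x - x'\<bar> + \<bar>y - y'\<bar>" by (intro add_increasing abs_ge_zero abs_ge_self)
    from add_mono[OF sup_ge2[of y' x'] this] show "y \<le> sup x' y' + (\<bar>x - x'\<bar> + \<bar>y - y'\<bar>)" by simp
  qed
  show ?thesis
  proof (rule abs_leI)
    show "sup x y - sup x' y' \<le> \<bar>x - x'\<bar> + \<bar>y - y'\<bar>"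
      using *[of x y x' y'] by (simp only: diff_le_eq add.commute)
    show "- (sup x y - sup x' y') \<le> \<bar>x - x'\<bar> + \<bar>y - y'\<bar>"
      using *[of x' y' x y] by (simp only: minus_diff_eq diff_le_eq add.commute abs_minus_commute)
  qed
qed

lemma inf_eq_sup: "inf x y = - sup (- x) (- (y::'a::banach_lattice))"
  by simp

lemma scaleR_sup:
  fixes x :: "'a::banach_lattice"
  assumes "0 \<le> r"
  shows "r *\<^sub>R sup x y = sup (r *\<^sub>R x) (r *\<^sub>R y)"
proof (cases "r = 0")
  case False
  then have r: "0 < r" using assms by simp
  have "sup x y \<le> sup (r *\<^sub>R x) (r *\<^sub>R y) /\<^sub>R r"
    by (intro sup_least) (simp_all add: pos_le_divideR_eq[OF r])
  then have "r *\<^sub>R sup x y \<le> sup (r *\<^sub>R x) (r *\<^sub>R y)"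
    by (simp only: pos_le_divideR_eq[OF r])
  then show ?thesis
    by (intro antisym) (simp_all add: scaleR_left_mono assms)
qed simp

lemma scaleR_inf:
  fixes x :: "'a::banach_lattice"
  assumes "0 \<le> r"
  shows "r *\<^sub>R inf x y = inf (r *\<^sub>R x) (r *\<^sub>R y)"
  using scaleR_sup[OF assms, of "- x" "- y"] by (simp only: inf_eq_sup scaleR_minus_right)

lemma abs_scaleR_lattice: "\<bar>r *\<^sub>R x\<bar> = \<bar>r\<bar> *\<^sub>R \<bar>x::'a::banach_lattice\<bar>"
proof -
  have *: "\<bar>r *\<^sub>R x\<bar> = r *\<^sub>R \<bar>x\<bar>" if "0 \<le> r" for r
    by (simp add: abs_lattice scaleR_sup[OF that])
  show ?thesis using *[of r] *[of "- r"] by (cases "0 \<le> r") auto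
qed

text \<open>The left side is bounded both by \<open>inf v a + b\<close> and by
  \<open>inf v a + v\<close>, hence by their infimum, to which translation invariance
  applies.\<close>

lemma inf_add_le:
  fixes v :: "'a::banach_lattice"
  assumes "0 \<le> v" "0 \<le> a" "0 \<le> b"
  shows "inf v (a + b) \<le> inf v a + inf v b"
proof -
  have "inf v (a + b) - b \<le> inf v a"
    using assms by (simp add: diff_le_eq add_increasing2 le_infI1 le_infI2)
  then have "inf v (a + b) \<le> inf v a + b" by (simp only: diff_le_eq)
  moreover have "inf v (a + b) \<le> inf v a + v"
    using assms by (intro le_infI1 add_increasing) simp_all
  ultimately have "inf v (a + b) \<le> inf (inf v a + v) (inf v a + b)" by (rule le_infI[rotated])
  then show ?thesis by (simp add: add_inf_distrib_left)
qed

lemma inf_scaleR_eq_0: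
  fixes v :: "'a::banach_lattice"
  assumes "0 \<le> v" "0 \<le> a" "inf v a = 0" "0 \<le> c"
  shows "inf v (c *\<^sub>R a) = 0"
proof (rule antisym)
  have "inf v (c *\<^sub>R a) \<le> inf (max 1 c *\<^sub>R v) (max 1 c *\<^sub>R a)"
    using scaleR_right_mono[of 1 "max 1 c" v] scaleR_right_mono[of c "max 1 c" a] assms
    by (intro inf_mono) auto
  also have "\<dots> = 0" using scaleR_inf[of "max 1 c" v a] assms by simp
  finally show "inf v (c *\<^sub>R a) \<le> 0" .
  show "0 \<le> inf v (c *\<^sub>R a)" using assms by (simp add: scaleR_nonneg_nonneg)
qed

lemma inf_pprt_uminus: "inf (pprt x) (pprt (- x)) = (0::'a::banach_lattice)"
proof -
  have "inf (pprt x - pprt x) (pprt (- x) - pprt x) = inf (pprt x) (pprt (- x)) - pprt x"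
    using add_inf_distrib_right[of "pprt x" "pprt (- x)" "- pprt x"] by simp
  moreover have "pprt (- x) - pprt x = - x"
    using prts[of x] by (simp add: pprt_neg algebra_simps)
  ultimately have "inf (pprt x) (pprt (- x)) = pprt x + inf 0 (- x)" by (simp add: algebra_simps)
  also have "inf 0 (- x) = - pprt x" by (simp add: pprt_def inf_commute)
  finally show ?thesis by simp
qed

text \<open>The Archimedean property, forced by the norm: the positive part of \<open>x\<close> has
  norm at most \<open>r\<close> for every positive \<open>r\<close>.\<close>

lemma le_zero_of_le_small:
  fixes x :: "'a::banach_lattice"
  assumes "0 \<le> y" "\<And>r. 0 < r \<Longrightarrow> x \<le> r *\<^sub>R y"
  shows "x \<le> 0"
proof -
  have "norm (pprt x) \<le> r" if "0 < r" for r
  proof -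
    have r': "0 < r / (norm y + 1)" using that by (simp add: add_nonneg_pos)
    have "pprt x \<le> (r / (norm y + 1)) *\<^sub>R y"
      using assms(2)[OF r'] assms(1) r' by (simp add: pprt_def scaleR_nonneg_nonneg)
    then have "norm (pprt x) \<le> norm ((r / (norm y + 1)) *\<^sub>R y)" by (rule norm_mono_nonneg[OF zero_le_pprt])
    also have "\<dots> = r / (norm y + 1) * norm y" using r' by (simp only: norm_scaleR abs_of_pos)
    also have "\<dots> \<le> r"
      using that add_nonneg_pos[OF norm_ge_zero[of y] zero_less_one] by (simp add: divide_simps algebra_simps)
    finally show ?thesis .
  qed
  then have "norm (pprt x) \<le> 0" by (rule field_le_epsilon) simp
  then show ?thesis by (simp add: le_zero_iff_zero_pprt)
qed

section \<open>Order ideals and real homomorphisms\<close>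

definition principal_ideal :: "'a::banach_lattice \<Rightarrow> 'a set" where
  "principal_ideal e = {x. \<exists>c\<ge>0. \<bar>x\<bar> \<le> c *\<^sub>R e}"

text \<open>Only the values on the ideal matter; the others are arbitrary.\<close>

definition real_homs :: "'a::banach_lattice \<Rightarrow> ('a \<Rightarrow> real) set" where
  "real_homs e = {\<omega>. \<omega> e = 1 \<and>
     (\<forall>x\<in>principal_ideal e. \<forall>y\<in>principal_ideal e.
        \<omega> (x + y) = \<omega> x + \<omega> y \<and> \<omega> (sup x y) = max (\<omega> x) (\<omega> y)) \<and>
     (\<forall>r. \<forall>x\<in>principal_ideal e. \<omega> (r *\<^sub>R x) = r * \<omega> x)}"

definition order_ideal :: "'a::banach_lattice set \<Rightarrow> bool" where
  "order_ideal J \<longleftrightarrow> 0 \<in> J \<and> (\<forall>x\<in>J. \<forall>y\<in>J. x + y \<in> J) \<and> (\<forall>r. \<forall>x\<in>J. r *\<^sub>R x \<in> J) \<and>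
     (\<forall>x\<in>J. \<forall>y. \<bar>y\<bar> \<le> \<bar>x\<bar> \<longrightarrow> y \<in> J)"

lemma order_idealD:
  assumes "order_ideal J"
  shows "0 \<in> J" "x \<in> J \<Longrightarrow> y \<in> J \<Longrightarrow> x + y \<in> J" "x \<in> J \<Longrightarrow> r *\<^sub>R x \<in> J"
    "x \<in> J \<Longrightarrow> \<bar>y\<bar> \<le> \<bar>x\<bar> \<Longrightarrow> y \<in> J" "x \<in> J \<Longrightarrow> \<bar>y\<bar> \<le> x \<Longrightarrow> y \<in> J" "x \<in> J \<Longrightarrow> \<bar>x\<bar> \<in> J"
    "x \<in> J \<Longrightarrow> y \<in> J \<Longrightarrow> x - y \<in> J"
proof -
  show "0 \<in> J" "x \<in> J \<Longrightarrow> y \<in> J \<Longrightarrow> x + y \<in> J" and scale: "x \<in> J \<Longrightarrow> r *\<^sub>R x \<in> J"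
    and solid: "x \<in> J \<Longrightarrow> \<bar>y\<bar> \<le> \<bar>x\<bar> \<Longrightarrow> y \<in> J" for x y r
    using assms by (auto simp: order_ideal_def)
  then show "x \<in> J \<Longrightarrow> y \<in> J \<Longrightarrow> x - y \<in> J" by (metis scaleR_minus1_left uminus_add_conv_diff add.commute)
  show "x \<in> J \<Longrightarrow> \<bar>y\<bar> \<le> x \<Longrightarrow> y \<in> J"
    using solid[of x y] order_trans[OF _ abs_ge_self] by blast
  show "x \<in> J \<Longrightarrow> \<bar>x\<bar> \<in> J" using solid[of x "\<bar>x\<bar>"] by simp
qed

lemma order_ideal_extend:
  assumes J: "order_ideal J" and w: "0 \<le> w"
  shows "order_ideal {v. \<exists>j\<in>J. \<exists>c\<ge>0. \<bar>v\<bar> \<le> j + c *\<^sub>R w}" (is "order_ideal ?J")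
  unfolding order_ideal_def
proof (intro conjI ballI allI impI)
  show "0 \<in> ?J" using order_idealD(1)[OF J] by (auto intro!: exI[of _ 0] bexI[of _ 0])
next
  fix x y assume "x \<in> ?J" "y \<in> ?J"
  then obtain j c k d where "j \<in> J" "0 \<le> c" "\<bar>x\<bar> \<le> j + c *\<^sub>R w" "k \<in> J" "0 \<le> d" "\<bar>y\<bar> \<le> k + d *\<^sub>R w"
    by auto
  moreover from this have "\<bar>x + y\<bar> \<le> (j + k) + (c + d) *\<^sub>R w"
    using order_trans[OF abs_triangle_ineq add_mono] by (fastforce simp: algebra_simps)
  ultimately show "x + y \<in> ?J" using order_idealD(2)[OF J] by (auto intro!: exI[of _ "c + d"] bexI[of _ "j + k"])
next
  fix r x assume "x \<in> ?J"
  then obtain j c where *: "j \<in> J" "0 \<le> c" "\<bar>x\<bar> \<le> j + c *\<^sub>R w" by auto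
  then have "\<bar>r *\<^sub>R x\<bar> \<le> \<bar>r\<bar> *\<^sub>R j + (\<bar>r\<bar> * c) *\<^sub>R w"
    using scaleR_left_mono[OF *(3), of "\<bar>r\<bar>"] by (simp add: abs_scaleR_lattice scaleR_add_right)
  then show "r *\<^sub>R x \<in> ?J" using * order_idealD(3)[OF J, of j "\<bar>r\<bar>"]
    by (auto intro!: exI[of _ "\<bar>r\<bar> * c"] bexI[of _ "\<bar>r\<bar> *\<^sub>R j"])
next
  fix x y assume "x \<in> ?J" "\<bar>y\<bar> \<le> \<bar>x\<bar>"
  then show "y \<in> ?J" by (blast intro: order_trans)
qed

text \<open>The last clause is maximality in the form used later: adding a positive \<open>w\<close>
  outside \<open>J\<close> would put \<open>e\<close> into the ideal, so a multiple of
  \<open>w\<close> dominates \<open>e\<close> modulo \<open>J\<close>.\<close>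

lemma maximal_order_ideal:
  fixes e :: "'a::banach_lattice"
  assumes "order_ideal J0" "e \<notin> J0" and e: "0 \<le> e"
  obtains J where "order_ideal J" "J0 \<subseteq> J" "e \<notin> J"
    "\<And>w. 0 \<le> w \<Longrightarrow> w \<notin> J \<Longrightarrow> \<exists>j\<in>J. \<exists>c\<ge>0. e \<le> j + c *\<^sub>R w"
proof -
  let ?A = "{J. order_ideal J \<and> J0 \<subseteq> J \<and> e \<notin> J}"
  have "\<exists>J\<in>?A. \<forall>X\<in>?A. J \<subseteq> X \<longrightarrow> X = J"
  proof (rule subset_Zorn_nonempty)
    show "?A \<noteq> {}" using assms by auto
    fix C assume C: "C \<noteq> {}" "subset.chain ?A C"
    have chain: "X \<subseteq> Y \<or> Y \<subseteq> X" if "X \<in> C" "Y \<in> C" for X Y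
      using C(2) that by (auto simp: subset.chain_def)
    have CA: "X \<in> ?A" if "X \<in> C" for X using C(2) that by (auto simp: subset.chain_def)
    have "order_ideal (\<Union>C)"
      unfolding order_ideal_def
    proof (intro conjI ballI allI impI)
      show "0 \<in> \<Union>C" using C(1) CA order_idealD(1) by blast
    next
      fix x y assume "x \<in> \<Union>C" "y \<in> \<Union>C"
      then obtain X where "X \<in> C" "x \<in> X" "y \<in> X" using chain by blast
      then show "x + y \<in> \<Union>C" using CA order_idealD(2) by blast
    next
      fix r x assume "x \<in> \<Union>C" then show "r *\<^sub>R x \<in> \<Union>C" using CA order_idealD(3) by blast
    next
      fix x y :: 'a assume "x \<in> \<Union>C" "\<bar>y\<bar> \<le> \<bar>x\<bar>" then show "y \<in> \<Union>C" using CA order_idealD(4) by blast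
    qed
    then show "\<Union>C \<in> ?A" using C(1) CA by blast
  qed
  then obtain J where JA: "J \<in> ?A" and maxA: "\<forall>X\<in>?A. J \<subseteq> X \<longrightarrow> X = J" by (rule bexE)
  then have J: "order_ideal J" "J0 \<subseteq> J" "e \<notin> J" by auto
  have max: "X = J" if "order_ideal X" "e \<notin> X" "J \<subseteq> X" for X
    using maxA[rule_format, of X] that J(2) by auto
  have "\<exists>j\<in>J. \<exists>c\<ge>0. e \<le> j + c *\<^sub>R w" if w: "0 \<le> w" "w \<notin> J" for w
  proof (rule ccontr)
    assume neg: "\<not> ?thesis"
    let ?J = "{v. \<exists>j\<in>J. \<exists>c\<ge>0. \<bar>v\<bar> \<le> j + c *\<^sub>R w}"
    have "e \<notin> ?J" using neg e by simp
    moreover have "J \<subseteq> ?J"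
      using order_idealD(6)[OF J(1)] by (auto intro!: exI[of _ 0])
    ultimately have "?J = J" using max order_ideal_extend[OF J(1) w(1)] by blast
    moreover have "w \<in> ?J" using w order_idealD(1)[OF J(1)] by (auto intro!: exI[of _ 1] bexI[of _ 0])
    ultimately show False using w by blast
  qed
  then show ?thesis using that J by blast
qed

lemma order_ideal_principal: "0 \<le> e \<Longrightarrow> order_ideal (principal_ideal e)"
  using order_ideal_extend[of "{0}" e] by (simp add: order_ideal_def principal_ideal_def)

lemma mem_principal_ideal: "0 \<le> e \<Longrightarrow> \<bar>x\<bar> \<le> e \<Longrightarrow> x \<in> principal_ideal e"
  by (auto simp: principal_ideal_def intro!: exI[of _ 1])

lemma principal_ideal_sup:
  assumes "0 \<le> e" "x \<in> principal_ideal e" "y \<in> principal_ideal e"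
  shows "sup x y \<in> principal_ideal e"
proof -
  note I = order_idealD[OF order_ideal_principal[OF assms(1)]]
  have "sup x y \<le> \<bar>x\<bar> + \<bar>y\<bar>"
    by (auto intro: add_increasing add_increasing2 abs_ge_zero abs_ge_self)
  moreover have "- sup x y \<le> \<bar>x\<bar> + \<bar>y\<bar>"
    by (auto intro!: le_infI1 add_increasing2 abs_ge_zero abs_ge_minus_self)
  ultimately have "\<bar>sup x y\<bar> \<le> \<bar>x\<bar> + \<bar>y\<bar>" by (rule abs_leI)
  then show ?thesis using I(5) I(2) I(6) assms by blast
qed

lemma real_homsD:
  assumes "\<omega> \<in> real_homs e"
  shows "\<omega> e = 1" "x \<in> principal_ideal e \<Longrightarrow> \<omega> (r *\<^sub>R x) = r * \<omega> x"
    "x \<in> principal_ideal e \<Longrightarrow> y \<in> principal_ideal e \<Longrightarrow> \<omega> (x + y) = \<omega> x + \<omega> y"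
    "x \<in> principal_ideal e \<Longrightarrow> y \<in> principal_ideal e \<Longrightarrow> \<omega> (sup x y) = max (\<omega> x) (\<omega> y)"
    "x \<in> principal_ideal e \<Longrightarrow> \<omega> (- x) = - \<omega> x"
    "x \<in> principal_ideal e \<Longrightarrow> 0 \<le> e \<Longrightarrow> \<omega> 0 = 0"
    "x \<in> principal_ideal e \<Longrightarrow> y \<in> principal_ideal e \<Longrightarrow> 0 \<le> e \<Longrightarrow> \<omega> (x - y) = \<omega> x - \<omega> y"
    "x \<in> principal_ideal e \<Longrightarrow> y \<in> principal_ideal e \<Longrightarrow> x \<le> y \<Longrightarrow> \<omega> x \<le> \<omega> y"
    "x \<in> principal_ideal e \<Longrightarrow> 0 \<le> e \<Longrightarrow> \<omega> \<bar>x\<bar> = \<bar>\<omega> x\<bar>"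
    "x \<in> principal_ideal e \<Longrightarrow> y \<in> principal_ideal e \<Longrightarrow> 0 \<le> e \<Longrightarrow> \<omega> (inf x y) = min (\<omega> x) (\<omega> y)"
proof -
  show "\<omega> e = 1" and scale: "\<And>x r. x \<in> principal_ideal e \<Longrightarrow> \<omega> (r *\<^sub>R x) = r * \<omega> x"
    and add: "\<And>x y. x \<in> principal_ideal e \<Longrightarrow> y \<in> principal_ideal e \<Longrightarrow> \<omega> (x + y) = \<omega> x + \<omega> y"
    and sup: "\<And>x y. x \<in> principal_ideal e \<Longrightarrow> y \<in> principal_ideal e \<Longrightarrow> \<omega> (sup x y) = max (\<omega> x) (\<omega> y)"
    using assms by (simp_all add: real_homs_def)
  show um: "\<omega> (- x) = - \<omega> x" if "x \<in> principal_ideal e" for x using scale[OF that, of "- 1"] by simp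
  show "\<omega> 0 = 0" if "x \<in> principal_ideal e" using scale[OF that, of 0] by simp
  show mono: "\<omega> x \<le> \<omega> y" if "x \<in> principal_ideal e" "y \<in> principal_ideal e" "x \<le> y" for x y
    using sup[OF that(1,2)] that(3) by (simp add: sup_absorb2)
  assume e: "0 \<le> e"
  have mI: "- x \<in> principal_ideal e" if "x \<in> principal_ideal e" for x
    using order_idealD(3)[OF order_ideal_principal[OF e] that, of "- 1"] by simp
  show "\<omega> (x - y) = \<omega> x - \<omega> y" if "x \<in> principal_ideal e" "y \<in> principal_ideal e"
    using add[OF that(1) mI[OF that(2)]] um[OF that(2)] by simp
  show "\<omega> \<bar>x\<bar> = \<bar>\<omega> x\<bar>" if "x \<in> principal_ideal e"
    using sup[OF that mI[OF that]] um[OF that] by (simp add: abs_lattice[of x] max_def)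
  show "\<omega> (inf x y) = min (\<omega> x) (\<omega> y)" if "x \<in> principal_ideal e" "y \<in> principal_ideal e"
    using um[OF principal_ideal_sup[OF e mI[OF that(1)] mI[OF that(2)]]]
      sup[OF mI[OF that(1)] mI[OF that(2)]] um[OF that(1)] um[OF that(2)]
    by (simp add: min_def max_def)
qed

text \<open>Maximality makes \<open>J\<close> prime. Modulo \<open>J\<close>, \<open>v\<close> lies
  below a multiple of \<open>e\<close>, hence of \<open>u\<close>, and by disjointness the part of
  \<open>v\<close> below a multiple of \<open>u\<close> vanishes.\<close>

lemma order_ideal_prime:
  fixes e :: "'a::banach_lattice"
  assumes J: "order_ideal J"
    and max: "\<And>w. 0 \<le> w \<Longrightarrow> w \<notin> J \<Longrightarrow> \<exists>j\<in>J. \<exists>c\<ge>0. e \<le> j + c *\<^sub>R w"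
    and uv: "0 \<le> u" "0 \<le> v" "inf v u = 0" "u \<notin> J" and v: "v \<in> principal_ideal e"
  shows "v \<in> J"
proof -
  note J' = order_idealD[OF J]
  obtain j c where j: "j \<in> J" "0 \<le> c" "e \<le> j + c *\<^sub>R u" using max uv by blast
  obtain C where C: "0 \<le> C" "v \<le> C *\<^sub>R e" using v uv(2) by (auto simp: principal_ideal_def)
  have "e \<le> \<bar>j\<bar> + c *\<^sub>R u" by (rule order_trans[OF j(3) add_right_mono[OF abs_ge_self]])
  then have "C *\<^sub>R e \<le> C *\<^sub>R \<bar>j\<bar> + (C * c) *\<^sub>R u"
    using scaleR_left_mono[of e "\<bar>j\<bar> + c *\<^sub>R u" C] C(1) by (simp add: scaleR_add_right)
  then have "v \<le> inf v (C *\<^sub>R \<bar>j\<bar> + (C * c) *\<^sub>R u)" by (simp add: order_trans[OF C(2)])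
  also have "\<dots> \<le> inf v (C *\<^sub>R \<bar>j\<bar>) + inf v ((C * c) *\<^sub>R u)"
    using uv C j by (intro inf_add_le) (simp_all add: scaleR_nonneg_nonneg)
  also have "inf v ((C * c) *\<^sub>R u) = 0" using uv C j by (intro inf_scaleR_eq_0) simp_all
  finally have "v \<le> C *\<^sub>R \<bar>j\<bar>" by simp
  then have "\<bar>v\<bar> \<le> C *\<^sub>R \<bar>j\<bar>" using uv(2) by simp
  then show ?thesis by (rule J'(5)[OF J'(3)[OF J'(6)[OF j(1)]]])
qed

text \<open>The quotient of the principal ideal by a maximal ideal is the real line: the value of
  \<open>x\<close> is the Dedekind cut of those \<open>t\<close> with \<open>t e \<le> x\<close>
  modulo \<open>J\<close>.\<close>

lemma maximal_order_ideal_real: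
  fixes e :: "'a::banach_lattice"
  assumes J: "order_ideal J" "e \<notin> J" and e: "0 \<le> e"
    and max: "\<And>w. 0 \<le> w \<Longrightarrow> w \<notin> J \<Longrightarrow> \<exists>j\<in>J. \<exists>c\<ge>0. e \<le> j + c *\<^sub>R w"
    and x: "x \<in> principal_ideal e"
  shows "\<exists>t. x - t *\<^sub>R e \<in> J"
proof -
  note J' = order_idealD[OF J(1)]
  note I' = order_idealD[OF order_ideal_principal[OF e]]
  have eI: "e \<in> principal_ideal e" using e by (simp add: mem_principal_ideal)
  have posJ: "y \<in> J" if "0 \<le> y" "y \<le> z" "z \<in> J" for y z using J'(5)[OF that(3)] that by simp
  have e_mult: "0 = c" if "c *\<^sub>R e \<in> J" for c
    using J'(3)[OF that, of "inverse c"] J(2) by (cases "c = 0") auto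
  define T where "T = {t. pprt (t *\<^sub>R e - x) \<in> J}"
  obtain C where C: "0 \<le> C" "\<bar>x\<bar> \<le> C *\<^sub>R e" using x by (auto simp: principal_ideal_def)
  have down: "s \<in> T" if "t \<in> T" "s \<le> t" for s t
  proof -
    have "pprt (s *\<^sub>R e - x) \<le> pprt (t *\<^sub>R e - x)"
      by (intro pprt_mono diff_right_mono scaleR_right_mono that e)
    then show ?thesis using posJ[OF zero_le_pprt] that(1) by (simp add: T_def)
  qed
  have "- C \<in> T"
  proof -
    have "- (C *\<^sub>R e) \<le> x" by (rule iffD1[OF minus_le_iff abs_le_D2[OF C(2)]])
    then have "pprt ((- C) *\<^sub>R e - x) = 0" by (simp add: le_zero_iff_zero_pprt[symmetric])
    then show ?thesis using J'(1) by (simp add: T_def)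
  qed
  then have Tne: "T \<noteq> {}" by blast
  have Tle: "t \<le> C" if "t \<in> T" for t
  proof (rule ccontr)
    assume "\<not> t \<le> C"
    then have tC: "0 < t - C" by simp
    have "x \<le> C *\<^sub>R e" by (rule abs_le_D1[OF C(2)])
    then have "(t - C) *\<^sub>R e \<le> t *\<^sub>R e - x" by (simp add: scaleR_diff_left)
    also have "\<dots> \<le> pprt (t *\<^sub>R e - x)" by (simp add: pprt_def)
    finally have "(t - C) *\<^sub>R e \<in> J"
      using posJ that tC e by (simp add: T_def scaleR_nonneg_nonneg)
    then show False using e_mult tC by fastforce
  qed
  have bdd: "bdd_above T" unfolding bdd_above_def using Tle by blast
  define s where "s = Sup T"
  \<comment> \<open>As \<open>s + r\<close> lies outside the cut, primeness puts the positive part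
    of \<open>x - (s + r) e\<close> into \<open>J\<close>; together with \<open>s - r\<close> inside
    the cut this bounds \<open>x - s e\<close> modulo \<open>J\<close> from both sides.\<close>
  have approx: "\<exists>j\<in>J. \<bar>x - s *\<^sub>R e\<bar> \<le> r *\<^sub>R e + j" if r: "0 < r" for r
  proof -
    have "\<exists>t\<in>T. s - r < t" using less_cSup_iff[OF Tne bdd, of "s - r"] r by (simp add: s_def)
    then have "s - r \<in> T" using down by (auto intro: less_imp_le)
    then have j1: "pprt ((s - r) *\<^sub>R e - x) \<in> J" by (simp add: T_def)
    have "s + r \<notin> T" using cSup_upper[OF _ bdd, of "s + r"] r by (auto simp: s_def)
    then have n: "pprt ((s + r) *\<^sub>R e - x) \<notin> J" by (simp add: T_def)
    have "x - (s + r) *\<^sub>R e \<in> principal_ideal e" by (intro I'(3,7) x eI)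
    then have "pprt (- ((s + r) *\<^sub>R e - x)) \<in> principal_ideal e"
      unfolding pprt_def by (intro principal_ideal_sup e I'(1)) simp
    then have "pprt (- ((s + r) *\<^sub>R e - x)) \<in> J"
    proof (rule order_ideal_prime[OF J(1) _ zero_le_pprt zero_le_pprt _ n, rotated 2])
      show "\<exists>j\<in>J. \<exists>c\<ge>0. e \<le> j + c *\<^sub>R w" if "0 \<le> w" "w \<notin> J" for w using max that by blast
      show "inf (pprt (- ((s + r) *\<^sub>R e - x))) (pprt ((s + r) *\<^sub>R e - x)) = 0"
        using inf_pprt_uminus[of "(s + r) *\<^sub>R e - x"] by (simp only: inf_commute)
    qed
    then have j2: "pprt (x - (s + r) *\<^sub>R e) \<in> J" by simp
    have "\<bar>x - s *\<^sub>R e\<bar> \<le> r *\<^sub>R e + (pprt ((s - r) *\<^sub>R e - x) + pprt (x - (s + r) *\<^sub>R e))"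
    proof (rule abs_leI)
      have "x - (s + r) *\<^sub>R e \<le> pprt (x - (s + r) *\<^sub>R e)" by (simp add: pprt_def)
      also have "\<dots> \<le> pprt ((s - r) *\<^sub>R e - x) + pprt (x - (s + r) *\<^sub>R e)" by simp
      finally show "x - s *\<^sub>R e \<le> r *\<^sub>R e + (pprt ((s - r) *\<^sub>R e - x) + pprt (x - (s + r) *\<^sub>R e))"
        by (simp add: algebra_simps)
      have "(s - r) *\<^sub>R e - x \<le> pprt ((s - r) *\<^sub>R e - x)" by (simp add: pprt_def)
      also have "\<dots> \<le> pprt ((s - r) *\<^sub>R e - x) + pprt (x - (s + r) *\<^sub>R e)" by simp
      finally show "- (x - s *\<^sub>R e) \<le> r *\<^sub>R e + (pprt ((s - r) *\<^sub>R e - x) + pprt (x - (s + r) *\<^sub>R e))"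
        by (simp add: algebra_simps)
    qed
    then show ?thesis using j1 j2 J'(2) by blast
  qed
  have "\<bar>x - s *\<^sub>R e\<bar> \<in> J"
  proof (rule ccontr)
    assume "\<not> ?thesis"
    then obtain j0 c where j0: "j0 \<in> J" "0 \<le> c" "e \<le> j0 + c *\<^sub>R \<bar>x - s *\<^sub>R e\<bar>"
      using max[OF abs_ge_zero] by blast
    \<comment> \<open>With this tolerance, \<open>c\<close> copies of the bound use at most half of
      \<open>e\<close>, so the other half would be dominated by an element of
      \<open>J\<close>.\<close>
    obtain j where j: "j \<in> J" "\<bar>x - s *\<^sub>R e\<bar> \<le> (1 / (2 * (c + 1))) *\<^sub>R e + j"
      using approx[of "1 / (2 * (c + 1))"] j0(2) by auto
    have "e \<le> j0 + c *\<^sub>R ((1 / (2 * (c + 1))) *\<^sub>R e + j)"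
      by (rule order_trans[OF j0(3) add_left_mono[OF scaleR_left_mono[OF j(2) j0(2)]]])
    also have "\<dots> = (c / (2 * (c + 1))) *\<^sub>R e + (j0 + c *\<^sub>R j)"
      by (simp add: scaleR_add_right algebra_simps)
    also have "\<dots> \<le> (1 / 2) *\<^sub>R e + (j0 + c *\<^sub>R j)"
      using j0(2) e by (intro add_right_mono scaleR_right_mono) (simp_all add: field_simps)
    finally have "e - (1 / 2) *\<^sub>R e \<le> j0 + c *\<^sub>R j" by (simp add: algebra_simps)
    moreover have "e - (1 / 2) *\<^sub>R e = (1 / 2) *\<^sub>R e"
      using scaleR_diff_left[of 1 "1 / 2" e] by simp
    moreover have "0 \<le> (1 / 2) *\<^sub>R e" using e by (simp add: scaleR_nonneg_nonneg)
    ultimately have "(1 / 2) *\<^sub>R e \<in> J"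
      using posJ J'(2)[OF j0(1) J'(3)[OF j(1)]] by metis
    then show False using e_mult by fastforce
  qed
  then show ?thesis using J'(5)[of _ "x - s *\<^sub>R e"] by auto
qed

text \<open>Since \<open>e\<close> is not in \<open>J\<close>, the number \<open>t\<close> with
  \<open>x - t e\<close> in \<open>J\<close> is unique; uniqueness turns each congruence modulo
  \<open>J\<close> into an identity of values.\<close>

lemma real_hom_of_maximal:
  fixes e :: "'a::banach_lattice"
  assumes J: "order_ideal J" "e \<notin> J" and e: "0 \<le> e"
    and max: "\<And>w. 0 \<le> w \<Longrightarrow> w \<notin> J \<Longrightarrow> \<exists>j\<in>J. \<exists>c\<ge>0. e \<le> j + c *\<^sub>R w"
  obtains \<omega> where "\<omega> \<in> real_homs e" "\<And>x. x \<in> principal_ideal e \<Longrightarrow> x \<in> J \<Longrightarrow> \<omega> x = 0"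
proof -
  note J' = order_idealD[OF J(1)]
  note I' = order_idealD[OF order_ideal_principal[OF e]]
  define \<omega> where "\<omega> x = (SOME t. x - t *\<^sub>R e \<in> J)" for x
  have \<omega>: "x - \<omega> x *\<^sub>R e \<in> J" if "x \<in> principal_ideal e" for x
    unfolding \<omega>_def by (rule someI_ex[OF maximal_order_ideal_real[OF J e max that]])
  have uniq: "\<omega> x = t" if "x \<in> principal_ideal e" "x - t *\<^sub>R e \<in> J" for x t
  proof -
    have "(x - t *\<^sub>R e) - (x - \<omega> x *\<^sub>R e) \<in> J" by (intro J'(7) \<omega> that)
    then have "(\<omega> x - t) *\<^sub>R e \<in> J" by (simp add: algebra_simps)
    then show ?thesis using J'(3)[of "(\<omega> x - t) *\<^sub>R e" "inverse (\<omega> x - t)"] J(2)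
      by (cases "\<omega> x - t = 0") auto
  qed
  have "\<omega> \<in> real_homs e"
    unfolding real_homs_def
  proof (intro CollectI conjI ballI allI)
    show "\<omega> e = 1" using e J'(1) by (intro uniq) (simp_all add: mem_principal_ideal)
  next
    fix r x assume x: "x \<in> principal_ideal e"
    have "r *\<^sub>R (x - \<omega> x *\<^sub>R e) \<in> J" by (intro J'(3) \<omega> x)
    then show "\<omega> (r *\<^sub>R x) = r * \<omega> x" using x by (intro uniq I'(3)) (simp_all add: algebra_simps)
  next
    fix x y assume x: "x \<in> principal_ideal e" and y: "y \<in> principal_ideal e"
    have "(x - \<omega> x *\<^sub>R e) + (y - \<omega> y *\<^sub>R e) \<in> J" by (intro J'(2) \<omega> x y)
    then show "\<omega> (x + y) = \<omega> x + \<omega> y" using x y by (intro uniq I'(2)) (simp_all add: algebra_simps)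
    have s: "sup (\<omega> x *\<^sub>R e) (\<omega> y *\<^sub>R e) = max (\<omega> x) (\<omega> y) *\<^sub>R e"
      using scaleR_right_mono[of "\<omega> x" "\<omega> y" e] scaleR_right_mono[of "\<omega> y" "\<omega> x" e] e
      by (cases "\<omega> x \<le> \<omega> y") (simp_all add: sup_absorb1 sup_absorb2 max_def)
    have "\<bar>x - \<omega> x *\<^sub>R e\<bar> + \<bar>y - \<omega> y *\<^sub>R e\<bar> \<in> J" by (intro J'(2,6) \<omega> x y)
    from J'(5)[OF this sup_diff_le] show "\<omega> (sup x y) = max (\<omega> x) (\<omega> y)"
      using x y e by (intro uniq principal_ideal_sup) (simp_all add: s)
  qed
  moreover have "\<omega> x = 0" if "x \<in> principal_ideal e" "x \<in> J" for x using uniq[of x 0] that by simp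
  ultimately show ?thesis using that by blast
qed

text \<open>Kakutani's representation in the form needed: real homomorphisms determine the order of
  the ideal. If \<open>x - y\<close> is not negative, then by the Archimedean property it is not
  below some \<open>r e\<close>; a homomorphism vanishing at the positive part of
  \<open>r e - (x - y)\<close> takes a value of at least \<open>r\<close> at
  \<open>x - y\<close>.\<close>

lemma le_if_real_homs_le:
  fixes e :: "'a::banach_lattice"
  assumes e: "0 \<le> e" and x: "x \<in> principal_ideal e" and y: "y \<in> principal_ideal e"
    and le: "\<And>\<omega>. \<omega> \<in> real_homs e \<Longrightarrow> \<omega> x \<le> \<omega> y"
  shows "x \<le> y"
proof (rule ccontr)
  assume "\<not> x \<le> y"
  define u where "u = x - y"
  note I' = order_idealD[OF order_ideal_principal[OF e]]
  have eI: "e \<in> principal_ideal e" using e by (simp add: mem_principal_ideal)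
  have u: "u \<in> principal_ideal e" using I'(7)[OF x y] by (simp add: u_def)
  have "\<not> u \<le> 0" using \<open>\<not> x \<le> y\<close> by (simp add: u_def)
  then obtain r where r: "0 < r" "\<not> u \<le> r *\<^sub>R e" using le_zero_of_le_small[OF e, of u] by blast
  define z where "z = pprt (r *\<^sub>R e - u)"
  define z' where "z' = pprt (- (r *\<^sub>R e - u))"
  have z: "0 \<le> z" "0 \<le> z'" "inf z' z = 0"
    using inf_pprt_uminus[of "r *\<^sub>R e - u"] by (simp_all add: z_def z'_def inf_commute)
  have "z' \<noteq> 0" using r(2) le_zero_iff_zero_pprt[of "- (r *\<^sub>R e - u)"] by (auto simp: z'_def)
  have "u - r *\<^sub>R e \<in> principal_ideal e" by (intro I'(3,7) u eI)
  then have "z' \<in> principal_ideal e" unfolding z'_def pprt_def using e I'(1)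
    by (intro principal_ideal_sup) simp_all
  then obtain C where C: "0 \<le> C" "z' \<le> C *\<^sub>R e" using z(2) by (auto simp: principal_ideal_def)
  have J0: "order_ideal (principal_ideal z)" by (rule order_ideal_principal[OF z(1)])
  \<comment> \<open>Otherwise \<open>z'\<close>, which is bounded by a multiple of \<open>e\<close>,
    would be bounded by a multiple of \<open>z\<close>, from which it is disjoint.\<close>
  have "e \<notin> principal_ideal z"
  proof
    assume "e \<in> principal_ideal z"
    then obtain c where c: "0 \<le> c" "e \<le> c *\<^sub>R z" using e by (auto simp: principal_ideal_def)
    have "z' \<le> C *\<^sub>R (c *\<^sub>R z)" by (rule order_trans[OF C(2) scaleR_left_mono[OF c(2) C(1)]])
    then have "z' \<le> inf z' ((C * c) *\<^sub>R z)" by simp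
    also have "\<dots> = 0" using z C c by (intro inf_scaleR_eq_0) simp_all
    finally show False using z(2) \<open>z' \<noteq> 0\<close> by (simp add: antisym)
  qed
  then obtain J where J: "order_ideal J" "principal_ideal z \<subseteq> J" "e \<notin> J"
    and max: "\<And>w. 0 \<le> w \<Longrightarrow> w \<notin> J \<Longrightarrow> \<exists>j\<in>J. \<exists>c\<ge>0. e \<le> j + c *\<^sub>R w"
    using maximal_order_ideal[OF J0 _ e] by blast
  obtain \<omega> where \<omega>: "\<omega> \<in> real_homs e" and \<omega>0: "\<And>x. x \<in> principal_ideal e \<Longrightarrow> x \<in> J \<Longrightarrow> \<omega> x = 0"
    using real_hom_of_maximal[OF J(1) J(3) e max] by blast
  have d: "r *\<^sub>R e - u \<in> principal_ideal e" by (intro I'(3,7) u eI)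
  have "z \<in> principal_ideal e" unfolding z_def pprt_def by (intro principal_ideal_sup e d I'(1))
  moreover have "z \<in> J" using J(2) z(1) by (auto simp: mem_principal_ideal)
  ultimately have "0 = \<omega> (sup (r *\<^sub>R e - u) 0)" using \<omega>0 by (simp add: z_def pprt_def)
  also have "\<dots> = max (r - (\<omega> x - \<omega> y)) 0"
    using real_homsD(1,2,3,4,6,7)[OF \<omega>] d I'(1) u eI x y I'(3) e by (simp add: u_def)
  finally show False using le[OF \<omega>] r(1) by simp
qed

section \<open>Amalgamation with a lattice of matrices\<close>

lemma tendsto_sup_lattice:
  fixes x y :: "'a::banach_lattice"
  assumes "X \<longlonglongrightarrow> x" "Y \<longlonglongrightarrow> y"
  shows "(\<lambda>k. sup (X k) (Y k)) \<longlonglongrightarrow> sup x y"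
proof -
  have "norm (sup (X k) (Y k) - sup x y) \<le> norm (X k - x) + norm (Y k - y)" for k
  proof -
    have "norm (sup (X k) (Y k) - sup x y) \<le> norm (\<bar>X k - x\<bar> + \<bar>Y k - y\<bar>)"
      by (rule norm_le_dominated[OF sup_diff_le])
    also have "\<dots> \<le> norm \<bar>X k - x\<bar> + norm \<bar>Y k - y\<bar>" by (rule norm_triangle_ineq)
    finally show ?thesis by (simp only: norm_abs_eq)
  qed
  moreover have "(\<lambda>k. norm (X k - x) + norm (Y k - y)) \<longlonglongrightarrow> 0"
    by (rule tendsto_add_zero; rule tendsto_norm_zero[OF LIM_zero]; rule assms)
  ultimately have "(\<lambda>k. sup (X k) (Y k) - sup x y) \<longlonglongrightarrow> 0"
    by (rule Lim_null_comparison[OF always_eventually[OF allI]])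
  then show ?thesis by (rule LIM_zero_cancel)
qed

lemma tendsto_inf_lattice:
  fixes x y :: "'a::banach_lattice"
  assumes "X \<longlonglongrightarrow> x" "Y \<longlonglongrightarrow> y"
  shows "(\<lambda>k. inf (X k) (Y k)) \<longlonglongrightarrow> inf x y"
  using tendsto_minus[OF tendsto_sup_lattice[OF tendsto_minus[OF assms(1)] tendsto_minus[OF assms(2)]]]
  by (simp only: inf_eq_sup)

text \<open>The algebraic part of \<open>gen_sublattice\<close>: lattice polynomials in elements of
  an order ideal stay there, while their norm limits may leave it.\<close>

inductive_set lat_gen :: "'a::banach_lattice set \<Rightarrow> 'a set" for A where
  zero: "0 \<in> lat_gen A"
| gen: "a \<in> A \<Longrightarrow> a \<in> lat_gen A"
| add: "x \<in> lat_gen A \<Longrightarrow> y \<in> lat_gen A \<Longrightarrow> x + y \<in> lat_gen A"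
| scale: "x \<in> lat_gen A \<Longrightarrow> r *\<^sub>R x \<in> lat_gen A"
| sup: "x \<in> lat_gen A \<Longrightarrow> y \<in> lat_gen A \<Longrightarrow> sup x y \<in> lat_gen A"

lemma lat_gen_minus: "x \<in> lat_gen A \<Longrightarrow> - x \<in> lat_gen A"
  using lat_gen.scale[of x A "- 1"] by simp

lemma lat_gen_diff: "x \<in> lat_gen A \<Longrightarrow> y \<in> lat_gen A \<Longrightarrow> x - y \<in> lat_gen A"
  using lat_gen.add[OF _ lat_gen_minus, of x A y] by simp

lemma lat_gen_inf: "x \<in> lat_gen A \<Longrightarrow> y \<in> lat_gen A \<Longrightarrow> inf x y \<in> lat_gen A"
  unfolding inf_eq_sup by (intro lat_gen_minus lat_gen.sup)

lemma closed_sublattice_gen: "closed_sublattice (gen_sublattice as)"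
  unfolding closed_sublattice_def
proof (intro conjI ballI)
  show "subspace (gen_sublattice as)" "closed (gen_sublattice as)"
    unfolding gen_sublattice_def
    by (rule subspace_Inter, simp add: closed_sublattice_def) (rule closed_Inter, simp add: closed_sublattice_def)
  fix x y assume "x \<in> gen_sublattice as" "y \<in> gen_sublattice as"
  then show "sup x y \<in> gen_sublattice as" "inf x y \<in> gen_sublattice as"
    by (simp_all add: gen_sublattice_def closed_sublattice_def)
qed

lemma set_subset_gen: "set as \<subseteq> gen_sublattice as"
  by (auto simp: gen_sublattice_def)

lemma closed_sublattice_closure_lat_gen: "closed_sublattice (closure (lat_gen A))"
  unfolding closed_sublattice_def
proof (intro conjI ballI)
  show "subspace (closure (lat_gen A))"
    unfolding subspace_def
  proof (intro conjI ballI allI)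
    show "0 \<in> closure (lat_gen A)" using closure_subset lat_gen.zero by blast
  next
    fix x y assume "x \<in> closure (lat_gen A)" "y \<in> closure (lat_gen A)"
    then obtain X Y where "\<And>k. X k \<in> lat_gen A" "X \<longlonglongrightarrow> x" "\<And>k. Y k \<in> lat_gen A" "Y \<longlonglongrightarrow> y"
      unfolding closure_sequential by blast
    then show "x + y \<in> closure (lat_gen A)"
      unfolding closure_sequential by (intro exI[of _ "\<lambda>k. X k + Y k"]) (auto intro: lat_gen.add tendsto_add)
  next
    fix r x assume "x \<in> closure (lat_gen A)"
    then obtain X where "\<And>k. X k \<in> lat_gen A" "X \<longlonglongrightarrow> x" unfolding closure_sequential by blast
    then show "r *\<^sub>R x \<in> closure (lat_gen A)"
      unfolding closure_sequential
      by (intro exI[of _ "\<lambda>k. r *\<^sub>R X k"]) (auto intro: lat_gen.scale tendsto_intros)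
  qed
  fix x y assume "x \<in> closure (lat_gen A)" "y \<in> closure (lat_gen A)"
  then obtain X Y where "\<And>k. X k \<in> lat_gen A" "X \<longlonglongrightarrow> x" "\<And>k. Y k \<in> lat_gen A" "Y \<longlonglongrightarrow> y"
    unfolding closure_sequential by blast
  then show "sup x y \<in> closure (lat_gen A)" "inf x y \<in> closure (lat_gen A)"
    unfolding closure_sequential
    by (intro exI[of _ "\<lambda>k. sup (X k) (Y k)"] exI[of _ "\<lambda>k. inf (X k) (Y k)"] conjI allI
      lat_gen.sup lat_gen_inf tendsto_sup_lattice tendsto_inf_lattice; blast)+
qed simp

lemma gen_sublattice_limit:
  assumes "x \<in> gen_sublattice as"
  shows "\<exists>X. (\<forall>k. X k \<in> lat_gen (set as)) \<and> X \<longlonglongrightarrow> x"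
proof -
  have "set as \<subseteq> closure (lat_gen (set as))"
    by (auto intro: subsetD[OF closure_subset] lat_gen.gen)
  then have "x \<in> closure (lat_gen (set as))"
    using assms closed_sublattice_closure_lat_gen unfolding gen_sublattice_def by blast
  then show ?thesis by (simp add: closure_sequential)
qed

lemma lat_gen_principal_ideal:
  assumes e: "0 \<le> e" and A: "A \<subseteq> principal_ideal e" and x: "x \<in> lat_gen A"
  shows "x \<in> principal_ideal e"
proof -
  note I = order_idealD[OF order_ideal_principal[OF e]]
  show ?thesis
    using x
  proof induction
    case zero
    show ?case by (rule I(1))
  next
    case (gen a)
    then show ?case using A by blast
  next
    case (add x y)
    show ?case by (rule I(2)[OF add.IH])
  next
    case (scale x r)
    show ?case by (rule I(3)[OF scale.IH])
  next
    case (sup x y)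
    show ?case by (rule principal_ideal_sup[OF e sup.IH])
  qed
qed

section \<open>The matrix lattices\<close>

lemma linf_l1_simps [simp]:
  "bcarrier (linf_l1 m n) = {c. \<forall>i j. \<not> (i < m \<and> j < n) \<longrightarrow> c i j = 0}"
  "bzero (linf_l1 m n) = (\<lambda>i j. 0)"
  "badd (linf_l1 m n) = (\<lambda>c d i j. c i j + d i j)"
  "bscale (linf_l1 m n) = (\<lambda>a c i j. a * c i j)"
  "bsup (linf_l1 m n) = (\<lambda>c d i j. max (c i j) (d i j))"
  "binf (linf_l1 m n) = (\<lambda>c d i j. min (c i j) (d i j))"
  by (simp_all add: linf_l1_def)

lemma blat_of_simps [simp]:
  "bcarrier (blat_of S) = S" "bzero (blat_of S) = 0" "badd (blat_of S) = (+)"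
  "bscale (blat_of S) = (*\<^sub>R)" "bsup (blat_of S) = sup" "binf (blat_of S) = inf"
  "bnorm (blat_of S) = norm" "ble (blat_of S) = (\<le>)"
  by (simp_all add: blat_of_def)

lemma linf_l1_norm_le_iff:
  "0 < m \<Longrightarrow> bnorm (linf_l1 m n) c \<le> B \<longleftrightarrow> (\<forall>i<m. (\<Sum>j<n. \<bar>c i j\<bar>) \<le> B)"
  by (subst linf_l1_def) (auto simp: Max_le_iff lessThan_empty_iff)

lemma linf_l1_row_le: "i < m \<Longrightarrow> (\<Sum>j<n. \<bar>c i j\<bar>) \<le> bnorm (linf_l1 m n) c"
  by (auto simp: linf_l1_def)

lemma linf_l1_entry_le: "i < m \<Longrightarrow> j < n \<Longrightarrow> \<bar>c i j\<bar> \<le> bnorm (linf_l1 m n) c"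
  by (rule order_trans[OF _ linf_l1_row_le]) (auto intro: member_le_sum[of j "{..<n}" "\<lambda>j. \<bar>c i j\<bar>"])

lemma linf_l1_norm_nonneg: "0 < m \<Longrightarrow> 0 \<le> bnorm (linf_l1 m n) c"
  by (rule order_trans[OF sum_nonneg linf_l1_row_le]) auto

lemma linf_l1_norm_mono:
  assumes "0 < m" "\<And>i j. i < m \<Longrightarrow> j < n \<Longrightarrow> \<bar>c i j\<bar> \<le> \<bar>d i j\<bar>"
  shows "bnorm (linf_l1 m n) c \<le> bnorm (linf_l1 m n) d"
  unfolding linf_l1_norm_le_iff[OF assms(1)]
  by (auto intro!: order_trans[OF sum_mono linf_l1_row_le] assms)

lemma linf_l1_norm_triangle:
  assumes "0 < m"
  shows "bnorm (linf_l1 m n) (\<lambda>i j. c i j + d i j) \<le> bnorm (linf_l1 m n) c + bnorm (linf_l1 m n) d"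
  unfolding linf_l1_norm_le_iff[OF assms]
proof (intro allI impI)
  fix i assume "i < m"
  have "(\<Sum>j<n. \<bar>c i j + d i j\<bar>) \<le> (\<Sum>j<n. \<bar>c i j\<bar>) + (\<Sum>j<n. \<bar>d i j\<bar>)"
    unfolding sum.distrib[symmetric] by (intro sum_mono abs_triangle_ineq)
  also have "\<dots> \<le> bnorm (linf_l1 m n) c + bnorm (linf_l1 m n) d"
    using \<open>i < m\<close> by (intro add_mono linf_l1_row_le)
  finally show "(\<Sum>j<n. \<bar>c i j + d i j\<bar>) \<le> bnorm (linf_l1 m n) c + bnorm (linf_l1 m n) d" .
qed

lemma linf_l1_norm_scale_le:
  assumes "0 < m"
  shows "bnorm (linf_l1 m n) (\<lambda>i j. r * c i j) \<le> \<bar>r\<bar> * bnorm (linf_l1 m n) c"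
  unfolding linf_l1_norm_le_iff[OF assms]
  by (auto simp: abs_mult sum_distrib_left[symmetric] intro!: mult_left_mono linf_l1_row_le)

lemma linf_l1_norm_zero: "0 < m \<Longrightarrow> bnorm (linf_l1 m n) (\<lambda>i j. 0) = 0"
  by (auto intro!: antisym linf_l1_norm_nonneg simp: linf_l1_norm_le_iff)

definition unit_matrix :: "nat \<Rightarrow> nat \<Rightarrow> nat \<Rightarrow> nat \<Rightarrow> real" where
  "unit_matrix i j = (\<lambda>a b. if a = i \<and> b = j then 1 else 0)"

lemma matrix_eq_sum_units:
  assumes "a < m" "b < n"
  shows "c a b = (\<Sum>i<m. \<Sum>j<n. c i j * unit_matrix i j a b)"
proof -
  have "(\<Sum>i<m. \<Sum>j<n. c i j * unit_matrix i j a b) = (\<Sum>i<m. if i = a then c a b else 0)"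
  proof (rule sum.cong[OF refl])
    fix i
    have "(\<Sum>j<n. c i j * unit_matrix i j a b) = (\<Sum>j<n. if j = b then (if i = a then c a b else 0) else 0)"
      by (rule sum.cong) (auto simp: unit_matrix_def)
    then show "(\<Sum>j<n. c i j * unit_matrix i j a b) = (if i = a then c a b else 0)"
      using assms by simp
  qed
  then show ?thesis using assms by simp
qed

text \<open>
  At a point \<open>s\<close> an element of the ideal has the value \<open>u s * \<omega> s x\<close>, and a matrix the multiple \<open>w s\<close> of
  one of its entries. The last two assumptions say that the infimal convolution of the two norms
  extends both of them.
\<close>

locale amalgam =
  fixes e :: "'a::banach_lattice" and m n :: nat
    and u :: "'s \<Rightarrow> real" and \<omega> :: "'s \<Rightarrow> 'a \<Rightarrow> real"
    and w :: "'s \<Rightarrow> real" and row col :: "'s \<Rightarrow> nat"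
  assumes e: "0 \<le> e" and m: "0 < m"
    and u: "0 \<le> u s" and hom: "u s \<noteq> 0 \<Longrightarrow> \<omega> s \<in> real_homs e"
    and w: "0 \<le> w s" and row: "row s < m" and col: "col s < n"
    and ideal_exact: "x \<in> principal_ideal e \<Longrightarrow> v \<in> principal_ideal e \<Longrightarrow> 0 \<le> x \<Longrightarrow> 0 \<le> v \<Longrightarrow>
       c \<in> bcarrier (linf_l1 m n) \<Longrightarrow> (\<And>i j. 0 \<le> c i j) \<Longrightarrow>
       (\<And>s. u s * \<omega> s x \<le> u s * \<omega> s v + w s * c (row s) (col s)) \<Longrightarrow>
       norm x \<le> norm v + bnorm (linf_l1 m n) c"
    and matrix_exact: "v \<in> principal_ideal e \<Longrightarrow> 0 \<le> v \<Longrightarrow>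
       d \<in> bcarrier (linf_l1 m n) \<Longrightarrow> (\<And>i j. 0 \<le> d i j) \<Longrightarrow>
       c \<in> bcarrier (linf_l1 m n) \<Longrightarrow> (\<And>i j. 0 \<le> c i j) \<Longrightarrow>
       (\<And>s. w s * d (row s) (col s) \<le> u s * \<omega> s v + w s * c (row s) (col s)) \<Longrightarrow>
       bnorm (linf_l1 m n) d \<le> norm v + bnorm (linf_l1 m n) c"
begin

definition J :: "'a \<Rightarrow> 's \<Rightarrow> real" where "J x s = u s * \<omega> s x"
definition I :: "(nat \<Rightarrow> nat \<Rightarrow> real) \<Rightarrow> 's \<Rightarrow> real" where "I c s = w s * c (row s) (col s)"

abbreviation "L \<equiv> linf_l1 m n"
abbreviation "D \<equiv> principal_ideal e"

lemma J_hom: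
  assumes "x \<in> D" "y \<in> D"
  shows "J (x + y) s = J x s + J y s" "J (x - y) s = J x s - J y s"
    "J (sup x y) s = max (J x s) (J y s)" "J (inf x y) s = min (J x s) (J y s)"
    "J (r *\<^sub>R x) s = r * J x s" "J \<bar>x\<bar> s = \<bar>J x s\<bar>" "J 0 s = 0"
proof -
  have "J (x + y) s = J x s + J y s \<and> J (x - y) s = J x s - J y s \<and>
    J (sup x y) s = max (J x s) (J y s) \<and> J (inf x y) s = min (J x s) (J y s) \<and>
    J (r *\<^sub>R x) s = r * J x s \<and> J \<bar>x\<bar> s = \<bar>J x s\<bar> \<and> J 0 s = 0"
  proof (cases "u s = 0")
    case False
    then have h: "\<omega> s \<in> real_homs e" by (rule hom)
    have "\<omega> s 0 = 0" by (rule real_homsD(6)[OF h assms(1) e])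
    then show ?thesis
      using u[of s] by (simp add: J_def real_homsD(2-5,7,9,10)[OF h] assms e distrib_left right_diff_distrib
        max_mult_distrib_left min_mult_distrib_left abs_mult)
  qed (simp add: J_def)
  then show "J (x + y) s = J x s + J y s" "J (x - y) s = J x s - J y s"
    "J (sup x y) s = max (J x s) (J y s)" "J (inf x y) s = min (J x s) (J y s)"
    "J (r *\<^sub>R x) s = r * J x s" "J \<bar>x\<bar> s = \<bar>J x s\<bar>" "J 0 s = 0" by blast+
qed

lemma I_hom:
  "I (\<lambda>i j. c i j + d i j) s = I c s + I d s" "I (\<lambda>i j. c i j - d i j) s = I c s - I d s"
  "I (\<lambda>i j. r * c i j) s = r * I c s" "I (\<lambda>i j. \<bar>c i j\<bar>) s = \<bar>I c s\<bar>" "I (\<lambda>i j. 0) s = 0"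
  "I (\<lambda>i j. max (c i j) (d i j)) s = max (I c s) (I d s)"
  "I (\<lambda>i j. min (c i j) (d i j)) s = min (I c s) (I d s)"
  using w[of s] by (simp_all add: I_def algebra_simps abs_mult max_mult_distrib_left min_mult_distrib_left)

text \<open>\<open>N\<close> is the infimal convolution of the two norms, taken over positive
  majorants of the absolute value so that it respects the order. As \<open>Inf {}\<close> is
  unspecified, it is meaningful only where \<open>bounds\<close> is non-empty; therefore
  \<open>fun_lattice_gen\<close> confines it to a lattice generated by such functions.\<close>

definition bounds :: "('s \<Rightarrow> real) \<Rightarrow> real set" where
  "bounds U = {norm v + bnorm L c | v c. v \<in> D \<and> 0 \<le> v \<and> c \<in> bcarrier L \<and> (\<forall>i j. 0 \<le> c i j) \<and>
     (\<forall>s. \<bar>U s\<bar> \<le> J v s + I c s)}"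

definition N :: "('s \<Rightarrow> real) \<Rightarrow> real" where "N U = Inf (bounds U)"

lemma boundsI:
  "v \<in> D \<Longrightarrow> 0 \<le> v \<Longrightarrow> c \<in> bcarrier L \<Longrightarrow> (\<And>i j. 0 \<le> c i j) \<Longrightarrow> (\<And>s. \<bar>U s\<bar> \<le> J v s + I c s) \<Longrightarrow>
   norm v + bnorm L c \<in> bounds U"
  unfolding bounds_def by blast

lemma boundsE:
  assumes "b \<in> bounds U"
  obtains v c where "b = norm v + bnorm L c" "v \<in> D" "0 \<le> v" "c \<in> bcarrier L" "\<And>i j. 0 \<le> c i j"
    "\<And>s. \<bar>U s\<bar> \<le> J v s + I c s"
  using assms unfolding bounds_def by blast

lemma bounds_nonneg: "b \<in> bounds U \<Longrightarrow> 0 \<le> b"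
  by (elim boundsE) (simp add: linf_l1_norm_nonneg m)

lemma bdd_below_bounds: "bdd_below (bounds U)"
  by (rule bdd_belowI[of _ 0]) (rule bounds_nonneg)

lemma N_le: "b \<in> bounds U \<Longrightarrow> N U \<le> b"
  unfolding N_def by (rule cInf_lower[OF _ bdd_below_bounds])

lemma N_ge: "bounds U \<noteq> {} \<Longrightarrow> (\<And>b. b \<in> bounds U \<Longrightarrow> B \<le> b) \<Longrightarrow> B \<le> N U"
  unfolding N_def by (rule cInf_greatest)

text \<open>Stated with domination in place of a sum, so that it serves sums and maxima
  alike.\<close>

lemma bounds_add:
  assumes "b \<in> bounds U" "b' \<in> bounds U'" "\<And>s. \<bar>V s\<bar> \<le> \<bar>U s\<bar> + \<bar>U' s\<bar>"
  shows "\<exists>b''\<in>bounds V. b'' \<le> b + b'"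
  using assms(1,2)
proof (elim boundsE)
  fix v c v' c'
  assume 1: "b = norm v + bnorm L c" "v \<in> D" "0 \<le> v" "c \<in> bcarrier L" "\<And>i j. 0 \<le> c i j"
      "\<And>s. \<bar>U s\<bar> \<le> J v s + I c s"
    and 2: "b' = norm v' + bnorm L c'" "v' \<in> D" "0 \<le> v'" "c' \<in> bcarrier L" "\<And>i j. 0 \<le> c' i j"
      "\<And>s. \<bar>U' s\<bar> \<le> J v' s + I c' s"
  have "norm (v + v') + bnorm L (\<lambda>i j. c i j + c' i j) \<in> bounds V"
  proof (rule boundsI)
    show "v + v' \<in> D" using order_idealD(2)[OF order_ideal_principal[OF e]] 1 2 by blast
    show "\<bar>V s\<bar> \<le> J (v + v') s + I (\<lambda>i j. c i j + c' i j) s" for s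
      using assms(3)[of s] 1(6)[of s] 2(6)[of s] by (simp add: J_hom 1(2) 2(2) I_hom)
  qed (use 1 2 in auto)
  moreover have "norm (v + v') + bnorm L (\<lambda>i j. c i j + c' i j) \<le> b + b'"
    using norm_triangle_ineq[of v v'] linf_l1_norm_triangle[OF m, of n c c'] 1(1) 2(1) by simp
  ultimately show ?thesis by blast
qed

lemma bounds_scale:
  assumes "b \<in> bounds U"
  shows "\<exists>b'\<in>bounds (\<lambda>s. r * U s). b' \<le> \<bar>r\<bar> * b"
  using assms
proof (elim boundsE)
  fix v c
  assume 1: "b = norm v + bnorm L c" "v \<in> D" "0 \<le> v" "c \<in> bcarrier L" "\<And>i j. 0 \<le> c i j"
      "\<And>s. \<bar>U s\<bar> \<le> J v s + I c s"
  have "norm (\<bar>r\<bar> *\<^sub>R v) + bnorm L (\<lambda>i j. \<bar>r\<bar> * c i j) \<in> bounds (\<lambda>s. r * U s)"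
  proof (rule boundsI)
    show "\<bar>r\<bar> *\<^sub>R v \<in> D" using order_idealD(3)[OF order_ideal_principal[OF e]] 1 by blast
    show "\<bar>r * U s\<bar> \<le> J (\<bar>r\<bar> *\<^sub>R v) s + I (\<lambda>i j. \<bar>r\<bar> * c i j) s" for s
      using mult_left_mono[OF 1(6)[of s], of "\<bar>r\<bar>"] by (simp add: J_hom(5)[OF 1(2) 1(2)] I_hom abs_mult algebra_simps)
  qed (use 1 in \<open>auto simp: scaleR_nonneg_nonneg\<close>)
  moreover have "norm (\<bar>r\<bar> *\<^sub>R v) + bnorm L (\<lambda>i j. \<bar>r\<bar> * c i j) \<le> \<bar>r\<bar> * b"
    using linf_l1_norm_scale_le[OF m, of n "\<bar>r\<bar>" c] 1(1) by (simp add: algebra_simps)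
  ultimately show ?thesis by blast
qed

lemma bounds_J: "x \<in> D \<Longrightarrow> norm x \<in> bounds (J x)"
  using boundsI[of "\<bar>x\<bar>" "\<lambda>i j. 0" "J x"] order_idealD(6)[OF order_ideal_principal[OF e], of x]
  by (simp add: linf_l1_norm_zero m norm_abs_eq J_hom I_hom)

lemma bounds_I: "c \<in> bcarrier L \<Longrightarrow> bnorm L c \<in> bounds (I c)"
proof -
  assume c: "c \<in> bcarrier L"
  have "bnorm L (\<lambda>i j. \<bar>c i j\<bar>) = bnorm L c"
    by (intro antisym linf_l1_norm_mono m) auto
  moreover have "0 \<in> D" using order_idealD(1)[OF order_ideal_principal[OF e]] .
  ultimately show ?thesis
    using boundsI[of 0 "\<lambda>i j. \<bar>c i j\<bar>" "I c"] c by (simp add: J_hom I_hom)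
qed

text \<open>\<open>ideal_exact\<close>, applied to \<open>\<bar>x\<bar>\<close>, says that no mixed
  majorant is cheaper than \<open>x\<close> itself; \<open>N_I\<close> is the counterpart for
  matrices.\<close>

lemma N_J: assumes x: "x \<in> D" shows "N (J x) = norm x"
proof (rule antisym)
  show "N (J x) \<le> norm x" by (rule N_le[OF bounds_J[OF x]])
  show "norm x \<le> N (J x)"
  proof (rule N_ge)
    show "bounds (J x) \<noteq> {}" using bounds_J[OF x] by blast
    fix b assume "b \<in> bounds (J x)"
    then obtain v c where 1: "b = norm v + bnorm L c" "v \<in> D" "0 \<le> v" "c \<in> bcarrier L" "\<And>i j. 0 \<le> c i j"
      "\<And>s. \<bar>J x s\<bar> \<le> J v s + I c s" by (rule boundsE) blast
    have "norm \<bar>x\<bar> \<le> norm v + bnorm L c"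
    proof (rule ideal_exact)
      show "\<bar>x\<bar> \<in> D" by (rule order_idealD(6)[OF order_ideal_principal[OF e] x])
      show "u s * \<omega> s \<bar>x\<bar> \<le> u s * \<omega> s v + w s * c (row s) (col s)" for s
        using 1(6)[of s] J_hom(6)[OF x x, of s] by (simp add: J_def I_def)
    qed (use 1 in auto)
    then show "norm x \<le> b" by (simp add: 1 norm_abs_eq)
  qed
qed

lemma N_I: assumes d: "d \<in> bcarrier L" shows "N (I d) = bnorm L d"
proof (rule antisym)
  show "N (I d) \<le> bnorm L d" by (rule N_le[OF bounds_I[OF d]])
  show "bnorm L d \<le> N (I d)"
  proof (rule N_ge)
    show "bounds (I d) \<noteq> {}" using bounds_I[OF d] by blast
    fix b assume "b \<in> bounds (I d)"
    then obtain v c where 1: "b = norm v + bnorm L c" "v \<in> D" "0 \<le> v" "c \<in> bcarrier L" "\<And>i j. 0 \<le> c i j"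
      "\<And>s. \<bar>I d s\<bar> \<le> J v s + I c s" by (rule boundsE) blast
    have "bnorm L d \<le> bnorm L (\<lambda>i j. \<bar>d i j\<bar>)" by (intro linf_l1_norm_mono m) auto
    also have "\<dots> \<le> norm v + bnorm L c"
    proof (rule matrix_exact)
      show "w s * \<bar>d (row s) (col s)\<bar> \<le> u s * \<omega> s v + w s * c (row s) (col s)" for s
        using 1(6)[of s] w[of s] by (simp add: J_def I_def abs_mult)
    qed (use 1 d in auto)
    finally show "bnorm L d \<le> b" by (simp add: 1)
  qed
qed

lemma fun_lattice_gen:
  assumes gs: "\<And>g. g \<in> set gs \<Longrightarrow> bounds g \<noteq> {}"
  shows "fun_lattice (fun_gen (set gs)) N"
proof
  have ne: "bounds U \<noteq> {}" if "U \<in> fun_gen (set gs)" for U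
    using that
  proof induction
    case zero
    have "0 \<in> D" using order_idealD(1)[OF order_ideal_principal[OF e]] .
    then have "J 0 = (\<lambda>_. 0)" using J_hom(7)[of 0 0] by auto
    then show ?case using bounds_J[OF \<open>0 \<in> D\<close>] by auto
  next
    case (gen g)
    then show ?case using gs by blast
  next
    case (add U V)
    then obtain b b' where b: "b \<in> bounds U" "b' \<in> bounds V" by blast
    from bounds_add[OF b, of "\<lambda>s. U s + V s"] show ?case by (auto simp: abs_triangle_ineq)
  next
    case (scale U r)
    then obtain b where "b \<in> bounds U" by blast
    from bounds_scale[OF this, of r] show ?case by auto
  next
    case (max U V)
    then obtain b b' where b: "b \<in> bounds U" "b' \<in> bounds V" by blast
    have "\<exists>b''\<in>bounds (\<lambda>s. Orderings.max (U s) (V s)). b'' \<le> b + b'" by (rule bounds_add[OF b]) auto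
    then show ?case by auto
  qed
  have N_sub: "N W \<le> N U + N V"
    if U: "U \<in> fun_gen (set gs)" and V: "V \<in> fun_gen (set gs)"
      and W: "\<And>s. \<bar>W s\<bar> \<le> \<bar>U s\<bar> + \<bar>V s\<bar>" for U V W
  proof -
    have "N W - b \<le> N V" if b: "b \<in> bounds U" for b
    proof (rule N_ge[OF ne[OF V]])
      fix b' assume "b' \<in> bounds V"
      then obtain b'' where "b'' \<in> bounds W" "b'' \<le> b + b'" using bounds_add[OF b _ W] by blast
      then show "N W - b \<le> b'" using N_le[of b'' W] by simp
    qed
    then have "N W - N V \<le> N U" by (intro N_ge[OF ne[OF U]]) (simp add: diff_le_eq add.commute)
    then show ?thesis by simp
  qed
  have N_scale_le: "N (\<lambda>s. r * U s) \<le> \<bar>r\<bar> * N U" if U: "U \<in> fun_gen (set gs)" for U r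
  proof (cases "r = 0")
    case True
    have "0 \<in> D" using order_idealD(1)[OF order_ideal_principal[OF e]] .
    moreover from this have "J 0 = (\<lambda>_. 0)" using J_hom(7)[of 0 0] by auto
    ultimately show ?thesis using N_J[of 0] True by simp
  next
    case False
    then have r: "0 < \<bar>r\<bar>" by simp
    have "N (\<lambda>s. r * U s) / \<bar>r\<bar> \<le> N U"
    proof (rule N_ge[OF ne[OF U]])
      fix b assume "b \<in> bounds U"
      then obtain b' where "b' \<in> bounds (\<lambda>s. r * U s)" "b' \<le> \<bar>r\<bar> * b" using bounds_scale by blast
      then have "N (\<lambda>s. r * U s) \<le> \<bar>r\<bar> * b" using N_le by (blast intro: order_trans)
      then show "N (\<lambda>s. r * U s) / \<bar>r\<bar> \<le> b" using r by (simp add: pos_divide_le_eq mult.commute)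
    qed
    then show ?thesis using r by (simp add: pos_divide_le_eq mult.commute)
  qed
  fix U V :: "'s \<Rightarrow> real" and r :: real
  show "(\<lambda>_. 0) \<in> fun_gen (set gs)" by (rule fun_gen.zero)
  assume U: "U \<in> fun_gen (set gs)"
  then show "(\<lambda>t. r * U t) \<in> fun_gen (set gs)" by (rule fun_gen.scale)
  show "N (\<lambda>t. r * U t) = \<bar>r\<bar> * N U"
  proof (cases "r = 0")
    case True
    have "0 \<le> N (\<lambda>t. r * U t)" by (rule N_ge[OF ne[OF fun_gen.scale[OF U]] bounds_nonneg])
    then show ?thesis using N_scale_le[OF U, of r] True by simp
  next
    case False
    have "N U \<le> \<bar>inverse r\<bar> * N (\<lambda>t. r * U t)"
      using N_scale_le[OF fun_gen.scale[OF U, of r], of "inverse r"] False by (simp flip: mult.assoc)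
    then have "\<bar>r\<bar> * N U \<le> N (\<lambda>t. r * U t)" using False by (simp add: field_simps)
    then show ?thesis using N_scale_le[OF U, of r] by simp
  qed
  assume V: "V \<in> fun_gen (set gs)"
  show "(\<lambda>t. U t + V t) \<in> fun_gen (set gs)" "(\<lambda>t. max (U t) (V t)) \<in> fun_gen (set gs)"
    using U V by (auto intro: fun_gen.intros)
  show "N (\<lambda>t. U t + V t) \<le> N U + N V" by (rule N_sub[OF U V abs_triangle_ineq])
  show "N U \<le> N V" if "\<And>t. \<bar>U t\<bar> \<le> \<bar>V t\<bar>"
  proof (rule N_ge[OF ne[OF V]])
    fix b assume "b \<in> bounds V"
    then have "b \<in> bounds U"
    proof (elim boundsE)
      fix v c assume 1: "b = norm v + bnorm L c" "v \<in> D" "0 \<le> v" "c \<in> bcarrier L" "\<And>i j. 0 \<le> c i j"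
        "\<And>s. \<bar>V s\<bar> \<le> J v s + I c s"
      show "b \<in> bounds U"
        unfolding 1(1) by (rule boundsI[OF 1(2-5) order_trans[OF that 1(6)]])
    qed
    then show "N U \<le> b" by (rule N_le)
  qed
qed

end

lemma fun_gen_sum:
  assumes "finite A" "\<And>a. a \<in> A \<Longrightarrow> f a \<in> fun_gen G"
  shows "(\<lambda>t. \<Sum>a\<in>A. f a t) \<in> fun_gen G"
  using assms
proof (induction)
  case empty
  show ?case by (simp add: fun_gen.zero)
next
  case (insert a A)
  then have "(\<lambda>t. f a t + (\<Sum>a\<in>A. f a t)) \<in> fun_gen G" by (intro fun_gen.add) auto
  then show ?case using insert.hyps by simp
qed

context amalgam
begin

lemma I_mem_fun_gen:
  assumes "c \<in> bcarrier L" "\<And>i j. i < m \<Longrightarrow> j < n \<Longrightarrow> I (unit_matrix i j) \<in> fun_gen G"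
  shows "I c \<in> fun_gen G"
proof -
  have "(\<lambda>s. \<Sum>i<m. \<Sum>j<n. c i j * I (unit_matrix i j) s) \<in> fun_gen G"
    by (intro fun_gen_sum fun_gen.scale assms(2)) auto
  moreover have "(\<lambda>s. \<Sum>i<m. \<Sum>j<n. c i j * I (unit_matrix i j) s) = I c"
  proof
    fix s
    have "I c s = w s * (\<Sum>i<m. \<Sum>j<n. c i j * unit_matrix i j (row s) (col s))"
      unfolding I_def using matrix_eq_sum_units[OF row col, of c s s] by simp
    then show "(\<Sum>i<m. \<Sum>j<n. c i j * I (unit_matrix i j) s) = I c s"
      by (simp add: I_def sum_distrib_left mult.left_commute)
  qed
  ultimately show ?thesis by simp
qed

text \<open>The functions \<open>J x\<close> for \<open>x\<close> in \<open>as\<close> and the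
  images of the matrix units are finitely many generators, so the completion qualifies for
  \<open>universal_fg\<close>. The final clause estimates a distance in the amalgam by a majorant
  from the ideal alone, with matrix part 0.\<close>

lemma exists_amalgam:
  assumes as: "set as \<subseteq> D"
  shows "\<exists>(X :: (nat \<Rightarrow> real) blat) F G. banach_lattice_on X \<and> finitely_generated X \<and>
     bl_embedding (blat_of (gen_sublattice as)) X F \<and> bl_embedding L X G \<and>
     (\<forall>x\<in>set as. \<forall>c\<in>bcarrier L. \<forall>v\<in>D. 0 \<le> v \<longrightarrow> (\<forall>s. \<bar>J x s - I c s\<bar> \<le> J v s) \<longrightarrow>
        bnorm X (bdiff X (F x) (G c)) \<le> norm v)"
proof -
  define gs where "gs = map J as @ map (\<lambda>(i, j). I (unit_matrix i j)) (List.product [0..<m] [0..<n])"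
  have unit: "unit_matrix i j \<in> bcarrier L" if "i < m" "j < n" for i j
    using that by (auto simp: unit_matrix_def)
  have gs_set: "set gs = J ` set as \<union> (\<lambda>(i, j). I (unit_matrix i j)) ` ({0..<m} \<times> {0..<n})"
    by (simp add: gs_def)
  define M where "M = fun_gen (set gs)"
  have "bounds g \<noteq> {}" if g: "g \<in> set gs" for g
  proof -
    consider x where "x \<in> set as" "g = J x" | i j where "i < m" "j < n" "g = I (unit_matrix i j)"
      using g unfolding gs_set by auto
    then show ?thesis
    proof cases
      case 1
      then show ?thesis using bounds_J[of x] as by blast
    next
      case 2
      then show ?thesis using bounds_I[OF unit, of i j] by blast
    qed
  qed
  then have fl: "fun_lattice M N" unfolding M_def by (rule fun_lattice_gen)
  interpret S: separable_fun_lattice M N "\<lambda>n. rat_eval gs (from_nat n)"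
    using separable_fun_gen[of gs N] fl by (simp add: M_def)
  let ?V = "lat_gen (set as)"
  have VD: "x \<in> D" if "x \<in> ?V" for x using lat_gen_principal_ideal[OF e as that] .
  have JM: "J x \<in> M" if "x \<in> ?V" for x
    using that
  proof induction
    case zero
    have "0 \<in> D" using VD[OF lat_gen.zero] .
    then have "J 0 = (\<lambda>_. 0)" using J_hom(7) by auto
    then show ?case by (simp add: M_def fun_gen.zero)
  next
    case (gen a)
    then have "J a \<in> set gs" using gs_set by blast
    then show ?case unfolding M_def by (rule fun_gen.gen)
  next
    case (add x y)
    have "J (x + y) = (\<lambda>s. J x s + J y s)" using J_hom(1)[OF VD VD] add.hyps by blast
    then show ?case using add.IH S.add_mem by simp
  next
    case (scale x r)
    have "J (r *\<^sub>R x) = (\<lambda>s. r * J x s)" using J_hom(5)[OF VD VD] scale.hyps by blast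
    then show ?case using scale.IH S.scale_mem by simp
  next
    case (sup x y)
    have "J (Lattices.sup x y) = (\<lambda>s. max (J x s) (J y s))" using J_hom(3)[OF VD VD] sup.hyps by blast
    then show ?case using sup.IH S.max_mem by simp
  qed
  have IM: "I c \<in> M" if "c \<in> bcarrier L" for c
    unfolding M_def
  proof (rule I_mem_fun_gen[OF that])
    fix i j assume "i < m" "j < n"
    then have "(i, j) \<in> {0..<m} \<times> {0..<n}" by simp
    then have "I (unit_matrix i j) \<in> set gs" unfolding gs_set by force
    then show "I (unit_matrix i j) \<in> fun_gen (set gs)" by (rule fun_gen.gen)
  qed
  have NJ_diff: "N (\<lambda>s. J x s - J y s) = norm (x - y)" if "x \<in> ?V" "y \<in> ?V" for x y
  proof -
    have "J (x - y) = (\<lambda>s. J x s - J y s)" using J_hom(2)[OF VD VD] that by blast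
    then show ?thesis using N_J[OF VD[OF lat_gen_diff[OF that]]] by simp
  qed
  let ?X = "S.completion.quot"
  \<comment> \<open>\<open>J\<close> is a homomorphism on the ideal only. An element of
    \<open>gen_sublattice as\<close> is therefore sent to the class of the images of lattice
    polynomials converging to it; as \<open>J\<close> is isometric, the class does not depend on the
    sequence.\<close>
  let ?seq = "\<lambda>p (k, s). J (p k) s"
  have seq: "?seq p \<in> S.cauchy_seqs" "S.N_lim (?seq p) = norm x"
    if p: "\<And>k. p k \<in> ?V" "p \<longlonglongrightarrow> x" for p x
  proof -
    have "S.cauchy_in (\<lambda>k s. J (p k) s)"
      unfolding S.cauchy_in_def NJ_diff[OF p(1) p(1)]
      using LIMSEQ_imp_Cauchy[OF p(2)] by (simp add: Cauchy_iff)
    then show c: "?seq p \<in> S.cauchy_seqs" by (simp add: S.cauchy_seqs_def JM p)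
    show "S.N_lim (?seq p) = norm x"
      by (rule S.N_lim_eq[OF c]) (simp add: N_J VD p tendsto_norm)
  qed
  have cls_eq: "S.completion.cls (?seq p) = S.completion.cls (?seq q)"
    if p: "\<And>k. p k \<in> ?V" "p \<longlonglongrightarrow> x" and q: "\<And>k. q k \<in> ?V" "q \<longlonglongrightarrow> x" for p q x
  proof -
    have "S.N_lim (\<lambda>t. ?seq p t - ?seq q t) = 0"
    proof (rule S.N_lim_eq)
      show "(\<lambda>t. ?seq p t - ?seq q t) \<in> S.cauchy_seqs"
        by (rule S.completion.diff_mem[OF seq(1)[OF p] seq(1)[OF q]])
      have "(\<lambda>k. norm (p k - q k)) \<longlonglongrightarrow> 0"
        using tendsto_norm[OF tendsto_diff[OF p(2) q(2)]] by simp
      then show "(\<lambda>k. N (\<lambda>s. ?seq p (k, s) - ?seq q (k, s))) \<longlonglongrightarrow> 0" by (simp add: NJ_diff p q)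
    qed
    then show ?thesis using S.completion.cls_eq_iff[OF seq(1)[OF p] seq(1)[OF q]] by blast
  qed
  define sel where "sel x = (SOME p. (\<forall>k. p k \<in> ?V) \<and> p \<longlonglongrightarrow> x)" for x
  have sel: "\<And>k. sel x k \<in> ?V" "sel x \<longlonglongrightarrow> x" if "x \<in> gen_sublattice as" for x
    using someI_ex[OF gen_sublattice_limit[OF that]] unfolding sel_def by blast+
  define F where "F x = S.completion.cls (?seq (sel x))" for x
  have F_eq: "F x = S.completion.cls (?seq p)"
    if "x \<in> gen_sublattice as" "\<And>k. p k \<in> ?V" "p \<longlonglongrightarrow> x" for x p
    unfolding F_def using cls_eq[OF sel[OF that(1)] that(2,3)] .
  define G where "G c = S.embed (I c)" for c
  have F: "bl_embedding (blat_of (gen_sublattice as)) ?X F"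
    unfolding bl_embedding_def blat_of_simps
  proof (intro conjI ballI allI)
    fix x and a :: real assume x: "x \<in> gen_sublattice as"
    note x' = sel[OF x]
    show "F x \<in> bcarrier ?X" unfolding F_def S.completion.quot_carrier by (rule imageI[OF seq(1)[OF x']])
    show "bnorm ?X (F x) = norm x"
      unfolding F_def S.completion.quot_norm[OF seq(1)[OF x']] by (rule seq(2)[OF x'])
    have gs: "a *\<^sub>R x \<in> gen_sublattice as"
      using closed_sublattice_gen[of as] x by (simp add: closed_sublattice_def subspace_def)
    have "(\<lambda>t. a * ?seq (sel x) t) = ?seq (\<lambda>k. a *\<^sub>R sel x k)"
      using J_hom(5)[OF VD VD, OF x'(1) x'(1)] by auto
    then show "F (a *\<^sub>R x) = bscale ?X a (F x)"
      using F_eq[OF gs lat_gen.scale[OF x'(1)] tendsto_scaleR[OF tendsto_const x'(2)]]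
        S.completion.quot_scale[OF seq(1)[OF x'], of a] by (simp add: F_def)
    fix y assume y: "y \<in> gen_sublattice as"
    note y' = sel[OF y]
    have gen: "x + y \<in> gen_sublattice as" "sup x y \<in> gen_sublattice as" "inf x y \<in> gen_sublattice as"
      using closed_sublattice_gen[of as] x y by (simp_all add: closed_sublattice_def subspace_def)
    have "(\<lambda>t. ?seq (sel x) t + ?seq (sel y) t) = ?seq (\<lambda>k. sel x k + sel y k)"
      using J_hom(1)[OF VD VD, OF x'(1) y'(1)] by auto
    then show "F (x + y) = badd ?X (F x) (F y)"
      using F_eq[OF gen(1) lat_gen.add[OF x'(1) y'(1)] tendsto_add[OF x'(2) y'(2)]]
        S.completion.quot_add[OF seq(1)[OF x'] seq(1)[OF y']] by (simp add: F_def)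
    have "(\<lambda>t. max (?seq (sel x) t) (?seq (sel y) t)) = ?seq (\<lambda>k. sup (sel x k) (sel y k))"
      using J_hom(3)[OF VD VD, OF x'(1) y'(1)] by auto
    then show "F (sup x y) = bsup ?X (F x) (F y)"
      using F_eq[OF gen(2) lat_gen.sup[OF x'(1) y'(1)] tendsto_sup_lattice[OF x'(2) y'(2)]]
        S.completion.quot_sup[OF seq(1)[OF x'] seq(1)[OF y']] by (simp add: F_def)
    have "(\<lambda>t. min (?seq (sel x) t) (?seq (sel y) t)) = ?seq (\<lambda>k. inf (sel x k) (sel y k))"
      using J_hom(4)[OF VD VD, OF x'(1) y'(1)] by auto
    then show "F (inf x y) = binf ?X (F x) (F y)"
      using F_eq[OF gen(3) lat_gen_inf[OF x'(1) y'(1)] tendsto_inf_lattice[OF x'(2) y'(2)]]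
        S.completion.quot_inf[OF seq(1)[OF x'] seq(1)[OF y']] by (simp add: F_def)
  qed
  have G: "bl_embedding L ?X G"
    unfolding bl_embedding_def
  proof (intro conjI ballI allI)
    fix c and a :: real assume c: "c \<in> bcarrier L"
    show "G c \<in> bcarrier ?X"
      unfolding G_def S.completion.quot_carrier by (rule imageI[OF S.const_cauchy_seqs[OF IM[OF c]]])
    show "bnorm ?X (G c) = bnorm L c" unfolding G_def S.embed_norm[OF IM[OF c]] by (rule N_I[OF c])
    have "I (bscale L a c) = (\<lambda>s. a * I c s)" by (simp add: fun_eq_iff I_hom)
    then show "G (bscale L a c) = bscale ?X a (G c)" unfolding G_def S.embed_scale[OF IM[OF c]] by simp
    fix d assume d: "d \<in> bcarrier L"
    have "I (badd L c d) = (\<lambda>s. I c s + I d s)" "I (bsup L c d) = (\<lambda>s. max (I c s) (I d s))"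
      "I (binf L c d) = (\<lambda>s. min (I c s) (I d s))" by (simp_all add: fun_eq_iff I_hom)
    then show "G (badd L c d) = badd ?X (G c) (G d)" "G (bsup L c d) = bsup ?X (G c) (G d)"
      "G (binf L c d) = binf ?X (G c) (G d)"
      unfolding G_def S.embed_add[OF IM[OF c] IM[OF d]] S.embed_sup[OF IM[OF c] IM[OF d]]
        S.embed_inf[OF IM[OF c] IM[OF d]] by simp_all
  qed
  have close: "bnorm ?X (bdiff ?X (F x) (G c)) \<le> norm v"
    if x: "x \<in> set as" and c: "c \<in> bcarrier L" and v: "v \<in> D" "0 \<le> v"
      and le: "\<And>s. \<bar>J x s - I c s\<bar> \<le> J v s" for x c v
  proof -
    have xV: "x \<in> ?V" using x by (rule lat_gen.gen)
    have Fx: "F x = S.embed (J x)"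
      by (rule F_eq[OF subsetD[OF set_subset_gen x] xV tendsto_const])
    have "bdiff ?X (F x) (G c) = S.embed (\<lambda>s. J x s - I c s)"
      unfolding bdiff_def Fx G_def S.embed_scale[OF IM[OF c]]
        S.embed_add[OF JM[OF xV] S.scale_mem[OF IM[OF c]]] by simp
    then have "bnorm ?X (bdiff ?X (F x) (G c)) = N (\<lambda>s. J x s - I c s)"
      by (simp only: S.embed_norm[OF S.diff_mem[OF JM[OF xV] IM[OF c]]])
    also have "\<dots> \<le> norm v + bnorm L (\<lambda>i j. 0)"
      by (rule N_le[OF boundsI]) (use v le in \<open>auto simp: I_hom\<close>)
    finally show ?thesis by (simp add: linf_l1_norm_zero m)
  qed
  show ?thesis
    using S.completion.banach_lattice_on_quot S.finitely_generated_completion[OF M_def] F G close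
    by blast
qed

end

section \<open>Moving the amalgam into the limit\<close>

lemma bl_embedding_comp:
  assumes "bl_embedding A B f" "bl_embedding B C g"
  shows "bl_embedding A C (\<lambda>x. g (f x))"
  using assms unfolding bl_embedding_def by simp

lemma lattice_isometry_inv:
  fixes \<phi> :: "'a::banach_lattice \<Rightarrow> 'a"
  assumes "lattice_isometry (blat_of UNIV) (blat_of UNIV) \<phi>"
  shows "bl_embedding (blat_of UNIV) (blat_of UNIV) (inv \<phi>)" "\<phi> (inv \<phi> y) = y" "\<phi> (x - y) = \<phi> x - \<phi> y"
    "norm (\<phi> x) = norm x"
proof -
  have emb: "norm (\<phi> x) = norm x" "\<phi> (a *\<^sub>R x) = a *\<^sub>R \<phi> x" "\<phi> (x + y) = \<phi> x + \<phi> y"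
    "\<phi> (sup x y) = sup (\<phi> x) (\<phi> y)" "\<phi> (inf x y) = inf (\<phi> x) (\<phi> y)" for x y a
    using assms by (auto simp: lattice_isometry_def bl_embedding_def)
  have surj: "surj \<phi>" using assms by (simp add: lattice_isometry_def)
  show diff: "\<phi> (x - y) = \<phi> x - \<phi> y" for x y
    using emb(3)[of x "- y"] emb(2)[of "- 1" y] by simp
  have "inj \<phi>"
  proof (rule injI)
    fix x y assume "\<phi> x = \<phi> y"
    then have "norm (x - y) = 0" using emb(1)[of "x - y"] diff[of x y] by simp
    then show "x = y" by simp
  qed
  then have inv: "inv \<phi> (\<phi> x) = x" for x by simp
  show surj': "\<phi> (inv \<phi> y) = y" for y by (rule surj_f_inv_f[OF surj])
  show "norm (\<phi> x) = norm x" by (rule emb(1))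
  show "bl_embedding (blat_of UNIV) (blat_of UNIV) (inv \<phi>)"
    unfolding bl_embedding_def blat_of_simps
  proof (intro conjI ballI allI)
    fix x y a
    show "norm (inv \<phi> x) = norm x" using emb(1)[of "inv \<phi> x"] surj'[of x] by simp
    show "inv \<phi> (a *\<^sub>R x) = a *\<^sub>R inv \<phi> x" using inv[of "a *\<^sub>R inv \<phi> x"] by (simp add: emb surj')
    show "inv \<phi> (x + y) = inv \<phi> x + inv \<phi> y" using inv[of "inv \<phi> x + inv \<phi> y"] by (simp add: emb surj')
    show "inv \<phi> (sup x y) = sup (inv \<phi> x) (inv \<phi> y)" using inv[of "sup (inv \<phi> x) (inv \<phi> y)"] by (simp add: emb surj')
    show "inv \<phi> (inf x y) = inf (inv \<phi> x) (inv \<phi> y)" using inv[of "inf (inv \<phi> x) (inv \<phi> y)"] by (simp add: emb surj')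
  qed simp
qed

text \<open>Universality puts a copy of the amalgam into the limit, but the copy of
  \<open>gen_sublattice as\<close> in it need not be the original. Homogeneity supplies an
  automorphism taking the original generators close to their copies, and its inverse brings the
  matrices back.\<close>

lemma (in amalgam) embed_in_BL:
  assumes BL: "is_BL TYPE('a)" and as: "set as \<subseteq> D" and \<epsilon>: "0 < \<epsilon>"
  shows "\<exists>g. bl_embedding L (blat_of (UNIV :: 'a set)) g \<and>
     (\<forall>x\<in>set as. \<forall>c\<in>bcarrier L. \<forall>v\<in>D. 0 \<le> v \<longrightarrow> (\<forall>s. \<bar>J x s - I c s\<bar> \<le> J v s) \<longrightarrow>
        norm (x - g c) \<le> norm v + \<epsilon>)"
proof -
  obtain X :: "(nat \<Rightarrow> real) blat" and F G where X: "banach_lattice_on X" "finitely_generated X"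
    and F: "bl_embedding (blat_of (gen_sublattice as)) X F" and G: "bl_embedding L X G"
    and close: "\<And>x c v. x \<in> set as \<Longrightarrow> c \<in> bcarrier L \<Longrightarrow> v \<in> D \<Longrightarrow> 0 \<le> v \<Longrightarrow>
        (\<And>s. \<bar>J x s - I c s\<bar> \<le> J v s) \<Longrightarrow> bnorm X (bdiff X (F x) (G c)) \<le> norm v"
    using exists_amalgam[OF as] by auto
  interpret X: banach_lattice_on X by (rule X(1))
  obtain h where h: "bl_embedding X (blat_of (UNIV :: 'a set)) h"
    using BL X unfolding is_BL_def universal_fg_def by blast
  have "bl_embedding (blat_of (gen_sublattice as)) (blat_of UNIV) (\<lambda>x. h (F x))"
    by (rule bl_embedding_comp[OF F h])
  then obtain \<phi> where \<phi>: "lattice_isometry (blat_of UNIV) (blat_of UNIV) \<phi>"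
    and \<phi>_close: "\<And>a. a \<in> set as \<Longrightarrow> norm (h (F a) - \<phi> a) < \<epsilon>"
    using BL \<epsilon> unfolding is_BL_def approx_ultrahomogeneous_def by blast
  note inv = lattice_isometry_inv[OF \<phi>]
  have "bl_embedding L (blat_of UNIV) (\<lambda>c. inv \<phi> (h (G c)))"
    by (rule bl_embedding_comp[OF bl_embedding_comp[OF G h] inv(1)])
  moreover have "norm (x - inv \<phi> (h (G c))) \<le> norm v + \<epsilon>"
    if x: "x \<in> set as" and c: "c \<in> bcarrier L" and v: "v \<in> D" "0 \<le> v"
      and le: "\<And>s. \<bar>J x s - I c s\<bar> \<le> J v s" for x c v
  proof -
    have FG: "F x \<in> bcarrier X" "G c \<in> bcarrier X"
      using F G c x set_subset_gen[of as] by (auto simp: bl_embedding_def simp del: linf_l1_simps)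
    have hd: "h (bdiff X (F x) (G c)) = h (F x) - h (G c)"
      using h FG X.scale_closed[OF FG(2)] by (simp add: bdiff_def bl_embedding_def)
    have "bdiff X (F x) (G c) \<in> bcarrier X" using FG X.scale_closed X.add_closed by (simp add: bdiff_def)
    then have "norm (h (F x) - h (G c)) = bnorm X (bdiff X (F x) (G c))"
      unfolding hd[symmetric] using h by (simp add: bl_embedding_def)
    also have "\<dots> \<le> norm v" by (rule close[OF x c v le])
    finally have 1: "norm (h (F x) - h (G c)) \<le> norm v" .
    have "norm (x - inv \<phi> (h (G c))) = norm (\<phi> x - h (G c))"
      using inv(4)[of "x - inv \<phi> (h (G c))"] by (simp add: inv)
    also have "\<dots> = norm ((h (F x) - h (G c)) - (h (F x) - \<phi> x))" by simp
    also have "\<dots> \<le> norm (h (F x) - h (G c)) + norm (h (F x) - \<phi> x)" by (rule norm_triangle_ineq4)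
    also have "\<dots> \<le> norm v + \<epsilon>" using 1 \<phi>_close[OF x] by simp
    finally show ?thesis .
  qed
  ultimately show ?thesis by blast
qed

section \<open>Finite-dimensional lattice seminorms\<close>

text \<open>
  A linear functional below \<open>q\<close> is represented by its graph; that the graph is single-valued follows
  from the bound.
\<close>

definition dominated_graph :: "((nat \<Rightarrow> real) \<Rightarrow> real) \<Rightarrow> ((nat \<Rightarrow> real) \<times> real) set \<Rightarrow> bool" where
  "dominated_graph q W \<longleftrightarrow> ((\<lambda>_. 0), 0) \<in> W \<and>
     (\<forall>y t z s. (y, t) \<in> W \<longrightarrow> (z, s) \<in> W \<longrightarrow> ((\<lambda>k. y k + z k), t + s) \<in> W) \<and>
     (\<forall>r y t. (y, t) \<in> W \<longrightarrow> ((\<lambda>k. r * y k), r * t) \<in> W) \<and>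
     (\<forall>y t. (y, t) \<in> W \<longrightarrow> t \<le> q y)"

lemma dominated_graphD:
  assumes "dominated_graph q W"
  shows "((\<lambda>_. 0), 0) \<in> W" "(y, t) \<in> W \<Longrightarrow> (z, s) \<in> W \<Longrightarrow> ((\<lambda>k. y k + z k), t + s) \<in> W"
    "(y, t) \<in> W \<Longrightarrow> ((\<lambda>k. r * y k), r * t) \<in> W" "(y, t) \<in> W \<Longrightarrow> t \<le> q y"
  using assms unfolding dominated_graph_def by blast+

locale sublinear =
  fixes q :: "(nat \<Rightarrow> real) \<Rightarrow> real"
  assumes q_add: "q (\<lambda>k. y k + z k) \<le> q y + q z"
    and q_scale: "0 \<le> r \<Longrightarrow> q (\<lambda>k. r * y k) = r * q y"
begin

lemma q_zero: "q (\<lambda>_. 0) = 0"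
  using q_scale[of 0 "\<lambda>_. 0"] by simp

text \<open>The one-dimensional step of Hahn and Banach: the value at \<open>v\<close> has to lie
  above all \<open>t - q (y - v)\<close> and below all \<open>q (z + v) - s\<close>. Subadditivity
  makes these bounds compatible, and the supremum of the former is taken.\<close>

lemma dominated_graph_extend:
  assumes W: "dominated_graph q W"
  shows "\<exists>a. dominated_graph q {((\<lambda>k. y k + r * v k), t + r * a) | y t r. (y, t) \<in> W}"
proof -
  note W' = dominated_graphD[OF W]
  define A where "A = {t - q (\<lambda>k. y k - v k) | y t. (y, t) \<in> W}"
  have A_le: "b \<le> q (\<lambda>k. z k + v k) - s" if "b \<in> A" "(z, s) \<in> W" for b z s
  proof -
    obtain y t where y: "b = t - q (\<lambda>k. y k - v k)" "(y, t) \<in> W" using \<open>b \<in> A\<close> unfolding A_def by blast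
    have "t + s \<le> q (\<lambda>k. y k + z k)" by (rule W'(4)[OF W'(2)[OF y(2) that(2)]])
    also have "\<dots> \<le> q (\<lambda>k. y k - v k) + q (\<lambda>k. z k + v k)"
      using q_add[of "\<lambda>k. y k - v k" "\<lambda>k. z k + v k"] by (simp add: algebra_simps)
    finally show ?thesis using y(1) by simp
  qed
  have A_ne: "A \<noteq> {}" using W'(1) unfolding A_def by blast
  have A_bdd: "bdd_above A" unfolding bdd_above_def using A_le[OF _ W'(1)] by blast
  define a where "a = Sup A"
  have dom: "t + r * a \<le> q (\<lambda>k. y k + r * v k)" if "(y, t) \<in> W" for y t r
  proof -
    consider "r = 0" | "0 < r" | "r < 0" by linarith
    then show ?thesis
    proof cases
      case 1
      then show ?thesis using W'(4)[OF that] by simp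
    next
      case 2
      have "a \<le> q (\<lambda>k. inverse r * y k + v k) - inverse r * t"
        unfolding a_def by (rule cSup_least[OF A_ne A_le[OF _ W'(3)[OF that]]])
      then have "r * a \<le> r * (q (\<lambda>k. inverse r * y k + v k) - inverse r * t)"
        using 2 by (intro mult_left_mono) simp_all
      also have "\<dots> = q (\<lambda>k. r * (inverse r * y k + v k)) - t"
        using 2 q_scale[of r "\<lambda>k. inverse r * y k + v k"] by (simp add: algebra_simps)
      also have "(\<lambda>k. r * (inverse r * y k + v k)) = (\<lambda>k. y k + r * v k)"
        using 2 by (simp add: fun_eq_iff field_simps)
      finally show ?thesis by simp
    next
      case 3
      define s where "s = - r"
      have s: "0 < s" using 3 by (simp add: s_def)
      have "inverse s * t - q (\<lambda>k. inverse s * y k - v k) \<in> A" unfolding A_def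
        by (intro CollectI exI[of _ "\<lambda>k. inverse s * y k"] exI[of _ "inverse s * t"] conjI refl W'(3)[OF that])
      then have "inverse s * t - q (\<lambda>k. inverse s * y k - v k) \<le> a" unfolding a_def by (rule cSup_upper[OF _ A_bdd])
      then have "s * (inverse s * t - q (\<lambda>k. inverse s * y k - v k)) \<le> s * a"
        using s by (intro mult_left_mono) simp_all
      also have "s * (inverse s * t - q (\<lambda>k. inverse s * y k - v k)) = t - q (\<lambda>k. s * (inverse s * y k - v k))"
        using s q_scale[of s "\<lambda>k. inverse s * y k - v k"] by (simp add: algebra_simps)
      also have "(\<lambda>k. s * (inverse s * y k - v k)) = (\<lambda>k. y k + r * v k)"
        using 3 by (simp add: fun_eq_iff field_simps s_def)
      finally show ?thesis by (simp add: s_def)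
    qed
  qed
  have "dominated_graph q {((\<lambda>k. y k + r * v k), t + r * a) | y t r. (y, t) \<in> W}"
    unfolding dominated_graph_def
  proof (intro conjI allI impI)
    show "((\<lambda>_. 0), 0) \<in> {((\<lambda>k. y k + r * v k), t + r * a) | y t r. (y, t) \<in> W}"
      using W'(1) by (intro CollectI exI[of _ "\<lambda>_. 0"] exI[of _ 0]) auto
  next
    fix Y T Z S
    assume "(Y, T) \<in> {((\<lambda>k. y k + r * v k), t + r * a) | y t r. (y, t) \<in> W}"
      "(Z, S) \<in> {((\<lambda>k. y k + r * v k), t + r * a) | y t r. (y, t) \<in> W}"
    then obtain y t r z s r' where "(y, t) \<in> W" "(z, s) \<in> W" "Y = (\<lambda>k. y k + r * v k)" "T = t + r * a"
      "Z = (\<lambda>k. z k + r' * v k)" "S = s + r' * a" by blast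
    then show "((\<lambda>k. Y k + Z k), T + S) \<in> {((\<lambda>k. y k + r * v k), t + r * a) | y t r. (y, t) \<in> W}"
      using W'(2)[of y t z s]
      by (intro CollectI exI[of _ "\<lambda>k. y k + z k"] exI[of _ "t + s"] exI[of _ "r + r'"]) (auto simp: algebra_simps)
  next
    fix c Y T
    assume "(Y, T) \<in> {((\<lambda>k. y k + r * v k), t + r * a) | y t r. (y, t) \<in> W}"
    then obtain y t r where "(y, t) \<in> W" "Y = (\<lambda>k. y k + r * v k)" "T = t + r * a" by blast
    then show "((\<lambda>k. c * Y k), c * T) \<in> {((\<lambda>k. y k + r * v k), t + r * a) | y t r. (y, t) \<in> W}"
      using W'(3)[of y t c]
      by (intro CollectI exI[of _ "\<lambda>k. c * y k"] exI[of _ "c * t"] exI[of _ "c * r"]) (auto simp: algebra_simps)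
  next
    fix Y T
    assume "(Y, T) \<in> {((\<lambda>k. y k + r * v k), t + r * a) | y t r. (y, t) \<in> W}"
    then show "T \<le> q Y" using dom by blast
  qed
  then show ?thesis by blast
qed

text \<open>Only the \<open>p\<close> unit vectors have to be adjoined, so induction replaces Zorn's
  lemma.\<close>

lemma dominated_graph_weights:
  assumes "dominated_graph q W"
  shows "\<exists>W' w. dominated_graph q W' \<and> W \<subseteq> W' \<and> (\<forall>k<p. (\<lambda>l. if l = k then 1 else 0, w k :: real) \<in> W')"
proof (induction p)
  case 0
  show ?case using assms by blast
next
  case (Suc p)
  then obtain W' w where W': "dominated_graph q W'" "W \<subseteq> W'" "\<forall>k<p. (\<lambda>l. if l = k then 1 else 0, w k :: real) \<in> W'"
    by blast
  let ?v = "\<lambda>l. if l = p then 1 else 0 :: real"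
  obtain a where a: "dominated_graph q {((\<lambda>k. y k + r * ?v k), t + r * a) | y t r. (y, t) \<in> W'}" (is "dominated_graph q ?W")
    using dominated_graph_extend[OF W'(1), of ?v] by blast
  have sub: "W' \<subseteq> ?W"
  proof
    fix x assume x: "x \<in> W'"
    obtain y t where "x = (y, t)" by (cases x)
    with x show "x \<in> ?W" by (intro CollectI exI[of _ y] exI[of _ t] exI[of _ 0]) simp
  qed
  have v: "(?v, a) \<in> ?W"
    using dominated_graphD(1)[OF W'(1)] by (intro CollectI exI[of _ "\<lambda>_. 0"] exI[of _ 0] exI[of _ 1]) simp
  have "(\<lambda>l. if l = k then 1 else 0, (w(p := a)) k) \<in> ?W" if "k < Suc p" for k
  proof (cases "k = p")
    case True
    then show ?thesis using v by simp
  next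
    case False
    then have "(\<lambda>l. if l = k then 1 else 0, w k) \<in> W'" using W'(3) that by simp
    from subsetD[OF sub this] show ?thesis by (simp only: fun_upd_other[OF False])
  qed
  then show ?case using a sub W'(2) by blast
qed

lemma hahn_banach_weights:
  assumes W: "dominated_graph q W" and supp: "\<And>y t k. (y, t) \<in> W \<Longrightarrow> p \<le> k \<Longrightarrow> y k = 0"
  shows "\<exists>w. (\<forall>y t. (y, t) \<in> W \<longrightarrow> (\<Sum>k<p. w k * y k) = t) \<and>
     (\<forall>z. (\<forall>k\<ge>p. z k = 0) \<longrightarrow> (\<Sum>k<p. w k * z k) \<le> q z)"
proof -
  obtain W' w where W': "dominated_graph q W'" "W \<subseteq> W'"
    and w: "\<And>k. k < p \<Longrightarrow> (\<lambda>l. if l = k then 1 else 0, w k :: real) \<in> W'"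
    using dominated_graph_weights[OF W, of p] by blast
  note D = dominated_graphD[OF W'(1)]
  have comb: "((\<lambda>l. if l < r then z l else 0), \<Sum>k<r. w k * z k) \<in> W'" if "r \<le> p" for r z
    using that
  proof (induction r)
    case 0
    then show ?case using D(1) by simp
  next
    case (Suc r)
    have "((\<lambda>l. (if l < r then z l else 0) + z r * (if l = r then 1 else 0)), (\<Sum>k<r. w k * z k) + z r * w r) \<in> W'"
      using Suc by (intro D(2) D(3) w) auto
    moreover have "(\<lambda>l. (if l < r then z l else 0) + z r * (if l = r then 1 else 0)) = (\<lambda>l. if l < Suc r then z l else 0)"
      by (auto simp: fun_eq_iff less_Suc_eq)
    ultimately show ?case by (simp add: mult.commute)
  qed
  have mem: "(z, \<Sum>k<p. w k * z k) \<in> W'" if "\<forall>k\<ge>p. z k = 0" for z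
  proof -
    have "(\<lambda>l. if l < p then z l else 0) = z" using that by auto
    then show ?thesis using comb[of p z] by simp
  qed
  have "(\<Sum>k<p. w k * y k) = t" if yt: "(y, t) \<in> W" for y t
  proof -
    have 1: "(y, \<Sum>k<p. w k * y k) \<in> W'" using supp[OF yt] by (intro mem) blast
    have 2: "(y, t) \<in> W'" using yt W'(2) by blast
    \<comment> \<open>The difference of two values at \<open>y\<close> is a value at the zero
      vector, hence at most \<open>q 0 = 0\<close>; exchanging the two gives equality.\<close>
    have "((\<lambda>k. y k + - 1 * y k), (\<Sum>k<p. w k * y k) + - 1 * t) \<in> W'" by (intro D(2) D(3) 1 2)
    from D(4)[OF this] have a: "(\<Sum>k<p. w k * y k) \<le> t" by (simp add: q_zero)
    have "((\<lambda>k. y k + - 1 * y k), t + - 1 * (\<Sum>k<p. w k * y k)) \<in> W'" by (intro D(2) D(3) 1 2)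
    from D(4)[OF this] have "t \<le> (\<Sum>k<p. w k * y k)" by (simp add: q_zero)
    with a show ?thesis by simp
  qed
  moreover have "(\<Sum>k<p. w k * z k) \<le> q z" if "\<forall>k\<ge>p. z k = 0" for z by (rule D(4)[OF mem[OF that]])
  ultimately show ?thesis by blast
qed

end

text \<open>A lattice seminorm on \<open>p\<close>-dimensional space, given on positive vectors only.\<close>

locale positive_seminorm =
  fixes p :: nat and \<rho> :: "(nat \<Rightarrow> real) \<Rightarrow> real"
  assumes \<rho>_add: "(\<And>k. 0 \<le> y k) \<Longrightarrow> (\<And>k. 0 \<le> z k) \<Longrightarrow> \<rho> (\<lambda>k. y k + z k) \<le> \<rho> y + \<rho> z"
    and \<rho>_scale: "(\<And>k. 0 \<le> y k) \<Longrightarrow> 0 \<le> r \<Longrightarrow> \<rho> (\<lambda>k. r * y k) = r * \<rho> y"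
    and \<rho>_mono: "(\<And>k. 0 \<le> y k) \<Longrightarrow> (\<And>k. k < p \<Longrightarrow> y k \<le> z k) \<Longrightarrow> (\<And>k. 0 \<le> z k) \<Longrightarrow> \<rho> y \<le> \<rho> z"
    and p: "0 < p"
begin

lemma \<rho>_zero: "\<rho> (\<lambda>_. 0) = 0"
  using \<rho>_scale[of "\<lambda>_. 0" 0] by simp

lemma \<rho>_nonneg: "(\<And>k. 0 \<le> y k) \<Longrightarrow> 0 \<le> \<rho> y"
  using \<rho>_mono[of "\<lambda>_. 0" y] by (simp add: \<rho>_zero)

text \<open>Composition with the positive part forces positivity: a linear functional below this
  bound is at most 0 at negative vectors.\<close>

lemma sublinear_pos: "0 \<le> C \<Longrightarrow> sublinear (\<lambda>z. C * \<rho> (\<lambda>k. max (z k) 0))"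
proof
  assume C: "0 \<le> C"
  fix y z :: "nat \<Rightarrow> real"
  have "\<rho> (\<lambda>k. max (y k + z k) 0) \<le> \<rho> (\<lambda>k. max (y k) 0 + max (z k) 0)" by (rule \<rho>_mono) auto
  also have "\<dots> \<le> \<rho> (\<lambda>k. max (y k) 0) + \<rho> (\<lambda>k. max (z k) 0)" by (rule \<rho>_add) auto
  finally show "C * \<rho> (\<lambda>k. max (y k + z k) 0) \<le> C * \<rho> (\<lambda>k. max (y k) 0) + C * \<rho> (\<lambda>k. max (z k) 0)"
    unfolding distrib_left[symmetric] by (rule mult_left_mono[OF _ C])
  fix r :: real assume "0 \<le> r"
  then show "C * \<rho> (\<lambda>k. max (r * y k) 0) = r * (C * \<rho> (\<lambda>k. max (y k) 0))"
    using \<rho>_scale[of "\<lambda>k. max (y k) 0" r] by (simp add: max_mult_distrib_left)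
qed

abbreviation unit_vec :: "nat \<Rightarrow> nat \<Rightarrow> real" where
  "unit_vec k \<equiv> (\<lambda>l. if l = k then 1 else 0)"

lemma positive_weights:
  assumes C: "0 \<le> C" and W: "dominated_graph (\<lambda>z. C * \<rho> (\<lambda>k. max (z k) 0)) W"
    and supp: "\<And>y t k. (y, t) \<in> W \<Longrightarrow> p \<le> k \<Longrightarrow> y k = 0"
  shows "\<exists>w. (\<forall>k. 0 \<le> w k) \<and> (\<forall>y t. (y, t) \<in> W \<longrightarrow> (\<Sum>k<p. w k * y k) = t) \<and>
     (\<forall>z. (\<forall>k. 0 \<le> z k) \<longrightarrow> (\<Sum>k<p. w k * z k) \<le> C * \<rho> z)"
proof -
  interpret sublinear "\<lambda>z. C * \<rho> (\<lambda>k. max (z k) 0)" by (rule sublinear_pos[OF C])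
  obtain w where w1: "\<And>y t. (y, t) \<in> W \<Longrightarrow> (\<Sum>k<p. w k * y k) = t"
    and w2: "\<And>z. (\<And>k. k \<ge> p \<Longrightarrow> z k = 0) \<Longrightarrow> (\<Sum>k<p. w k * z k) \<le> C * \<rho> (\<lambda>k. max (z k) 0)"
    using hahn_banach_weights[OF W, of p] supp by blast
  have w_nonneg: "0 \<le> w k" if "k < p" for k
  proof -
    have max0: "(\<lambda>l. max (if l = k then - 1 else 0) (0 :: real)) = (\<lambda>_. 0)" by auto
    have "(\<Sum>l<p. w l * (if l = k then - 1 else 0)) \<le> C * \<rho> (\<lambda>l. max (if l = k then - 1 else 0) 0)"
      by (rule w2) (use that in auto)
    then have "(\<Sum>l<p. if l = k then - w l else 0) \<le> 0"
      unfolding max0 \<rho>_zero by (simp add: if_distrib[of "\<lambda>x. w _ * x"] cong: if_cong)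
    then show ?thesis using that by simp
  qed
  \<comment> \<open>Only the first \<open>p\<close> weights are known to be positive; zeros
    elsewhere extend this to all indices.\<close>
  define w' where "w' k = (if k < p then w k else 0)" for k
  have sum_eq: "(\<Sum>k<p. w' k * z k) = (\<Sum>k<p. w k * z k)" for z by (rule sum.cong) (auto simp: w'_def)
  have "(\<Sum>k<p. w' k * z k) \<le> C * \<rho> z" if z: "\<forall>k. 0 \<le> z k" for z
  proof -
    have "(\<Sum>k<p. w' k * z k) = (\<Sum>k<p. w k * (if k < p then z k else 0))"
      by (rule sum.cong) (auto simp: w'_def)
    also have "\<dots> \<le> C * \<rho> (\<lambda>k. max (if k < p then z k else 0) 0)" by (rule w2) simp
    also have "\<dots> \<le> C * \<rho> z" using z by (intro mult_left_mono \<rho>_mono C) auto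
    finally show ?thesis .
  qed
  then show ?thesis using w1 w_nonneg by (intro exI[of _ w']) (auto simp: sum_eq w'_def)
qed

text \<open>Hahn and Banach, starting from the multiples of \<open>z\<close>. Negative multiples
  obey the bound because \<open>\<rho>\<close> is non-negative at positive vectors.\<close>

lemma norming_weights:
  assumes z: "\<And>k. 0 \<le> z k"
  shows "\<exists>f. (\<forall>k. 0 \<le> f k) \<and> (\<Sum>k<p. f k * z k) = \<rho> z \<and> (\<forall>y. (\<forall>k. 0 \<le> y k) \<longrightarrow> (\<Sum>k<p. f k * y k) \<le> \<rho> y)"
proof -
  let ?z = "\<lambda>k. if k < p then z k else 0"
  have \<rho>z: "\<rho> ?z = \<rho> z" by (intro antisym \<rho>_mono) (auto simp: z)
  let ?W = "{((\<lambda>k. r * ?z k), r * \<rho> z) | r. True}"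
  have "dominated_graph (\<lambda>z. 1 * \<rho> (\<lambda>k. max (z k) 0)) ?W"
    unfolding dominated_graph_def
  proof (intro conjI allI impI)
    show "((\<lambda>_. 0), 0) \<in> ?W" by (intro CollectI exI[of _ 0]) simp
  next
    fix y t z' s assume "(y, t) \<in> ?W" "(z', s) \<in> ?W"
    then obtain r r' where "y = (\<lambda>k. r * ?z k)" "t = r * \<rho> z" "z' = (\<lambda>k. r' * ?z k)" "s = r' * \<rho> z" by blast
    then show "((\<lambda>k. y k + z' k), t + s) \<in> ?W" by (intro CollectI exI[of _ "r + r'"]) (auto simp: algebra_simps)
  next
    fix c y t assume "(y, t) \<in> ?W"
    then obtain r where "y = (\<lambda>k. r * ?z k)" "t = r * \<rho> z" by blast
    then show "((\<lambda>k. c * y k), c * t) \<in> ?W" by (intro CollectI exI[of _ "c * r"]) (auto simp: algebra_simps)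
  next
    fix y t assume "(y, t) \<in> ?W"
    then obtain r where r: "y = (\<lambda>k. r * ?z k)" "t = r * \<rho> z" by blast
    have "r * \<rho> z \<le> \<rho> (\<lambda>k. max (r * ?z k) 0)"
    proof (cases "0 \<le> r")
      case True
      then have "(\<lambda>k. max (r * ?z k) 0) = (\<lambda>k. r * ?z k)" using z by (simp add: fun_eq_iff max_absorb1)
      moreover have "\<rho> (\<lambda>k. r * ?z k) = r * \<rho> ?z" using True z by (intro \<rho>_scale) auto
      ultimately show ?thesis using \<rho>z by simp
    next
      case False
      then have "r * \<rho> z \<le> 0" using \<rho>_nonneg[of z] z by (simp add: mult_nonpos_nonneg)
      also have "0 \<le> \<rho> (\<lambda>k. max (r * ?z k) 0)" by (rule \<rho>_nonneg) simp
      finally show ?thesis .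
    qed
    then show "t \<le> 1 * \<rho> (\<lambda>k. max (y k) 0)" using r by simp
  qed
  moreover have "y k = 0" if "(y, t) \<in> ?W" "p \<le> k" for y t k using that by auto
  ultimately have "\<exists>f. (\<forall>k. 0 \<le> f k) \<and> (\<forall>y t. (y, t) \<in> ?W \<longrightarrow> (\<Sum>k<p. f k * y k) = t) \<and>
     (\<forall>z. (\<forall>k. 0 \<le> z k) \<longrightarrow> (\<Sum>k<p. f k * z k) \<le> 1 * \<rho> z)"
    by (intro positive_weights) auto
  then obtain f where f: "\<forall>k. 0 \<le> f k" "\<And>y t. (y, t) \<in> ?W \<Longrightarrow> (\<Sum>k<p. f k * y k) = t"
     "\<forall>z. (\<forall>k. 0 \<le> z k) \<longrightarrow> (\<Sum>k<p. f k * z k) \<le> 1 * \<rho> z"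
    by blast
  have "(\<Sum>k<p. f k * z k) = (\<Sum>k<p. f k * ?z k)" by (rule sum.cong) auto
  also have "\<dots> = \<rho> z" by (rule f(2)) (intro CollectI exI[of _ 1], simp)
  finally show ?thesis using f by auto
qed

text \<open>A norming functional is at most \<open>\<rho> (unit_vec k)\<close> at the
  \<open>k\<close>th unit vector. Rounding it down to multiples of
  \<open>\<rho> (unit_vec k) / (K p)\<close> thus leaves finitely many possibilities and stays below
  \<open>\<rho>\<close>. Since \<open>z k * \<rho> (unit_vec k) \<le> \<rho> z\<close>, each of the
  \<open>p\<close> coordinates loses at most \<open>\<rho> z / (K p)\<close>.\<close>

lemma grid_weights:
  assumes K: "0 < K"
  shows "\<exists>G. finite G \<and> (\<forall>w\<in>G. (\<forall>k. 0 \<le> w k) \<and> (\<forall>z. (\<forall>k. 0 \<le> z k) \<longrightarrow> (\<Sum>k<p. w k * z k) \<le> \<rho> z)) \<and>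
     (\<forall>z. (\<forall>k. 0 \<le> z k) \<longrightarrow> (\<exists>w\<in>G. (1 - 1 / real K) * \<rho> z \<le> (\<Sum>k<p. w k * z k)))"
proof -
  let ?u = "\<lambda>k. \<rho> (unit_vec k)"
  have u_nonneg: "0 \<le> ?u k" for k by (rule \<rho>_nonneg) simp
  let ?F = "{l. \<forall>k. (k \<in> {..<p} \<longrightarrow> l k \<in> {..K * p}) \<and> (k \<notin> {..<p} \<longrightarrow> l k = 0)}"
  let ?w = "\<lambda>l k. real (l k) * ?u k / (real K * real p)"
  let ?G = "{w \<in> ?w ` ?F. \<forall>z. (\<forall>k. 0 \<le> z k) \<longrightarrow> (\<Sum>k<p. w k * z k) \<le> \<rho> z}"
  have "finite ?F" by (rule finite_set_of_finite_funs) auto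
  then have fin: "finite ?G" by simp
  have nonneg: "0 \<le> w k" if "w \<in> ?G" for w k
    using that u_nonneg by (auto intro!: divide_nonneg_nonneg mult_nonneg_nonneg)
  have ex: "\<exists>w\<in>?G. (1 - 1 / real K) * \<rho> z \<le> (\<Sum>k<p. w k * z k)" if z: "\<forall>k. 0 \<le> z k" for z
  proof -
    obtain f where f: "\<And>k. 0 \<le> f k" "(\<Sum>k<p. f k * z k) = \<rho> z"
      "\<And>y. (\<And>k. 0 \<le> y k) \<Longrightarrow> (\<Sum>k<p. f k * y k) \<le> \<rho> y"
      using norming_weights[of z] z by blast
    have f_le: "f k \<le> ?u k" if "k < p" for k
    proof -
      have "f k = (\<Sum>l<p. f l * unit_vec k l)" using that by (simp add: if_distrib cong: if_cong)
      also have "\<dots> \<le> ?u k" by (rule f(3)) simp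
      finally show ?thesis .
    qed
    define l where "l k = (if k < p then nat \<lfloor>f k * (real K * real p) / ?u k\<rfloor> else 0)" for k
    have Kp: "0 < real K * real p" using K p by simp
    have approx: "?w l k \<le> f k \<and> f k \<le> ?w l k + ?u k / (real K * real p) \<and> l k \<le> K * p" if k: "k < p" for k
    proof (cases "?u k = 0")
      case True
      then have "f k = 0" using f_le[OF k] f(1)[of k] by simp
      then show ?thesis using True k by (simp add: l_def)
    next
      case False
      then have u: "0 < ?u k" using u_nonneg[of k] by simp
      let ?x = "f k * (real K * real p) / ?u k"
      have x: "0 \<le> ?x" using f(1)[of k] u by (intro divide_nonneg_nonneg mult_nonneg_nonneg) auto
      then have l: "real (l k) = of_int \<lfloor>?x\<rfloor>" using k by (simp add: l_def)
      have fx: "f k = ?x * ?u k / (real K * real p)" using u p K by simp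
      have "f k * (real K * real p) \<le> ?u k * (real K * real p)"
        using Kp by (intro mult_right_mono f_le[OF k]) simp
      then have "?x \<le> real K * real p" using u by (simp add: pos_divide_le_eq mult.commute)
      then have "real (l k) \<le> real (K * p)" unfolding l of_nat_mult by (rule order_trans[OF of_int_floor_le])
      then have "l k \<le> K * p" using of_nat_le_iff by blast
      moreover have "?w l k \<le> ?x * ?u k / (real K * real p)"
        using u Kp of_int_floor_le[of ?x] unfolding l by (intro divide_right_mono mult_right_mono) simp_all
      moreover have "?x * ?u k / (real K * real p) \<le> (real (l k) + 1) * ?u k / (real K * real p)"
        using u Kp real_of_int_floor_add_one_ge[of ?x] unfolding l
        by (intro divide_right_mono mult_right_mono) simp_all
      moreover note fx
      ultimately show ?thesis unfolding distrib_right add_divide_distrib mult_1 by linarith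
    qed
    have wF: "?w l \<in> ?w ` ?F" using approx by (intro imageI) (auto simp: l_def)
    have "(\<Sum>k<p. ?w l k * y k) \<le> \<rho> y" if y: "\<forall>k. 0 \<le> y k" for y
    proof -
      have "(\<Sum>k<p. ?w l k * y k) \<le> (\<Sum>k<p. f k * y k)" using approx y by (intro sum_mono mult_right_mono) auto
      also have "\<dots> \<le> \<rho> y" using y by (intro f(3)) auto
      finally show ?thesis .
    qed
    then have wG: "?w l \<in> ?G" using wF by blast
    have zu: "z k * ?u k \<le> \<rho> z" if "k < p" for k
    proof -
      have "z k * ?u k = \<rho> (\<lambda>l. z k * unit_vec k l)" using z by (subst \<rho>_scale) auto
      also have "\<dots> \<le> \<rho> z" using z by (intro \<rho>_mono) auto
      finally show ?thesis .
    qed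
    have "\<rho> z = (\<Sum>k<p. f k * z k)" by (simp add: f)
    also have "\<dots> \<le> (\<Sum>k<p. ?w l k * z k + \<rho> z / (real K * real p))"
    proof (rule sum_mono)
      fix k assume "k \<in> {..<p}"
      then have k: "k < p" by simp
      have "f k * z k \<le> (?w l k + ?u k / (real K * real p)) * z k"
        using approx[OF k] z by (intro mult_right_mono) auto
      also have "\<dots> = ?w l k * z k + z k * ?u k / (real K * real p)" by (simp add: algebra_simps)
      also have "\<dots> \<le> ?w l k * z k + \<rho> z / (real K * real p)"
        using zu[OF k] Kp by (intro add_left_mono divide_right_mono) auto
      finally show "f k * z k \<le> ?w l k * z k + \<rho> z / (real K * real p)" .
    qed
    also have "\<dots> = (\<Sum>k<p. ?w l k * z k) + \<rho> z / real K"
      using p K by (simp add: sum.distrib)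
    finally have "(1 - 1 / real K) * \<rho> z \<le> (\<Sum>k<p. ?w l k * z k)" by (simp add: algebra_simps)
    then show ?thesis by (rule bexI[OF _ wG])
  qed
  show ?thesis
  proof (intro exI[of _ ?G] conjI)
    show "finite ?G" by (rule fin)
    show "\<forall>w\<in>?G. (\<forall>k. 0 \<le> w k) \<and> (\<forall>z. (\<forall>k. 0 \<le> z k) \<longrightarrow> (\<Sum>k<p. w k * z k) \<le> \<rho> z)"
      using nonneg by simp
    show "\<forall>z. (\<forall>k. 0 \<le> z k) \<longrightarrow> (\<exists>w\<in>?G. (1 - 1 / real K) * \<rho> z \<le> (\<Sum>k<p. w k * z k))"
      by (intro allI impI) (rule ex)
  qed
qed

text \<open>
  The index functions \<open>a\<close> and \<open>b\<close> and the weights \<open>t\<close> describe a lattice homomorphism from matrices to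
  vectors. The rows are a grid of functionals that norm all vectors up to the factor \<open>1 - 1 / K\<close>, and
  extensions of the \<open>m\<close> rows of the matrices.
\<close>

lemma exact_rows:
  fixes t :: "nat \<Rightarrow> real" and a b :: "nat \<Rightarrow> nat"
  assumes m: "0 < m" and K: "0 < K" and t: "\<And>k. 0 \<le> t k" and ab: "\<And>k. k < p \<Longrightarrow> a k < m \<and> b k < n"
    and lower: "\<forall>x. (\<forall>i j. 0 \<le> x i j) \<longrightarrow> bnorm (linf_l1 m n) x \<le> (1 + \<delta>) * \<rho> (\<lambda>k. t k * x (a k) (b k))"
    and upper: "\<forall>x. (\<forall>i j. 0 \<le> x i j) \<longrightarrow> \<rho> (\<lambda>k. t k * x (a k) (b k)) \<le> bnorm (linf_l1 m n) x"
    and \<delta>: "0 \<le> \<delta>"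
  shows "\<exists>(m' :: nat) w. 0 < m' \<and> (\<forall>r k. 0 \<le> w r k) \<and>
     (\<forall>r<m'. \<forall>z. (\<forall>k. 0 \<le> z k) \<longrightarrow> (\<Sum>k<p. w r k * z k) \<le> (1 + \<delta>) * \<rho> z) \<and>
     (\<forall>z. (\<forall>k. 0 \<le> z k) \<longrightarrow> (\<exists>r<m'. (1 - 1 / real K) * \<rho> z \<le> (\<Sum>k<p. w r k * z k))) \<and>
     (\<forall>x. (\<forall>i j. 0 \<le> x i j) \<longrightarrow> (\<forall>r<m'. (\<Sum>k<p. w r k * (t k * x (a k) (b k))) \<le> bnorm (linf_l1 m n) x)) \<and>
     (\<forall>i<m. \<exists>r<m'. \<forall>x. (\<Sum>k<p. w r k * (t k * x (a k) (b k))) = (\<Sum>j<n. x i j))"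
proof -
  have \<delta>1: "0 \<le> 1 + \<delta>" using \<delta> by simp
  define P where "P i w \<longleftrightarrow> (\<forall>k. 0 \<le> w k) \<and> (\<forall>x. (\<Sum>k<p. w k * (t k * x (a k) (b k))) = (\<Sum>j<n. x i j)) \<and>
     (\<forall>z. (\<forall>k. 0 \<le> z k) \<longrightarrow> (\<Sum>k<p. w k * z k) \<le> (1 + \<delta>) * \<rho> z)"
    for i and w :: "nat \<Rightarrow> real"
  have "\<exists>w. P i w" if i: "i < m" for i
  proof -
    let ?\<tau> = "\<lambda>x k. if k < p then t k * x (a k) (b k) else 0"
    \<comment> \<open>The graph of the \<open>i\<close>th row sum over the image of the matrices. It
      obeys the bound by \<open>lower\<close>, applied to the positive part of \<open>x\<close>, and
      so the row sum is a function of the image.\<close>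
    let ?W = "{(?\<tau> x, \<Sum>j<n. x i j) | x. True}"
    have "dominated_graph (\<lambda>z. (1 + \<delta>) * \<rho> (\<lambda>k. max (z k) 0)) ?W"
      unfolding dominated_graph_def
    proof (intro conjI allI impI)
      show "((\<lambda>_. 0), 0) \<in> ?W" by (intro CollectI exI[of _ "\<lambda>_ _. 0"]) auto
    next
      fix y s z s' assume "(y, s) \<in> ?W" "(z, s') \<in> ?W"
      then obtain x x' where "y = ?\<tau> x" "s = (\<Sum>j<n. x i j)" "z = ?\<tau> x'" "s' = (\<Sum>j<n. x' i j)" by blast
      then show "((\<lambda>k. y k + z k), s + s') \<in> ?W"
        by (intro CollectI exI[of _ "\<lambda>i j. x i j + x' i j"]) (auto simp: algebra_simps sum.distrib)
    next
      fix r y s assume "(y, s) \<in> ?W"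
      then obtain x where "y = ?\<tau> x" "s = (\<Sum>j<n. x i j)" by blast
      then show "((\<lambda>k. r * y k), r * s) \<in> ?W"
        by (intro CollectI exI[of _ "\<lambda>i j. r * x i j"]) (auto simp: algebra_simps sum_distrib_left)
    next
      fix y s assume "(y, s) \<in> ?W"
      then obtain x where x: "y = ?\<tau> x" "s = (\<Sum>j<n. x i j)" by blast
      let ?x = "\<lambda>i j. max (x i j) 0"
      have "s \<le> (\<Sum>j<n. \<bar>?x i j\<bar>)" unfolding x(2) by (rule sum_mono) simp
      also have "\<dots> \<le> bnorm (linf_l1 m n) ?x" by (rule linf_l1_row_le[OF i])
      also have "\<dots> \<le> (1 + \<delta>) * \<rho> (\<lambda>k. t k * ?x (a k) (b k))" using spec[OF lower, of ?x] by simp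
      also have "\<dots> \<le> (1 + \<delta>) * \<rho> (\<lambda>k. max (y k) 0)"
        using t by (intro mult_left_mono \<delta>1 \<rho>_mono) (auto simp: x(1) max_mult_distrib_left)
      finally show "s \<le> (1 + \<delta>) * \<rho> (\<lambda>k. max (y k) 0)" .
    qed
    moreover have "y k = 0" if "(y, t) \<in> ?W" "p \<le> k" for y t k using that by auto
    ultimately have "\<exists>w. (\<forall>k. 0 \<le> w k) \<and> (\<forall>y s. (y, s) \<in> ?W \<longrightarrow> (\<Sum>k<p. w k * y k) = s) \<and>
      (\<forall>z. (\<forall>k. 0 \<le> z k) \<longrightarrow> (\<Sum>k<p. w k * z k) \<le> (1 + \<delta>) * \<rho> z)"
      by (intro positive_weights \<delta>1) auto
    then obtain w where w: "\<And>k. 0 \<le> w k" "\<And>y s. (y, s) \<in> ?W \<Longrightarrow> (\<Sum>k<p. w k * y k) = s"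
      "\<And>z. (\<And>k. 0 \<le> z k) \<Longrightarrow> (\<Sum>k<p. w k * z k) \<le> (1 + \<delta>) * \<rho> z"
      by blast
    have "(\<Sum>k<p. w k * (t k * x (a k) (b k))) = (\<Sum>j<n. x i j)" for x
    proof -
      have "(\<Sum>k<p. w k * (t k * x (a k) (b k))) = (\<Sum>k<p. w k * ?\<tau> x k)" by (rule sum.cong) auto
      also have "\<dots> = (\<Sum>j<n. x i j)" by (rule w(2)) blast
      finally show ?thesis .
    qed
    then show ?thesis using w unfolding P_def by blast
  qed
  then obtain h where hP: "\<And>i. i < m \<Longrightarrow> P i (h i)" by metis
  have h: "\<And>i k. i < m \<Longrightarrow> 0 \<le> h i k"
    "\<And>i x. i < m \<Longrightarrow> (\<Sum>k<p. h i k * (t k * x (a k) (b k))) = (\<Sum>j<n. x i j)"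
    "\<And>i z. i < m \<Longrightarrow> (\<And>k. 0 \<le> z k) \<Longrightarrow> (\<Sum>k<p. h i k * z k) \<le> (1 + \<delta>) * \<rho> z"
    using hP unfolding P_def by blast+
  obtain G where fin: "finite G"
    and Gall: "\<forall>w\<in>G. (\<forall>k. 0 \<le> w k) \<and> (\<forall>z. (\<forall>k. 0 \<le> z k) \<longrightarrow> (\<Sum>k<p. w k * z k) \<le> \<rho> z)"
    and Gex: "\<forall>z. (\<forall>k. 0 \<le> z k) \<longrightarrow> (\<exists>w\<in>G. (1 - 1 / real K) * \<rho> z \<le> (\<Sum>k<p. w k * z k))"
    using grid_weights[OF K] by (elim exE conjE) (rule that)
  have G: "0 \<le> w k" "(\<And>k. 0 \<le> z k) \<Longrightarrow> (\<Sum>k<p. w k * z k) \<le> \<rho> z" if "w \<in> G" for w k z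
    using bspec[OF Gall that] by simp_all
  obtain R where R: "set R = G \<union> h ` {..<m}" using finite_list[of "G \<union> h ` {..<m}"] fin by auto
  have "h 0 \<in> set R" unfolding R using m by simp
  then have len: "0 < length R" by (rule length_pos_if_in_set)
  define w where "w r k = (if r < length R then (R ! r) k else 0)" for r k
  have w_cases: "w r \<in> G \<or> (\<exists>i<m. w r = h i)" if "r < length R" for r
  proof -
    have "R ! r \<in> G \<union> h ` {..<m}" using R that nth_mem by blast
    moreover have "w r = R ! r" using that by (simp add: w_def fun_eq_iff)
    ultimately show ?thesis by auto
  qed
  have w_ex: "\<exists>r<length R. w r = f" if "f \<in> G \<union> h ` {..<m}" for f
  proof -
    have "f \<in> set R" using that R by blast
    then obtain r where "r < length R" "R ! r = f" by (auto simp: in_set_conv_nth)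
    then show ?thesis by (intro exI[of _ r]) (simp add: w_def fun_eq_iff)
  qed
  have nonneg: "0 \<le> w r k" for r k
  proof (cases "r < length R")
    case True
    show ?thesis using w_cases[OF True] by (auto simp: G(1) h(1))
  qed (simp add: w_def)
  have le\<rho>: "(\<Sum>k<p. w r k * z k) \<le> (1 + \<delta>) * \<rho> z" if r: "r < length R" and z: "\<forall>k. 0 \<le> z k" for r z
    using w_cases[OF r]
  proof
    assume "w r \<in> G"
    then have "(\<Sum>k<p. w r k * z k) \<le> 1 * \<rho> z" using z by (simp add: G(2))
    also have "\<dots> \<le> (1 + \<delta>) * \<rho> z" using \<delta> z by (intro mult_right_mono \<rho>_nonneg) auto
    finally show ?thesis .
  next
    assume "\<exists>i<m. w r = h i"
    then show ?thesis using z by (auto intro!: h(3))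
  qed
  \<comment> \<open>For a grid functional, which is below \<open>\<rho>\<close>, this is
    \<open>upper\<close>; an extended row returns an old row sum.\<close>
  have row_le: "(\<Sum>k<p. w r k * (t k * x (a k) (b k))) \<le> bnorm (linf_l1 m n) x"
    if r: "r < length R" and x: "\<forall>i j. 0 \<le> x i j" for r x
    using w_cases[OF r]
  proof
    assume "w r \<in> G"
    then have "(\<Sum>k<p. w r k * (t k * x (a k) (b k))) \<le> \<rho> (\<lambda>k. t k * x (a k) (b k))" using x t by (intro G(2)) simp_all
    also have "\<dots> \<le> bnorm (linf_l1 m n) x" using x spec[OF upper, of x] by simp
    finally show ?thesis .
  next
    assume "\<exists>i<m. w r = h i"
    then obtain i where i: "i < m" "w r = h i" by blast
    then have "(\<Sum>k<p. w r k * (t k * x (a k) (b k))) = (\<Sum>j<n. x i j)" by (simp add: h(2))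
    also have "\<dots> \<le> (\<Sum>j<n. \<bar>x i j\<bar>)" by (rule sum_mono) simp
    also have "\<dots> \<le> bnorm (linf_l1 m n) x" by (rule linf_l1_row_le[OF i(1)])
    finally show ?thesis .
  qed
  have ge: "\<exists>r<length R. (1 - 1 / real K) * \<rho> z \<le> (\<Sum>k<p. w r k * z k)" if "\<forall>k. 0 \<le> z k" for z
  proof -
    obtain f where f: "f \<in> G" "(1 - 1 / real K) * \<rho> z \<le> (\<Sum>k<p. f k * z k)" using Gex[rule_format, of z] \<open>\<forall>k. 0 \<le> z k\<close> by auto
    then obtain r where "r < length R" "w r = f" using w_ex by blast
    then show ?thesis using f by blast
  qed
  have exact: "\<exists>r<length R. \<forall>x. (\<Sum>k<p. w r k * (t k * x (a k) (b k))) = (\<Sum>j<n. x i j)" if i: "i < m" for i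
  proof -
    obtain r where "r < length R" "w r = h i" using w_ex[of "h i"] i by auto
    then show ?thesis using h(2)[OF i] by auto
  qed
  show ?thesis
  proof (intro exI[of _ "length R"] exI[of _ w] conjI)
    show "0 < length R" by (rule len)
    show "\<forall>r k. 0 \<le> w r k" using nonneg by blast
    show "\<forall>r<length R. \<forall>z. (\<forall>k. 0 \<le> z k) \<longrightarrow> (\<Sum>k<p. w r k * z k) \<le> (1 + \<delta>) * \<rho> z" using le\<rho> by blast
    show "\<forall>z. (\<forall>k. 0 \<le> z k) \<longrightarrow> (\<exists>r<length R. (1 - 1 / real K) * \<rho> z \<le> (\<Sum>k<p. w r k * z k))" using ge by blast
    show "\<forall>x. (\<forall>i j. 0 \<le> x i j) \<longrightarrow> (\<forall>r<length R. (\<Sum>k<p. w r k * (t k * x (a k) (b k))) \<le> bnorm (linf_l1 m n) x)"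
      using row_le by blast
    show "\<forall>i<m. \<exists>r<length R. \<forall>x. (\<Sum>k<p. w r k * (t k * x (a k) (b k))) = (\<Sum>j<n. x i j)" using exact by blast
  qed
qed

end

section \<open>The extension step\<close>

text \<open>\<open>key\<close> numbers the pieces of a partition of the set of homomorphisms, and a
  vector indexed by the keys stands for a function constant on the pieces.\<close>

locale keyed =
  fixes e :: "'a::banach_lattice" and p :: nat and key :: "('a \<Rightarrow> real) \<Rightarrow> nat"
  assumes e_pos: "0 \<le> e" and p_pos: "0 < p" and key: "\<omega> \<in> real_homs e \<Longrightarrow> key \<omega> < p"
begin

abbreviation "D \<equiv> principal_ideal e"
abbreviation "\<Omega> \<equiv> real_homs e"

lemmas D_ideal = order_idealD[OF order_ideal_principal[OF e_pos]]

lemma e_mem: "e \<in> D" by (rule mem_principal_ideal[OF e_pos]) (simp add: e_pos)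

text \<open>Functions of the key need not belong to the ideal; they are normed by their majorants in it.\<close>

definition majorants :: "(nat \<Rightarrow> real) \<Rightarrow> 'a set" where
  "majorants z = {y \<in> D. 0 \<le> y \<and> (\<forall>\<omega>\<in>\<Omega>. z (key \<omega>) \<le> \<omega> y)}"

definition \<rho> :: "(nat \<Rightarrow> real) \<Rightarrow> real" where "\<rho> z = Inf (norm ` majorants z)"

lemma \<rho>_le: "y \<in> majorants z \<Longrightarrow> \<rho> z \<le> norm y"
  unfolding \<rho>_def by (rule cInf_lower) (auto intro: bdd_belowI[of _ 0])

lemma majorants_nonempty: "majorants z \<noteq> {}"
proof -
  \<comment> \<open>Every homomorphism takes the value 1 at \<open>e\<close>, so a multiple of
    \<open>e\<close> majorises any function of the key.\<close>
  let ?C = "\<Sum>k<p. \<bar>z k\<bar>"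
  have "?C *\<^sub>R e \<in> majorants z"
    unfolding majorants_def
  proof (intro CollectI conjI ballI)
    show "?C *\<^sub>R e \<in> D" by (rule D_ideal(3)[OF e_mem])
    show "0 \<le> ?C *\<^sub>R e" using e_pos by (intro scaleR_nonneg_nonneg sum_nonneg) auto
    fix \<omega> assume \<omega>: "\<omega> \<in> \<Omega>"
    have "z (key \<omega>) \<le> \<bar>z (key \<omega>)\<bar>" by simp
    also have "\<dots> \<le> ?C" using key[OF \<omega>] by (intro member_le_sum) auto
    finally show "z (key \<omega>) \<le> \<omega> (?C *\<^sub>R e)" by (simp add: real_homsD(1)[OF \<omega>] real_homsD(2)[OF \<omega> e_mem])
  qed
  then show ?thesis by blast
qed

lemma \<rho>_ge: "(\<And>y. y \<in> majorants z \<Longrightarrow> B \<le> norm y) \<Longrightarrow> B \<le> \<rho> z"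
  unfolding \<rho>_def by (rule cInf_greatest) (use majorants_nonempty in auto)

lemma majorants_scale:
  assumes "y \<in> majorants z" "0 \<le> r"
  shows "r *\<^sub>R y \<in> majorants (\<lambda>k. r * z k)"
proof -
  have y: "y \<in> D" "0 \<le> y" "\<And>\<omega>. \<omega> \<in> \<Omega> \<Longrightarrow> z (key \<omega>) \<le> \<omega> y" using assms(1) by (auto simp: majorants_def)
  show ?thesis
    unfolding majorants_def
    using y assms(2) by (auto intro!: D_ideal(3) scaleR_nonneg_nonneg mult_left_mono simp: real_homsD(2)[OF _ y(1)])
qed

sublocale \<rho>: positive_seminorm p \<rho>
proof
  show "0 < p" by (rule p_pos)
next
  fix y z :: "nat \<Rightarrow> real"
  assume pos: "\<And>k. 0 \<le> y k" "\<And>k. 0 \<le> z k"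
  have "\<rho> (\<lambda>k. y k + z k) - norm b \<le> \<rho> y" if b: "b \<in> majorants z" for b
  proof (rule \<rho>_ge)
    fix a assume a: "a \<in> majorants y"
    have D: "a \<in> D" "b \<in> D" using a b by (auto simp: majorants_def)
    have "a + b \<in> majorants (\<lambda>k. y k + z k)"
      unfolding majorants_def
    proof (intro CollectI conjI ballI)
      show "a + b \<in> D" by (rule D_ideal(2)[OF D])
      show "0 \<le> a + b" using a b by (simp add: majorants_def)
      fix \<omega> assume \<omega>: "\<omega> \<in> \<Omega>"
      show "y (key \<omega>) + z (key \<omega>) \<le> \<omega> (a + b)"
        unfolding real_homsD(3)[OF \<omega> D] using a b \<omega> by (intro add_mono) (auto simp: majorants_def)
    qed
    from \<rho>_le[OF this] show "\<rho> (\<lambda>k. y k + z k) - norm b \<le> norm a" using norm_triangle_ineq[of a b] by linarith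
  qed
  then have "\<rho> (\<lambda>k. y k + z k) - \<rho> y \<le> \<rho> z" by (intro \<rho>_ge) (simp add: diff_le_eq add.commute)
  then show "\<rho> (\<lambda>k. y k + z k) \<le> \<rho> y + \<rho> z" by simp
next
  fix y :: "nat \<Rightarrow> real" and r :: real
  assume "0 \<le> r"
  show "\<rho> (\<lambda>k. r * y k) = r * \<rho> y"
  proof (cases "r = 0")
    case True
    have "0 \<in> majorants (\<lambda>_. 0)"
      unfolding majorants_def
    proof (intro CollectI conjI ballI D_ideal(1))
      fix \<omega> assume "\<omega> \<in> \<Omega>"
      then show "0 \<le> \<omega> 0" using real_homsD(6)[OF _ e_mem e_pos, of \<omega>] by simp
    qed simp
    from \<rho>_le[OF this] have "\<rho> (\<lambda>_. 0) \<le> 0" by simp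
    moreover have "0 \<le> \<rho> (\<lambda>_. 0)" by (rule \<rho>_ge) simp
    ultimately show ?thesis using True by simp
  next
    case False
    then have r: "0 < r" using \<open>0 \<le> r\<close> by simp
    have le: "\<rho> (\<lambda>k. r * y k) \<le> r * \<rho> y" if r: "0 < r" for y r
    proof -
      have "\<rho> (\<lambda>k. r * y k) / r \<le> \<rho> y"
      proof (rule \<rho>_ge)
        fix a assume "a \<in> majorants y"
        from \<rho>_le[OF majorants_scale[OF this, of r]] show "\<rho> (\<lambda>k. r * y k) / r \<le> norm a"
          using r by (simp add: pos_divide_le_eq mult.commute)
      qed
      then show ?thesis using r by (simp add: pos_divide_le_eq mult.commute)
    qed
    have "\<rho> y \<le> inverse r * \<rho> (\<lambda>k. r * y k)"
      using le[of "inverse r" "\<lambda>k. r * y k"] r by (simp flip: mult.assoc)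
    then have "r * \<rho> y \<le> \<rho> (\<lambda>k. r * y k)" using r by (simp add: field_simps)
    then show ?thesis using le[OF r] by (intro antisym)
  qed
next
  fix y z :: "nat \<Rightarrow> real"
  assume le: "\<And>k. k < p \<Longrightarrow> y k \<le> z k"
  show "\<rho> y \<le> \<rho> z"
  proof (rule \<rho>_ge)
    fix b assume b: "b \<in> majorants z"
    then have "b \<in> majorants y"
      unfolding majorants_def by (auto intro: order_trans[OF le[OF key]])
    then show "\<rho> y \<le> norm b" by (rule \<rho>_le)
  qed
qed

end

text \<open>On positive vectors the largest weighted row sum is a norm of matrix type that differs
  from \<open>\<rho>\<close> by at most a factor \<open>1 - \<delta>\<close> or
  \<open>1 + \<delta>\<close>.\<close>

locale row_model = keyed e p key for e :: "'a::banach_lattice" and p and key +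
  fixes \<delta> :: real and m :: nat and w :: "nat \<Rightarrow> nat \<Rightarrow> real"
  assumes \<delta>: "0 < \<delta>" "\<delta> < 1" and m: "0 < m" and w: "0 \<le> w k \<kappa>"
    and rows_le: "k < m \<Longrightarrow> (\<And>\<kappa>. 0 \<le> z \<kappa>) \<Longrightarrow> (\<Sum>\<kappa><p. w k \<kappa> * z \<kappa>) \<le> (1 + \<delta>) * \<rho> z"
    and rows_ge: "(\<And>\<kappa>. 0 \<le> z \<kappa>) \<Longrightarrow> \<exists>k<m. (1 - \<delta>) * \<rho> z \<le> (\<Sum>\<kappa><p. w k \<kappa> * z \<kappa>)"
begin

text \<open>Points with tag 0 give the ideal its exact norm, points with tag 1 the matrices theirs; those
  with tag 2 take care of the vanishing weights.\<close>

definition active :: "('a \<Rightarrow> real) \<Rightarrow> nat \<Rightarrow> nat \<Rightarrow> bool" where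
  "active \<omega> k \<kappa> \<longleftrightarrow> \<omega> \<in> \<Omega> \<and> k < m \<and> \<kappa> = key \<omega> \<and> 0 < w k \<kappa>"

text \<open>Let an ideal element have the value \<open>T\<close> at an active point. It and the
  matrix with entries \<open>w k \<kappa> * T\<close> are given the values \<open>T\<close> and
  \<open>(1 - \<delta>) T\<close> for tag 0, and \<open>T / (1 + \<delta>)\<close> and
  \<open>T\<close> for tag 1. The two factors are the distortions of the rows in
  \<open>rows_ge\<close> and \<open>rows_le\<close>.\<close>

definition ideal_weight :: "('a \<Rightarrow> real) \<times> nat \<times> nat \<times> nat \<Rightarrow> real" where
  "ideal_weight = (\<lambda>(\<omega>, k, \<kappa>, tag).
     if active \<omega> k \<kappa> \<and> tag = 0 then 1 else if active \<omega> k \<kappa> \<and> tag = 1 then 1 / (1 + \<delta>) else 0)"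

definition matrix_weight :: "('a \<Rightarrow> real) \<times> nat \<times> nat \<times> nat \<Rightarrow> real" where
  "matrix_weight = (\<lambda>(\<omega>, k, \<kappa>, tag).
     if active \<omega> k \<kappa> \<and> tag = 0 then (1 - \<delta>) / w k \<kappa>
     else if active \<omega> k \<kappa> \<and> tag = 1 then 1 / w k \<kappa>
     else if k < m \<and> \<kappa> < p \<and> w k \<kappa> = 0 \<and> tag = 2 then 1 else 0)"

text \<open>The locale \<open>amalgam\<close> asks for indices in range at all points; the default 0
  is taken only where the matrix weight is 0. The same holds for \<open>point_col\<close>.\<close>

definition point_row :: "('a \<Rightarrow> real) \<times> nat \<times> nat \<times> nat \<Rightarrow> nat" where
  "point_row = (\<lambda>(\<omega>, k, \<kappa>, tag). if k < m then k else 0)"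

definition point_col :: "('a \<Rightarrow> real) \<times> nat \<times> nat \<times> nat \<Rightarrow> nat" where
  "point_col = (\<lambda>(\<omega>, k, \<kappa>, tag). if \<kappa> < p then \<kappa> else 0)"

lemma tag0:
  assumes "\<omega> \<in> \<Omega>" "k < m" "0 < w k (key \<omega>)"
  shows "ideal_weight (\<omega>, k, key \<omega>, 0) = 1" "matrix_weight (\<omega>, k, key \<omega>, 0) = (1 - \<delta>) / w k (key \<omega>)"
    "ideal_weight (\<omega>, k, key \<omega>, 1) = 1 / (1 + \<delta>)" "matrix_weight (\<omega>, k, key \<omega>, 1) = 1 / w k (key \<omega>)"
    "point_row (\<omega>, k, key \<omega>, tag) = k" "point_col (\<omega>, k, key \<omega>, tag) = key \<omega>"
  using assms key by (auto simp: active_def ideal_weight_def matrix_weight_def point_row_def point_col_def)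

lemma tag2:
  assumes "k < m" "\<kappa> < p" "w k \<kappa> = 0"
  shows "ideal_weight (\<omega>, k, \<kappa>, 2) = 0" "matrix_weight (\<omega>, k, \<kappa>, 2) = 1"
    "point_row (\<omega>, k, \<kappa>, tag) = k" "point_col (\<omega>, k, \<kappa>, tag) = \<kappa>"
  using assms by (auto simp: active_def ideal_weight_def matrix_weight_def point_row_def point_col_def)

text \<open>\<open>z\<close> is the largest vector whose weighted rows all stay below
  \<open>c\<close>. The points with tag 0 yield \<open>x \<le> v + (1 - \<delta>) y\<close> for
  every majorant \<open>y\<close> of \<open>z\<close>, and by \<open>rows_ge\<close> some weighted
  row sum of \<open>z\<close>, hence the norm of \<open>c\<close>, is at least
  \<open>(1 - \<delta>) \<rho> z\<close>.\<close>

lemma ideal_norm_le: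
  assumes x: "x \<in> D" "0 \<le> x" and v: "v \<in> D" "0 \<le> v" and c: "\<And>i j. 0 \<le> c i j"
    and le: "\<And>s. ideal_weight s * fst s x \<le> ideal_weight s * fst s v + matrix_weight s * c (point_row s) (point_col s)"
  shows "norm x \<le> norm v + bnorm (linf_l1 m p) c"
proof -
  obtain C where C: "0 \<le> C" "x \<le> C *\<^sub>R e" using x by (auto simp: principal_ideal_def)
  define q where "q \<kappa> = (\<lambda>k. c k \<kappa> / w k \<kappa>) ` {k. k < m \<and> 0 < w k \<kappa>}" for \<kappa>
  \<comment> \<open>If every row has weight 0 on a piece, the points with tag 0 say nothing there.
    The default makes \<open>(1 - \<delta>) z\<close> equal to the bound \<open>C\<close> of
    \<open>x\<close>, and no weighted row sum notices it.\<close>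
  define z where "z \<kappa> = (if q \<kappa> = {} then C / (1 - \<delta>) else Min (q \<kappa>))" for \<kappa>
  have fin: "finite (q \<kappa>)" for \<kappa> by (simp add: q_def)
  have z_nonneg: "0 \<le> z \<kappa>" for \<kappa>
  proof (cases "q \<kappa> = {}")
    case True
    then show ?thesis using C(1) \<delta> by (simp add: z_def)
  next
    case False
    have "0 \<le> a" if "a \<in> q \<kappa>" for a using that c w by (auto simp: q_def)
    then show ?thesis using Min_in[OF fin False] False by (simp add: z_def)
  qed
  have wz: "w k \<kappa> * z \<kappa> \<le> c k \<kappa>" if k: "k < m" for k \<kappa>
  proof (cases "w k \<kappa> = 0")
    case True
    then show ?thesis using c by simp
  next
    case False
    then have pos: "0 < w k \<kappa>" using w[of k \<kappa>] by simp
    then have mem: "c k \<kappa> / w k \<kappa> \<in> q \<kappa>" using k by (auto simp: q_def)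
    then have "z \<kappa> \<le> c k \<kappa> / w k \<kappa>" using Min_le[OF fin mem] by (auto simp: z_def)
    then show ?thesis using pos by (simp add: pos_le_divide_eq mult.commute)
  qed
  have dom: "\<omega> x \<le> \<omega> v + (1 - \<delta>) * z (key \<omega>)" if \<omega>: "\<omega> \<in> \<Omega>" for \<omega>
  proof (cases "q (key \<omega>) = {}")
    case True
    have "\<omega> x \<le> \<omega> (C *\<^sub>R e)" by (rule real_homsD(8)[OF \<omega> x(1) D_ideal(3)[OF e_mem] C(2)])
    also have "\<dots> = (1 - \<delta>) * z (key \<omega>)"
      using True \<delta> by (simp add: z_def real_homsD(1)[OF \<omega>] real_homsD(2)[OF \<omega> e_mem])
    also have "\<dots> \<le> \<omega> v + (1 - \<delta>) * z (key \<omega>)"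
      using real_homsD(8)[OF \<omega> D_ideal(1) v] real_homsD(6)[OF \<omega> e_mem e_pos] by simp
    finally show ?thesis .
  next
    case False
    then have "z (key \<omega>) \<in> q (key \<omega>)" using Min_in[OF fin False] by (simp add: z_def)
    then obtain k where k: "k < m" "0 < w k (key \<omega>)" "z (key \<omega>) = c k (key \<omega>) / w k (key \<omega>)"
      by (auto simp: q_def)
    show ?thesis using le[of "(\<omega>, k, key \<omega>, 0)"] unfolding tag0[OF \<omega> k(1,2)] k(3) by simp
  qed
  have "(norm x - norm v) / (1 - \<delta>) \<le> \<rho> z"
  proof (rule \<rho>_ge)
    fix y assume y: "y \<in> majorants z"
    then have yD: "y \<in> D" and y_pos: "0 \<le> y" by (auto simp: majorants_def)
    have "x \<le> v + (1 - \<delta>) *\<^sub>R y"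
    proof (rule le_if_real_homs_le[OF e_pos x(1) D_ideal(2)[OF v(1) D_ideal(3)[OF yD]]])
      fix \<omega> assume \<omega>: "\<omega> \<in> \<Omega>"
      have "\<omega> x \<le> \<omega> v + (1 - \<delta>) * z (key \<omega>)" by (rule dom[OF \<omega>])
      also have "\<dots> \<le> \<omega> v + (1 - \<delta>) * \<omega> y"
        using y \<omega> \<delta> by (intro add_left_mono mult_left_mono) (auto simp: majorants_def)
      also have "\<dots> = \<omega> (v + (1 - \<delta>) *\<^sub>R y)"
        by (simp add: real_homsD(3)[OF \<omega> v(1) D_ideal(3)[OF yD]] real_homsD(2)[OF \<omega> yD])
      finally show "\<omega> x \<le> \<omega> (v + (1 - \<delta>) *\<^sub>R y)" .
    qed
    then have "norm x \<le> norm (v + (1 - \<delta>) *\<^sub>R y)" by (rule norm_mono_nonneg[OF x(2)])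
    also have "\<dots> \<le> norm v + (1 - \<delta>) * norm y"
      using norm_triangle_ineq[of v "(1 - \<delta>) *\<^sub>R y"] \<delta> by simp
    finally show "(norm x - norm v) / (1 - \<delta>) \<le> norm y"
      using \<delta> by (simp add: pos_divide_le_eq mult.commute)
  qed
  then have 1: "norm x - norm v \<le> (1 - \<delta>) * \<rho> z" using \<delta> by (simp add: pos_divide_le_eq mult.commute)
  obtain k where k: "k < m" "(1 - \<delta>) * \<rho> z \<le> (\<Sum>\<kappa><p. w k \<kappa> * z \<kappa>)" using rows_ge[of z] z_nonneg by blast
  have "(\<Sum>\<kappa><p. w k \<kappa> * z \<kappa>) \<le> (\<Sum>\<kappa><p. \<bar>c k \<kappa>\<bar>)" using wz[OF k(1)] c by (intro sum_mono) simp
  also have "\<dots> \<le> bnorm (linf_l1 m p) c" by (rule linf_l1_row_le[OF k(1)])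
  finally show ?thesis using 1 k(2) by linarith
qed

text \<open>In a fixed row, \<open>z\<close> is the excess of \<open>d\<close> over \<open>c\<close>
  in units of the weight. The points with tag 1 make \<open>v\<close> a majorant of
  \<open>(1 + \<delta>) z\<close>, so by \<open>rows_le\<close> the weighted sum of \<open>z\<close>
  is at most the norm of \<open>v\<close>. Where the weight vanishes, tag 2 gives
  \<open>d \<le> c\<close> outright.\<close>

lemma matrix_norm_le:
  assumes v: "v \<in> D" "0 \<le> v" and d: "\<And>i j. 0 \<le> d i j" and c: "\<And>i j. 0 \<le> c i j"
    and le: "\<And>s. matrix_weight s * d (point_row s) (point_col s) \<le>
       ideal_weight s * fst s v + matrix_weight s * c (point_row s) (point_col s)"
  shows "bnorm (linf_l1 m p) d \<le> norm v + bnorm (linf_l1 m p) c"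
  unfolding linf_l1_norm_le_iff[OF m]
proof (intro allI impI)
  fix k assume k: "k < m"
  define z where "z \<kappa> = (if 0 < w k \<kappa> then max (d k \<kappa> - c k \<kappa>) 0 / w k \<kappa> else 0)" for \<kappa>
  have z_nonneg: "0 \<le> z \<kappa>" for \<kappa> by (simp add: z_def)
  have "v \<in> majorants (\<lambda>\<kappa>. (1 + \<delta>) * z \<kappa>)"
    unfolding majorants_def
  proof (intro CollectI conjI ballI v)
    fix \<omega> assume \<omega>: "\<omega> \<in> \<Omega>"
    have v0: "0 \<le> \<omega> v" using real_homsD(8)[OF \<omega> D_ideal(1) v] real_homsD(6)[OF \<omega> e_mem e_pos] by simp
    show "(1 + \<delta>) * z (key \<omega>) \<le> \<omega> v"
    proof (cases "0 < w k (key \<omega>)")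
      case True
      have "1 / w k (key \<omega>) * d k (key \<omega>) \<le> 1 / (1 + \<delta>) * \<omega> v + 1 / w k (key \<omega>) * c k (key \<omega>)"
        using le[of "(\<omega>, k, key \<omega>, 1)"] unfolding tag0[OF \<omega> k True] by simp
      then have "(d k (key \<omega>) - c k (key \<omega>)) / w k (key \<omega>) \<le> \<omega> v / (1 + \<delta>)"
        by (simp add: diff_divide_distrib)
      moreover have "0 \<le> \<omega> v / (1 + \<delta>)" using v0 \<delta> by simp
      ultimately have "z (key \<omega>) \<le> \<omega> v / (1 + \<delta>)" using True by (simp add: z_def max_def)
      then show ?thesis using \<delta> by (simp add: pos_le_divide_eq mult.commute)
    next
      case False
      then show ?thesis using v0 by (simp add: z_def)
    qed
  qed
  then have "\<rho> (\<lambda>\<kappa>. (1 + \<delta>) * z \<kappa>) \<le> norm v" by (rule \<rho>_le)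
  then have \<rho>z: "(1 + \<delta>) * \<rho> z \<le> norm v" using \<rho>.\<rho>_scale[of z "1 + \<delta>"] z_nonneg \<delta> by simp
  have "(\<Sum>\<kappa><p. \<bar>d k \<kappa>\<bar>) \<le> (\<Sum>\<kappa><p. w k \<kappa> * z \<kappa> + \<bar>c k \<kappa>\<bar>)"
  proof (rule sum_mono)
    fix \<kappa> assume "\<kappa> \<in> {..<p}"
    then have \<kappa>: "\<kappa> < p" by simp
    show "\<bar>d k \<kappa>\<bar> \<le> w k \<kappa> * z \<kappa> + \<bar>c k \<kappa>\<bar>"
    proof (cases "w k \<kappa> = 0")
      case True
      have "d k \<kappa> \<le> c k \<kappa>" using le[of "(\<lambda>_. 0, k, \<kappa>, 2)"] unfolding tag2[OF k \<kappa> True] by simp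
      then show ?thesis using True d c by simp
    next
      case False
      then have "w k \<kappa> * z \<kappa> = max (d k \<kappa> - c k \<kappa>) 0" using w[of k \<kappa>] by (simp add: z_def)
      then show ?thesis using d[of k \<kappa>] c[of k \<kappa>] by simp
    qed
  qed
  also have "\<dots> = (\<Sum>\<kappa><p. w k \<kappa> * z \<kappa>) + (\<Sum>\<kappa><p. \<bar>c k \<kappa>\<bar>)" by (rule sum.distrib)
  also have "\<dots> \<le> (1 + \<delta>) * \<rho> z + bnorm (linf_l1 m p) c"
    by (intro add_mono rows_le k z_nonneg linf_l1_row_le)
  finally show "(\<Sum>\<kappa><p. \<bar>d k \<kappa>\<bar>) \<le> norm v + bnorm (linf_l1 m p) c" using \<rho>z by simp
qed

sublocale am: amalgam e m p ideal_weight fst matrix_weight point_row point_col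
proof
  show "0 \<le> e" "0 < m" by (rule e_pos, rule m)
  fix s :: "('a \<Rightarrow> real) \<times> nat \<times> nat \<times> nat"
  obtain \<omega> k \<kappa> tag where s: "s = (\<omega>, k, \<kappa>, tag)" by (cases s)
  show "0 \<le> ideal_weight s" "ideal_weight s \<noteq> 0 \<Longrightarrow> fst s \<in> \<Omega>" "0 \<le> matrix_weight s"
    "point_row s < m" "point_col s < p"
    using \<delta> w m p_pos
    by (auto simp: s ideal_weight_def matrix_weight_def active_def point_row_def point_col_def split: if_splits)
next
  show "norm x \<le> norm v + bnorm (linf_l1 m p) c"
    if "x \<in> D" "v \<in> D" "0 \<le> x" "0 \<le> v" "\<And>i j. 0 \<le> c i j"
      "\<And>s. ideal_weight s * fst s x \<le> ideal_weight s * fst s v + matrix_weight s * c (point_row s) (point_col s)"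
    for x v c
    using that by (intro ideal_norm_le)
  show "bnorm (linf_l1 m p) d \<le> norm v + bnorm (linf_l1 m p) c"
    if "v \<in> D" "0 \<le> v" "\<And>i j. 0 \<le> d i j" "\<And>i j. 0 \<le> c i j"
      "\<And>s. matrix_weight s * d (point_row s) (point_col s) \<le>
         ideal_weight s * fst s v + matrix_weight s * c (point_row s) (point_col s)"
    for v d c
    using that by (intro matrix_norm_le)
qed

definition weighted :: "(nat \<Rightarrow> real) \<Rightarrow> nat \<Rightarrow> nat \<Rightarrow> real" where
  "weighted T = (\<lambda>k \<kappa>. if k < m \<and> \<kappa> < p then w k \<kappa> * T \<kappa> else 0)"

text \<open>The difference is \<open>\<omega> a - (1 - \<delta>) T\<close> for tag 0 and
  \<open>\<omega> a / (1 + \<delta>) - T\<close> for tag 1, a rounding error plus a share of order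
  \<open>\<delta>\<close> of the value of \<open>a\<close>. The factor 2 compensates for the weight
  \<open>1 / (1 + \<delta>)\<close> of the majorant at tag 1.\<close>

lemma weighted_close:
  assumes a: "a \<in> D" and T: "\<And>\<omega>. \<omega> \<in> \<Omega> \<Longrightarrow> \<bar>\<omega> a - T (key \<omega>)\<bar> \<le> \<theta>"
  shows "\<bar>am.J a s - am.I (weighted T) s\<bar> \<le> am.J (2 *\<^sub>R (\<theta> *\<^sub>R e + \<delta> *\<^sub>R \<bar>a\<bar>)) s"
proof -
  obtain \<omega> k \<kappa> tag where s: "s = (\<omega>, k, \<kappa>, tag)" by (cases s)
  have aD: "\<bar>a\<bar> \<in> D" by (rule D_ideal(6)[OF a])
  show ?thesis
  proof (cases "active \<omega> k \<kappa> \<and> (tag = 0 \<or> tag = 1)")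
    case True
    then have act: "\<omega> \<in> \<Omega>" "k < m" "\<kappa> = key \<omega>" "0 < w k (key \<omega>)" by (auto simp: active_def)
    have kp: "key \<omega> < p" by (rule key[OF act(1)])
    have v: "\<omega> (2 *\<^sub>R (\<theta> *\<^sub>R e + \<delta> *\<^sub>R \<bar>a\<bar>)) = 2 * (\<theta> + \<delta> * \<bar>\<omega> a\<bar>)"
      using real_homsD(1,2,3,9)[OF act(1)] D_ideal(2,3) e_mem aD a e_pos by simp
    have t: "\<bar>\<omega> a - T (key \<omega>)\<bar> \<le> \<theta>" by (rule T[OF act(1)])
    have \<theta>: "0 \<le> \<theta>" using t by linarith
    consider "tag = 0" | "tag = 1" using True by blast
    then show ?thesis
    proof cases
      case 1
      have "am.J a s - am.I (weighted T) s = \<omega> a - (1 - \<delta>) * T (key \<omega>)"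
        using act kp by (simp add: am.J_def am.I_def s 1 tag0 weighted_def)
      also have "\<dots> = (1 - \<delta>) * (\<omega> a - T (key \<omega>)) + \<delta> * \<omega> a" by (simp add: algebra_simps)
      finally have "\<bar>am.J a s - am.I (weighted T) s\<bar> \<le> \<bar>(1 - \<delta>) * (\<omega> a - T (key \<omega>))\<bar> + \<bar>\<delta> * \<omega> a\<bar>"
        by (simp only: abs_triangle_ineq)
      also have "\<dots> = (1 - \<delta>) * \<bar>\<omega> a - T (key \<omega>)\<bar> + \<delta> * \<bar>\<omega> a\<bar>" using \<delta> by (simp add: abs_mult)
      also have "\<dots> \<le> 1 * \<theta> + \<delta> * \<bar>\<omega> a\<bar>" using \<delta> t by (intro add_right_mono mult_mono) auto
      also have "\<dots> \<le> 2 * (\<theta> + \<delta> * \<bar>\<omega> a\<bar>)" using \<theta> \<delta> by simp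
      also have "\<dots> = am.J (2 *\<^sub>R (\<theta> *\<^sub>R e + \<delta> *\<^sub>R \<bar>a\<bar>)) s"
        using act v by (simp add: am.J_def s 1 tag0)
      finally show ?thesis .
    next
      case 2
      have "am.J a s - am.I (weighted T) s = \<omega> a / (1 + \<delta>) - T (key \<omega>)"
        using act kp by (simp add: am.J_def am.I_def s 2 tag0[unfolded One_nat_def] weighted_def)
      also have "\<dots> = ((\<omega> a - T (key \<omega>)) * (1 + \<delta>) - \<delta> * \<omega> a) / (1 + \<delta>)"
        using \<delta> by (simp add: field_simps)
      finally have "\<bar>am.J a s - am.I (weighted T) s\<bar> = \<bar>(\<omega> a - T (key \<omega>)) * (1 + \<delta>) - \<delta> * \<omega> a\<bar> / (1 + \<delta>)"
        using \<delta> by simp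
      also have "\<dots> \<le> (2 * (\<theta> + \<delta> * \<bar>\<omega> a\<bar>)) / (1 + \<delta>)"
      proof (rule divide_right_mono)
        have "\<bar>(\<omega> a - T (key \<omega>)) * (1 + \<delta>) - \<delta> * \<omega> a\<bar> \<le> \<bar>(\<omega> a - T (key \<omega>)) * (1 + \<delta>)\<bar> + \<bar>\<delta> * \<omega> a\<bar>"
          by (rule abs_triangle_ineq4)
        also have "\<dots> = \<bar>\<omega> a - T (key \<omega>)\<bar> * (1 + \<delta>) + \<delta> * \<bar>\<omega> a\<bar>" using \<delta> by (simp add: abs_mult)
        also have "\<dots> \<le> \<theta> * 2 + \<delta> * \<bar>\<omega> a\<bar>" using \<delta> t \<theta> by (intro add_right_mono mult_mono) auto
        also have "\<dots> \<le> 2 * (\<theta> + \<delta> * \<bar>\<omega> a\<bar>)" using \<delta> by simp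
        finally show "\<bar>(\<omega> a - T (key \<omega>)) * (1 + \<delta>) - \<delta> * \<omega> a\<bar> \<le> 2 * (\<theta> + \<delta> * \<bar>\<omega> a\<bar>)" .
        show "0 \<le> 1 + \<delta>" using \<delta> by simp
      qed
      also have "\<dots> = am.J (2 *\<^sub>R (\<theta> *\<^sub>R e + \<delta> *\<^sub>R \<bar>a\<bar>)) s"
        using act v by (simp add: am.J_def s 2 tag0[unfolded One_nat_def])
      finally show ?thesis .
    qed
  next
    case False
    then have "ideal_weight s = 0" by (auto simp: s ideal_weight_def)
    moreover have "am.I (weighted T) s = 0"
      unfolding am.I_def using False by (auto simp: s matrix_weight_def weighted_def point_row_def point_col_def)
    ultimately show ?thesis by (simp add: am.J_def)
  qed
qed

end

section \<open>Embeddings of matrix lattices\<close>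

lemma unit_matrix_mem: "i < m \<Longrightarrow> j < n \<Longrightarrow> unit_matrix i j \<in> bcarrier (linf_l1 m n)"
  by (auto simp: unit_matrix_def)

lemma embeddingD:
  assumes "bl_embedding (linf_l1 m n) (blat_of (UNIV :: 'a::banach_lattice set)) g"
  shows "c \<in> bcarrier (linf_l1 m n) \<Longrightarrow> norm (g c) = bnorm (linf_l1 m n) c"
    "c \<in> bcarrier (linf_l1 m n) \<Longrightarrow> g (\<lambda>i j. r * c i j) = r *\<^sub>R g c"
    "c \<in> bcarrier (linf_l1 m n) \<Longrightarrow> d \<in> bcarrier (linf_l1 m n) \<Longrightarrow> g (\<lambda>i j. c i j + d i j) = g c + g d"
    "c \<in> bcarrier (linf_l1 m n) \<Longrightarrow> d \<in> bcarrier (linf_l1 m n) \<Longrightarrow> g (\<lambda>i j. max (c i j) (d i j)) = sup (g c) (g d)"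
    "c \<in> bcarrier (linf_l1 m n) \<Longrightarrow> d \<in> bcarrier (linf_l1 m n) \<Longrightarrow> g (\<lambda>i j. min (c i j) (d i j)) = inf (g c) (g d)"
  using assms by (simp_all add: bl_embedding_def)

lemma embedding_zero:
  assumes "bl_embedding (linf_l1 m n) (blat_of (UNIV :: 'a::banach_lattice set)) g"
  shows "g (\<lambda>_ _. 0) = 0"
  using embeddingD(2)[OF assms, of "\<lambda>_ _. 0" 0] by simp

lemma embedding_diff:
  assumes "bl_embedding (linf_l1 m n) (blat_of (UNIV :: 'a::banach_lattice set)) g"
    "c \<in> bcarrier (linf_l1 m n)" "d \<in> bcarrier (linf_l1 m n)"
  shows "g (\<lambda>i j. c i j - d i j) = g c - g d"
proof -
  have "(\<lambda>i j. - 1 * d i j) \<in> bcarrier (linf_l1 m n)" using assms(3) by simp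
  from embeddingD(3)[OF assms(1,2) this] embeddingD(2)[OF assms(1,3), of "- 1"] show ?thesis by simp
qed

lemma embedding_nonneg:
  assumes g: "bl_embedding (linf_l1 m n) (blat_of (UNIV :: 'a::banach_lattice set)) g"
    and c: "c \<in> bcarrier (linf_l1 m n)" "\<And>i j. 0 \<le> c i j"
  shows "0 \<le> g c"
proof -
  have "(\<lambda>i j. max (c i j) 0) = c" using c(2) by (simp add: max_absorb1)
  then have "sup (g c) 0 = g c"
    using embeddingD(4)[OF g c(1), of "\<lambda>_ _. 0"] embedding_zero[OF g] by simp
  then show ?thesis using sup_ge2[of 0 "g c"] by simp
qed

lemma embedding_sum:
  assumes g: "bl_embedding (linf_l1 m n) (blat_of (UNIV :: 'a::banach_lattice set)) g"
    and "finite A" "\<And>a. a \<in> A \<Longrightarrow> f a \<in> bcarrier (linf_l1 m n)"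
  shows "g (\<lambda>i j. \<Sum>a\<in>A. f a i j) = (\<Sum>a\<in>A. g (f a))"
  using assms(2,3)
proof induction
  case empty
  show ?case using embedding_zero[OF g] by simp
next
  case (insert a A)
  have "(\<lambda>i j. \<Sum>a\<in>A. f a i j) \<in> bcarrier (linf_l1 m n)" using insert.prems by (auto intro!: sum.neutral)
  then show ?case using insert embeddingD(3)[OF g, of "f a" "\<lambda>i j. \<Sum>a\<in>A. f a i j"] by simp
qed

lemma matrix_sum_units:
  assumes "c \<in> bcarrier (linf_l1 m n)"
  shows "c = (\<lambda>a b. \<Sum>q\<in>{..<m} \<times> {..<n}. c (fst q) (snd q) * unit_matrix (fst q) (snd q) a b)"
proof (intro ext)
  fix a b
  have eq: "(\<Sum>q\<in>{..<m} \<times> {..<n}. c (fst q) (snd q) * unit_matrix (fst q) (snd q) a b)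
     = (\<Sum>i<m. \<Sum>j<n. c i j * unit_matrix i j a b)"
    by (simp add: sum.cartesian_product case_prod_unfold)
  show "c a b = (\<Sum>q\<in>{..<m} \<times> {..<n}. c (fst q) (snd q) * unit_matrix (fst q) (snd q) a b)"
  proof (cases "a < m \<and> b < n")
    case True
    then show ?thesis unfolding eq by (intro matrix_eq_sum_units) auto
  next
    case False
    then have "c a b = 0" using assms by simp
    moreover have "(\<Sum>q\<in>{..<m} \<times> {..<n}. c (fst q) (snd q) * unit_matrix (fst q) (snd q) a b) = 0"
      using False by (intro sum.neutral) (auto simp: unit_matrix_def)
    ultimately show ?thesis by simp
  qed
qed

lemma embedding_eq_sum:
  assumes g: "bl_embedding (linf_l1 m n) (blat_of (UNIV :: 'a::banach_lattice set)) g"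
    and c: "c \<in> bcarrier (linf_l1 m n)"
  shows "g c = (\<Sum>q\<in>{..<m} \<times> {..<n}. c (fst q) (snd q) *\<^sub>R g (unit_matrix (fst q) (snd q)))"
proof -
  have "g c = g (\<lambda>a b. \<Sum>q\<in>{..<m} \<times> {..<n}. c (fst q) (snd q) * unit_matrix (fst q) (snd q) a b)"
    by (rule arg_cong[OF matrix_sum_units[OF c]])
  also have "\<dots> = (\<Sum>q\<in>{..<m} \<times> {..<n}. g (\<lambda>a b. c (fst q) (snd q) * unit_matrix (fst q) (snd q) a b))"
    by (rule embedding_sum[OF g]) (auto simp: unit_matrix_def)
  also have "\<dots> = (\<Sum>q\<in>{..<m} \<times> {..<n}. c (fst q) (snd q) *\<^sub>R g (unit_matrix (fst q) (snd q)))"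
    by (rule sum.cong[OF refl], rule embeddingD(2)[OF g], rule unit_matrix_mem) auto
  finally show ?thesis .
qed

lemma real_homs_sum:
  assumes e: "0 \<le> e" and \<omega>: "\<omega> \<in> real_homs e" and "finite A" "\<And>a. a \<in> A \<Longrightarrow> f a \<in> principal_ideal e"
  shows "(\<Sum>a\<in>A. f a) \<in> principal_ideal e \<and> \<omega> (\<Sum>a\<in>A. f a) = (\<Sum>a\<in>A. \<omega> (f a))"
  using assms(3,4)
proof induction
  case empty
  have "0 \<in> principal_ideal e" by (rule order_idealD(1)[OF order_ideal_principal[OF e]])
  then show ?case using real_homsD(6)[OF \<omega> _ e, of 0] by simp
next
  case (insert a A)
  have "f a \<in> principal_ideal e" and A: "sum f A \<in> principal_ideal e" "\<omega> (sum f A) = (\<Sum>a\<in>A. \<omega> (f a))"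
    using insert by auto
  then have "f a + sum f A \<in> principal_ideal e \<and> \<omega> (f a + sum f A) = \<omega> (f a) + \<omega> (sum f A)"
    using order_idealD(2)[OF order_ideal_principal[OF e]] real_homsD(3)[OF \<omega>] by blast
  then show ?case using insert.hyps A(2) by simp
qed

text \<open>Two homomorphisms share a piece when their rounded values agree on all of
  \<open>as\<close>; bounded values leave finitely many pieces. A representative of each piece turns
  the rounded values into functions of the key.\<close>

lemma finite_key:
  fixes \<Omega> :: "('a \<Rightarrow> real) set"
  assumes "\<Omega> \<noteq> {}" "0 < \<theta>" and bound: "\<forall>\<omega>\<in>\<Omega>. \<forall>a\<in>set as. \<bar>\<omega> a\<bar> \<le> 1"
  shows "\<exists>(p :: nat) key rep. 0 < p \<and> (\<forall>\<omega>\<in>\<Omega>. key \<omega> < p) \<and> (\<forall>\<kappa><p. rep \<kappa> \<in> \<Omega>) \<and>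
     (\<forall>\<omega>\<in>\<Omega>. \<forall>a\<in>set as. \<lfloor>rep (key \<omega>) a / \<theta>\<rfloor> = \<lfloor>\<omega> a / \<theta>\<rfloor>)"
proof -
  define v where "v \<omega> = map (\<lambda>a. \<lfloor>\<omega> a / \<theta>\<rfloor>) as" for \<omega> :: "'a \<Rightarrow> real"
  have "v ` \<Omega> \<subseteq> {xs. set xs \<subseteq> {\<lfloor>- 1 / \<theta>\<rfloor>..\<lfloor>1 / \<theta>\<rfloor>} \<and> length xs = length as}"
  proof clarify
    fix \<omega> assume \<omega>: "\<omega> \<in> \<Omega>"
    have "\<lfloor>\<omega> a / \<theta>\<rfloor> \<in> {\<lfloor>- 1 / \<theta>\<rfloor>..\<lfloor>1 / \<theta>\<rfloor>}" if "a \<in> set as" for a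
    proof -
      have "- 1 \<le> \<omega> a" "\<omega> a \<le> 1" using bound[rule_format, OF \<omega> that] by auto
      then show ?thesis
        using assms(2) divide_right_mono[of "- 1" "\<omega> a" \<theta>] divide_right_mono[of "\<omega> a" 1 \<theta>]
        by (auto intro!: floor_mono)
    qed
    then show "set (v \<omega>) \<subseteq> {\<lfloor>- 1 / \<theta>\<rfloor>..\<lfloor>1 / \<theta>\<rfloor>} \<and> length (v \<omega>) = length as" by (auto simp: v_def)
  qed
  then have fin: "finite (v ` \<Omega>)" by (rule finite_subset) (rule finite_lists_length_eq, simp)
  obtain h where h: "bij_betw h (v ` \<Omega>) {0..<card (v ` \<Omega>)}" using ex_bij_betw_finite_nat[OF fin] by blast
  let ?p = "card (v ` \<Omega>)"
  have p: "0 < ?p" using fin assms(1) by (simp add: card_gt_0_iff)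
  have key: "h (v \<omega>) < ?p" if "\<omega> \<in> \<Omega>" for \<omega> using bij_betwE[OF h] that by auto
  have "\<exists>\<omega>\<in>\<Omega>. h (v \<omega>) = \<kappa>" if "\<kappa> < ?p" for \<kappa>
  proof -
    have "\<kappa> \<in> h ` v ` \<Omega>" using h that by (simp add: bij_betw_def)
    then show ?thesis by auto
  qed
  then obtain rep where rep: "\<And>\<kappa>. \<kappa> < ?p \<Longrightarrow> rep \<kappa> \<in> \<Omega> \<and> h (v (rep \<kappa>)) = \<kappa>" by metis
  have "v (rep (h (v \<omega>))) = v \<omega>" if "\<omega> \<in> \<Omega>" for \<omega>
    using rep[OF key[OF that]] bij_betw_imp_inj_on[OF h] that by (auto dest: inj_onD)
  then have "\<lfloor>rep (h (v \<omega>)) a / \<theta>\<rfloor> = \<lfloor>\<omega> a / \<theta>\<rfloor>" if "\<omega> \<in> \<Omega>" "a \<in> set as" for \<omega> a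
    using that by (auto simp: v_def)
  then show ?thesis using p key rep by (intro exI[of _ ?p] exI[of _ "\<lambda>\<omega>. h (v \<omega>)"] exI[of _ rep]) auto
qed

text \<open>Lattice homomorphisms between lattices of matrices: each entry is a multiple of an entry of \<open>x\<close>.\<close>

definition pull :: "nat \<Rightarrow> nat \<Rightarrow> (nat \<Rightarrow> nat \<Rightarrow> nat) \<Rightarrow> (nat \<Rightarrow> nat \<Rightarrow> nat) \<Rightarrow> (nat \<Rightarrow> nat \<Rightarrow> real) \<Rightarrow>
    (nat \<Rightarrow> nat \<Rightarrow> real) \<Rightarrow> nat \<Rightarrow> nat \<Rightarrow> real" where
  "pull m n \<alpha> \<beta> s x = (\<lambda>k l. if k < m \<and> l < n then s k l * x (\<alpha> k l) (\<beta> k l) else 0)"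

lemma floor_approx:
  assumes "0 < \<theta>"
  shows "\<theta> * of_int \<lfloor>x / \<theta>\<rfloor> \<le> x" "\<bar>x - \<theta> * of_int \<lfloor>x / \<theta>\<rfloor>\<bar> \<le> (\<theta>::real)"
proof -
  have "\<theta> * of_int \<lfloor>x / \<theta>\<rfloor> \<le> \<theta> * (x / \<theta>)" using assms by (intro mult_left_mono of_int_floor_le) simp
  then show 1: "\<theta> * of_int \<lfloor>x / \<theta>\<rfloor> \<le> x" using assms by simp
  have "\<theta> * (x / \<theta>) \<le> \<theta> * (of_int \<lfloor>x / \<theta>\<rfloor> + 1)"
    using assms by (intro mult_left_mono real_of_int_floor_add_one_ge) simp
  then have "x \<le> \<theta> * of_int \<lfloor>x / \<theta>\<rfloor> + \<theta>" using assms by (simp add: distrib_left)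
  then show "\<bar>x - \<theta> * of_int \<lfloor>x / \<theta>\<rfloor>\<bar> \<le> \<theta>" using 1 by simp
qed

text \<open>Closeness to \<open>g\<close> is claimed at the matrix units only, because rounding and
  homogeneity handle finitely many elements; \<open>embedding_map_diff_le\<close> extends it to all
  matrices.\<close>

lemma extension_step:
  fixes g :: "(nat \<Rightarrow> nat \<Rightarrow> real) \<Rightarrow> 'a::banach_lattice"
  assumes BL: "is_BL TYPE('a)" and m: "0 < m" and n: "0 < n"
    and g: "bl_embedding (linf_l1 m n) (blat_of UNIV) g" and \<epsilon>: "0 < \<epsilon>"
  shows "\<exists>m' n' \<alpha> \<beta> s g'. 0 < m' \<and> 0 < n' \<and> bl_embedding (linf_l1 m' n') (blat_of (UNIV :: 'a set)) g' \<and>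
    (\<forall>k<m'. \<forall>l<n'. \<alpha> k l < m \<and> \<beta> k l < n \<and> 0 \<le> s k l) \<and>
    (\<forall>x. bnorm (linf_l1 m' n') (pull m' n' \<alpha> \<beta> s x) = bnorm (linf_l1 m n) x) \<and>
    (\<forall>i<m. \<forall>j<n. norm (g (unit_matrix i j) - g' (pull m' n' \<alpha> \<beta> s (unit_matrix i j))) \<le> \<epsilon>) \<and>
    (\<exists>c\<in>bcarrier (linf_l1 m' n'). norm (d - g' c) \<le> \<epsilon>)"
proof -
  let ?Q = "{..<m} \<times> {..<n}"
  define b where "b q = g (unit_matrix (fst q) (snd q))" for q
  have unit: "unit_matrix (fst q) (snd q) \<in> bcarrier (linf_l1 m n)" if "q \<in> ?Q" for q
    using that by (intro unit_matrix_mem) auto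
  have b_pos: "0 \<le> b q" if "q \<in> ?Q" for q
    unfolding b_def by (rule embedding_nonneg[OF g unit[OF that]]) (simp add: unit_matrix_def)
  have b_disj: "inf (b q) (b r) = 0" if "q \<in> ?Q" "r \<in> ?Q" "q \<noteq> r" for q r
  proof -
    have "(\<lambda>i j. min (unit_matrix (fst q) (snd q) i j) (unit_matrix (fst r) (snd r) i j)) = (\<lambda>_ _. 0)"
      using that(3) by (auto simp: unit_matrix_def fun_eq_iff prod_eq_iff)
    then show ?thesis
      using embeddingD(5)[OF g unit[OF that(1)] unit[OF that(2)]] embedding_zero[OF g] by (simp add: b_def)
  qed
  define e where "e = \<bar>d\<bar> + (\<Sum>q\<in>?Q. b q)"
  have sum_b: "0 \<le> (\<Sum>q\<in>?Q. b q)" using b_pos by (intro sum_nonneg)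
  have e: "0 \<le> e" unfolding e_def using sum_b by simp
  have b_le: "b q \<le> e" if q: "q \<in> ?Q" for q
  proof -
    have "(\<Sum>q\<in>?Q. b q) = b q + (\<Sum>q\<in>?Q - {q}. b q)" using q by (intro sum.remove) auto
    moreover have "0 \<le> (\<Sum>q\<in>?Q - {q}. b q)" using b_pos by (intro sum_nonneg) auto
    ultimately show ?thesis unfolding e_def by (simp add: add_increasing)
  qed
  define as where "as = d # map b (List.product [0..<m] [0..<n])"
  have as_set: "set as = insert d (b ` ?Q)" by (auto simp: as_def lessThan_atLeast0)
  have as_le: "\<bar>a\<bar> \<le> e" if "a \<in> set as" for a
    using that sum_b b_le b_pos unfolding as_set by (auto simp: e_def)
  have as_D: "a \<in> principal_ideal e" if "a \<in> set as" for a by (rule mem_principal_ideal[OF e as_le[OF that]])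
  have bD: "b q \<in> principal_ideal e" if "q \<in> ?Q" for q using that as_D unfolding as_set by blast
  have eD: "e \<in> principal_ideal e" by (rule mem_principal_ideal[OF e]) (simp add: e)
  note D = order_idealD[OF order_ideal_principal[OF e]]
  have \<omega>_le: "\<bar>\<omega> a\<bar> \<le> 1" if "\<omega> \<in> real_homs e" "a \<in> set as" for \<omega> a
    using real_homsD(8)[OF that(1) D(6)[OF as_D[OF that(2)]] eD as_le[OF that(2)]]
      real_homsD(9)[OF that(1) as_D[OF that(2)] e] real_homsD(1)[OF that(1)] by simp
  \<comment> \<open>Without homomorphisms, \<open>le_if_real_homs_le\<close> would give
    \<open>e \<le> 0\<close>, although \<open>e\<close> dominates the image of a matrix unit, which
    is not 0.\<close>
  have \<Omega>_ne: "real_homs e \<noteq> {}"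
  proof
    assume "real_homs e = {}"
    then have "e \<le> 0" by (intro le_if_real_homs_le[OF e eD D(1)]) simp
    then have "b (0, 0) \<le> 0" using b_le[of "(0, 0)"] m n by simp
    then have "b (0, 0) = 0" using b_pos[of "(0, 0)"] m n by simp
    then have "bnorm (linf_l1 m n) (unit_matrix 0 0) = 0"
      using embeddingD(1)[OF g unit[of "(0, 0)"]] m n by (simp add: b_def)
    moreover have "\<bar>unit_matrix 0 0 0 0\<bar> \<le> bnorm (linf_l1 m n) (unit_matrix 0 0)"
      by (rule linf_l1_entry_le[OF m n])
    ultimately show False by (simp add: unit_matrix_def)
  qed
  define E where "E = norm e + 1"
  have E: "0 < E" "norm e \<le> E" by (simp_all add: E_def add_nonneg_pos)
  \<comment> \<open>\<open>\<delta> E\<close> and \<open>\<theta> E\<close> are to be at most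
    \<open>\<epsilon> / 8\<close>, so that the majorant
    \<open>2 (\<theta> e + \<delta> \<bar>a\<bar>)\<close> has norm at most
    \<open>\<epsilon> / 2\<close>; homogeneity takes the other half. The second bound on
    \<open>\<theta>\<close> lets the rounding errors of all entries together cost no more than the
    factor \<open>1 + \<delta>\<close> in \<open>lower\<close>.\<close>
  obtain K where K: "max 2 (8 * E / \<epsilon>) < real K" using reals_Archimedean2 by blast
  define \<delta> where "\<delta> = 1 / real K"
  have K2: "2 < real K" "8 * E / \<epsilon> < real K" using K by simp_all
  have K0: "0 < K" using K2(1) by linarith
  have \<delta>: "0 < \<delta>" "\<delta> < 1" unfolding \<delta>_def using K2(1) by simp_all
  have \<delta>E: "\<delta> * E \<le> \<epsilon> / 8" unfolding \<delta>_def using K2(1) K2(2) \<epsilon> E(1) by (simp add: field_simps)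
  define \<theta> where "\<theta> = min (\<epsilon> / (8 * E)) (\<delta> / ((1 + \<delta>) * real m * E))"
  have \<theta>: "0 < \<theta>" unfolding \<theta>_def using \<epsilon> E(1) \<delta> m by simp
  have \<theta>E: "\<theta> * E \<le> \<epsilon> / 8"
  proof -
    have "\<theta> * E \<le> \<epsilon> / (8 * E) * E" unfolding \<theta>_def using E(1) by (intro mult_right_mono) auto
    then show ?thesis using E(1) by simp
  qed
  have \<theta>m: "\<theta> * (real m * E) \<le> \<delta> / (1 + \<delta>)"
  proof -
    have "\<theta> * (real m * E) \<le> \<delta> / ((1 + \<delta>) * real m * E) * (real m * E)"
      unfolding \<theta>_def using E(1) by (intro mult_right_mono) auto
    also have "\<dots> = (\<delta> * (real m * E)) / ((1 + \<delta>) * (real m * E))" by (simp add: mult.assoc)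
    also have "\<dots> = \<delta> / (1 + \<delta>)" using E(1) m by (intro mult_divide_mult_cancel_right) simp
    finally show ?thesis .
  qed
  have \<omega>_bound: "\<forall>\<omega>\<in>real_homs e. \<forall>a\<in>set as. \<bar>\<omega> a\<bar> \<le> 1" by (intro ballI \<omega>_le)
  obtain p :: nat and key rep where p: "0 < p" and key': "\<forall>\<omega>\<in>real_homs e. key \<omega> < p"
    and rep': "\<forall>\<kappa><p. rep \<kappa> \<in> real_homs e"
    and rep_key': "\<forall>\<omega>\<in>real_homs e. \<forall>a\<in>set as. \<lfloor>rep (key \<omega>) a / \<theta>\<rfloor> = \<lfloor>\<omega> a / \<theta>\<rfloor>"
    using finite_key[OF \<Omega>_ne \<theta> \<omega>_bound] by (elim exE conjE) (rule that)
  note key = key'[rule_format] and rep = rep'[rule_format] and rep_key = rep_key'[rule_format]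
  interpret keyed e p key by unfold_locales (fact e p key)+
  define T where "T a \<kappa> = \<theta> * of_int \<lfloor>rep \<kappa> a / \<theta>\<rfloor>" for a \<kappa>
  have T_le: "T a (key \<omega>) \<le> \<omega> a" and T_close: "\<bar>\<omega> a - T a (key \<omega>)\<bar> \<le> \<theta>"
    if "\<omega> \<in> real_homs e" "a \<in> set as" for \<omega> a
    unfolding T_def rep_key[OF that] by (rule floor_approx[OF \<theta>])+
  \<comment> \<open>The images of the matrix units are disjoint, and rounding down preserves this,
    so at each key at most one of the \<open>T (b q)\<close> is non-zero; \<open>pick\<close> names
    it. Where all of them vanish, the default does no harm because the factor \<open>t\<close> is
    0.\<close>
  define pick where "pick \<kappa> = (if \<exists>q\<in>?Q. T (b q) \<kappa> \<noteq> 0 then SOME q. q \<in> ?Q \<and> T (b q) \<kappa> \<noteq> 0 else (0, 0))" for \<kappa>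
  have pick_mem: "pick \<kappa> \<in> ?Q" for \<kappa>
  proof (cases "\<exists>q\<in>?Q. T (b q) \<kappa> \<noteq> 0")
    case True
    then have "\<exists>q. q \<in> ?Q \<and> T (b q) \<kappa> \<noteq> 0" by blast
    from someI_ex[OF this] show ?thesis using True by (simp add: pick_def)
  next
    case False
    then show ?thesis unfolding pick_def if_not_P[OF False] using m n by simp
  qed
  have pick_nz: "T (b (pick \<kappa>)) \<kappa> \<noteq> 0" if "q \<in> ?Q" "T (b q) \<kappa> \<noteq> 0" for q \<kappa>
  proof -
    have ex: "\<exists>q. q \<in> ?Q \<and> T (b q) \<kappa> \<noteq> 0" using that by blast
    then have "pick \<kappa> = (SOME q. q \<in> ?Q \<and> T (b q) \<kappa> \<noteq> 0)" unfolding pick_def by (intro if_P) blast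
    then show ?thesis using someI_ex[OF ex] by simp
  qed
  have rep_pos: "0 \<le> rep \<kappa> (b q)" if "\<kappa> < p" "q \<in> ?Q" for q \<kappa>
    using real_homsD(8)[OF rep[OF that(1)] D(1) bD[OF that(2)] b_pos[OF that(2)]]
      real_homsD(6)[OF rep[OF that(1)] eD e] by simp
  have T_pos: "0 \<le> T (b q) \<kappa>" if "\<kappa> < p" "q \<in> ?Q" for q \<kappa>
    unfolding T_def using rep_pos[OF that] \<theta> by simp
  have T_nz: "0 < rep \<kappa> (b q)" if "\<kappa> < p" "q \<in> ?Q" "T (b q) \<kappa> \<noteq> 0" for q \<kappa>
  proof -
    have "0 < T (b q) \<kappa>" using T_pos[OF that(1,2)] that(3) by simp
    also have "\<dots> \<le> rep \<kappa> (b q)" unfolding T_def by (rule floor_approx(1)[OF \<theta>])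
    finally show ?thesis .
  qed
  define t where "t \<kappa> = (if \<kappa> < p then T (b (pick \<kappa>)) \<kappa> else 0)" for \<kappa>
  have t: "0 \<le> t \<kappa>" for \<kappa> using T_pos[OF _ pick_mem] by (simp add: t_def)
  have T_unit: "T (b q) \<kappa> = t \<kappa> * unit_matrix (fst q) (snd q) (fst (pick \<kappa>)) (snd (pick \<kappa>))"
    if "\<kappa> < p" "q \<in> ?Q" for q \<kappa>
  proof (cases "q = pick \<kappa>")
    case True
    then show ?thesis using that(1) by (simp add: t_def unit_matrix_def)
  next
    case False
    have "T (b q) \<kappa> = 0"
    proof (rule ccontr)
      assume nz: "T (b q) \<kappa> \<noteq> 0"
      have "0 < rep \<kappa> (b q)" "0 < rep \<kappa> (b (pick \<kappa>))"
        using T_nz[OF that nz] T_nz[OF that(1) pick_mem pick_nz[OF that(2) nz]] .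
      moreover have "rep \<kappa> (inf (b q) (b (pick \<kappa>))) = min (rep \<kappa> (b q)) (rep \<kappa> (b (pick \<kappa>)))"
        by (rule real_homsD(10)[OF rep[OF that(1)] bD[OF that(2)] bD[OF pick_mem] e])
      moreover have "rep \<kappa> 0 = 0" by (rule real_homsD(6)[OF rep[OF that(1)] eD e])
      ultimately show False using b_disj[OF that(2) pick_mem False] by simp
    qed
    then show ?thesis using False by (auto simp: unit_matrix_def prod_eq_iff)
  qed
  \<comment> \<open>The rounding of \<open>g x\<close>: each coordinate is a multiple of a single
    entry of \<open>x\<close>, the form that \<open>exact_rows\<close> requires.\<close>
  let ?\<tau> = "\<lambda>x \<kappa>. t \<kappa> * x (fst (pick \<kappa>)) (snd (pick \<kappa>))"
  have \<tau>_eq: "?\<tau> x \<kappa> = (\<Sum>q\<in>?Q. x (fst q) (snd q) * T (b q) \<kappa>)" if "\<kappa> < p" for x \<kappa>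
  proof -
    have ab: "fst (pick \<kappa>) < m" "snd (pick \<kappa>) < n" using pick_mem[of \<kappa>] by auto
    have "?\<tau> x \<kappa> = t \<kappa> * (\<Sum>q\<in>?Q. x (fst q) (snd q) * unit_matrix (fst q) (snd q) (fst (pick \<kappa>)) (snd (pick \<kappa>)))"
      using matrix_eq_sum_units[OF ab, of x] by (simp add: sum.cartesian_product case_prod_unfold)
    also have "\<dots> = (\<Sum>q\<in>?Q. x (fst q) (snd q) * T (b q) \<kappa>)"
      unfolding sum_distrib_left by (rule sum.cong[OF refl]) (simp add: T_unit[OF that])
    finally show ?thesis .
  qed
  \<comment> \<open>The matrix norm and \<open>?\<tau>\<close> look only at the \<open>m\<close> by
    \<open>n\<close> block, whereas \<open>g\<close> is controlled only at matrices that vanish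
    outside it.\<close>
  let ?cut = "\<lambda>x i j. if i < m \<and> j < n then x i j else 0 :: real"
  have cut_mem: "?cut x \<in> bcarrier (linf_l1 m n)" for x by auto
  have cut_norm: "norm (g (?cut x)) = bnorm (linf_l1 m n) x" for x
    unfolding embeddingD(1)[OF g cut_mem] by (intro antisym linf_l1_norm_mono m) auto
  have g_cut: "g (?cut x) = (\<Sum>q\<in>?Q. x (fst q) (snd q) *\<^sub>R b q)" for x
    unfolding embedding_eq_sum[OF g cut_mem] b_def by (rule sum.cong) auto
  have g_cut_D: "g (?cut x) \<in> D" and g_cut_hom: "\<omega> \<in> real_homs e \<Longrightarrow> \<omega> (g (?cut x)) = (\<Sum>q\<in>?Q. x (fst q) (snd q) * \<omega> (b q))"
    for x \<omega>
  proof -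
    have *: "g (?cut x) \<in> D \<and> \<omega> (g (?cut x)) = (\<Sum>q\<in>?Q. x (fst q) (snd q) * \<omega> (b q))" if \<omega>: "\<omega> \<in> real_homs e" for \<omega>
    proof -
      have "(\<Sum>q\<in>?Q. \<omega> (x (fst q) (snd q) *\<^sub>R b q)) = (\<Sum>q\<in>?Q. x (fst q) (snd q) * \<omega> (b q))"
        by (rule sum.cong[OF refl]) (rule real_homsD(2)[OF \<omega> bD])
      then show ?thesis
        unfolding g_cut using real_homs_sum[OF e \<omega>, of ?Q "\<lambda>q. x (fst q) (snd q) *\<^sub>R b q"] D(3)[OF bD] by simp
    qed
    show "g (?cut x) \<in> D" using * \<Omega>_ne by blast
    show "\<omega> \<in> real_homs e \<Longrightarrow> \<omega> (g (?cut x)) = (\<Sum>q\<in>?Q. x (fst q) (snd q) * \<omega> (b q))" using * by blast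
  qed
  \<comment> \<open>Since values are rounded down, the image of \<open>x\<close> under
    \<open>g\<close> is itself one of the majorants.\<close>
  have upper: "\<rho> (?\<tau> x) \<le> bnorm (linf_l1 m n) x" if x: "\<And>i j. 0 \<le> x i j" for x
  proof -
    have "g (?cut x) \<in> majorants (?\<tau> x)"
      unfolding majorants_def
    proof (intro CollectI conjI ballI g_cut_D)
      show "0 \<le> g (?cut x)" by (rule embedding_nonneg[OF g cut_mem]) (simp add: x)
      fix \<omega> assume \<omega>: "\<omega> \<in> real_homs e"
      show "?\<tau> x (key \<omega>) \<le> \<omega> (g (?cut x))"
        unfolding \<tau>_eq[OF key[OF \<omega>]] g_cut_hom[OF \<omega>]
        using T_le[OF \<omega>] as_set x by (intro sum_mono mult_left_mono) auto
    qed
    from \<rho>_le[OF this] show ?thesis unfolding cut_norm .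
  qed
  \<comment> \<open>A majorant of the rounding dominates the image of \<open>x\<close> once
    \<open>\<theta> X e\<close> is added, where the sum \<open>X\<close> of all entries is at most
    \<open>m\<close> times the norm.\<close>
  have lower: "bnorm (linf_l1 m n) x \<le> (1 + \<delta>) * \<rho> (?\<tau> x)" if x: "\<And>i j. 0 \<le> x i j" for x
  proof -
    let ?B = "bnorm (linf_l1 m n) x" and ?X = "\<Sum>q\<in>?Q. x (fst q) (snd q)"
    have X_le: "?X \<le> real m * ?B"
    proof -
      have "?X = (\<Sum>i<m. \<Sum>j<n. x i j)" by (simp add: sum.cartesian_product case_prod_unfold)
      also have "\<dots> \<le> (\<Sum>i<m. ?B)"
      proof (rule sum_mono)
        fix i assume "i \<in> {..<m}"
        have "(\<Sum>j<n. x i j) = (\<Sum>j<n. \<bar>x i j\<bar>)" using x by simp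
        also have "\<dots> \<le> ?B" using \<open>i \<in> {..<m}\<close> by (intro linf_l1_row_le) simp
        finally show "(\<Sum>j<n. x i j) \<le> ?B" .
      qed
      finally show ?thesis by simp
    qed
    have X0: "0 \<le> ?X" using x by (intro sum_nonneg)
    have B0: "0 \<le> ?B" by (rule linf_l1_norm_nonneg[OF m])
    have "?B / (1 + \<delta>) \<le> \<rho> (?\<tau> x)"
    proof (rule \<rho>_ge)
      fix y assume y: "y \<in> majorants (?\<tau> x)"
      then have yD: "y \<in> D" by (simp add: majorants_def)
      have "g (?cut x) \<le> y + (\<theta> * ?X) *\<^sub>R e"
      proof (rule le_if_real_homs_le[OF e g_cut_D D(2)[OF yD D(3)[OF eD]]])
        fix \<omega> assume \<omega>: "\<omega> \<in> real_homs e"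
        have "\<omega> (g (?cut x)) \<le> (\<Sum>q\<in>?Q. x (fst q) (snd q) * T (b q) (key \<omega>) + x (fst q) (snd q) * \<theta>)"
          unfolding g_cut_hom[OF \<omega>] distrib_left[symmetric]
        proof (intro sum_mono mult_left_mono x)
          fix q assume "q \<in> ?Q"
          then have "b q \<in> set as" using as_set by blast
          from T_close[OF \<omega> this] show "\<omega> (b q) \<le> T (b q) (key \<omega>) + \<theta>" by linarith
        qed
        also have "\<dots> = ?\<tau> x (key \<omega>) + \<theta> * ?X"
          unfolding \<tau>_eq[OF key[OF \<omega>]] sum.distrib by (simp add: sum_distrib_left mult.commute)
        also have "\<dots> \<le> \<omega> y + \<theta> * ?X" using y \<omega> by (simp add: majorants_def)
        also have "\<dots> = \<omega> (y + (\<theta> * ?X) *\<^sub>R e)"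
          by (simp add: real_homsD(3)[OF \<omega> yD D(3)[OF eD]] real_homsD(2)[OF \<omega> eD] real_homsD(1)[OF \<omega>])
        finally show "\<omega> (g (?cut x)) \<le> \<omega> (y + (\<theta> * ?X) *\<^sub>R e)" .
      qed
      then have "norm (g (?cut x)) \<le> norm (y + (\<theta> * ?X) *\<^sub>R e)"
        by (rule norm_mono_nonneg[rotated]) (rule embedding_nonneg[OF g cut_mem], simp add: x)
      also have "\<dots> \<le> norm y + norm ((\<theta> * ?X) *\<^sub>R e)" by (rule norm_triangle_ineq)
      also have "norm ((\<theta> * ?X) *\<^sub>R e) = \<theta> * ?X * norm e" using \<theta> X0 by simp
      also have "\<dots> \<le> \<theta> * (real m * ?B) * E" using X_le X0 \<theta> E B0 by (intro mult_mono) auto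
      also have "\<dots> = \<theta> * (real m * E) * ?B" by (simp add: algebra_simps)
      also have "\<dots> \<le> \<delta> / (1 + \<delta>) * ?B" by (rule mult_right_mono[OF \<theta>m B0])
      finally have "?B - \<delta> / (1 + \<delta>) * ?B \<le> norm y" by (simp add: cut_norm)
      moreover have "?B - \<delta> / (1 + \<delta>) * ?B = ?B / (1 + \<delta>)" using \<delta> by (simp add: field_simps)
      ultimately show "?B / (1 + \<delta>) \<le> norm y" by simp
    qed
    then show ?thesis using \<delta> by (simp add: pos_divide_le_eq mult.commute)
  qed
  obtain m' :: nat and w where m': "0 < m'" and w: "\<forall>r k. 0 \<le> w r k"
    and w1: "\<forall>r<m'. \<forall>z. (\<forall>k. 0 \<le> z k) \<longrightarrow> (\<Sum>k<p. w r k * z k) \<le> (1 + \<delta>) * \<rho> z"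
    and w2: "\<forall>z. (\<forall>k. 0 \<le> z k) \<longrightarrow> (\<exists>r<m'. (1 - 1 / real K) * \<rho> z \<le> (\<Sum>k<p. w r k * z k))"
    and w3: "\<forall>x. (\<forall>i j. 0 \<le> x i j) \<longrightarrow> (\<forall>r<m'. (\<Sum>k<p. w r k * ?\<tau> x k) \<le> bnorm (linf_l1 m n) x)"
    and w4: "\<forall>i<m. \<exists>r<m'. \<forall>x. (\<Sum>k<p. w r k * ?\<tau> x k) = (\<Sum>j<n. x i j)"
  proof -
    have ab: "fst (pick k) < m \<and> snd (pick k) < n" for k using pick_mem[of k] by auto
    have lower': "\<forall>x. (\<forall>i j. 0 \<le> x i j) \<longrightarrow> bnorm (linf_l1 m n) x \<le> (1 + \<delta>) * \<rho> (?\<tau> x)" using lower by blast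
    have upper': "\<forall>x. (\<forall>i j. 0 \<le> x i j) \<longrightarrow> \<rho> (?\<tau> x) \<le> bnorm (linf_l1 m n) x" using upper by blast
    show ?thesis
      using \<rho>.exact_rows[of m K t "\<lambda>k. fst (pick k)" "\<lambda>k. snd (pick k)" n \<delta>, OF m K0 t ab lower' upper' less_imp_le[OF \<delta>(1)]]
      by (elim exE conjE) (rule that)
  qed
  interpret R: row_model e p key \<delta> m' w
  proof
    show "0 < \<delta>" "\<delta> < 1" "0 < m'" by (fact \<delta> m')+
    show "0 \<le> w k \<kappa>" for k \<kappa> using w by blast
    show "(\<Sum>\<kappa><p. w k \<kappa> * z \<kappa>) \<le> (1 + \<delta>) * \<rho> z" if "k < m'" "\<And>\<kappa>. 0 \<le> z \<kappa>" for k z using w1 that by blast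
    show "\<exists>k<m'. (1 - \<delta>) * \<rho> z \<le> (\<Sum>\<kappa><p. w k \<kappa> * z \<kappa>)" if "\<And>\<kappa>. 0 \<le> z \<kappa>" for z
      using w2 that unfolding \<delta>_def by blast
  qed
  have asD: "set as \<subseteq> principal_ideal e" using as_D by blast
  obtain g' where g': "bl_embedding (linf_l1 m' p) (blat_of (UNIV :: 'a set)) g'"
    and g'_close: "\<And>x c v. x \<in> set as \<Longrightarrow> c \<in> bcarrier (linf_l1 m' p) \<Longrightarrow> v \<in> D \<Longrightarrow> 0 \<le> v \<Longrightarrow>
       (\<And>s. \<bar>R.am.J x s - R.am.I c s\<bar> \<le> R.am.J v s) \<Longrightarrow> norm (x - g' c) \<le> norm v + \<epsilon> / 2"
    using R.am.embed_in_BL[OF BL asD half_gt_zero[OF \<epsilon>]] by blast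
  have wt_mem: "R.weighted T' \<in> bcarrier (linf_l1 m' p)" for T' by (auto simp: R.weighted_def)
  have close: "norm (a - g' (R.weighted (T a))) \<le> \<epsilon>" if a: "a \<in> set as" for a
  proof -
    let ?v = "2 *\<^sub>R (\<theta> *\<^sub>R e + \<delta> *\<^sub>R \<bar>a\<bar>)"
    have "norm (a - g' (R.weighted (T a))) \<le> norm ?v + \<epsilon> / 2"
    proof (rule g'_close[OF a wt_mem])
      show "?v \<in> D" by (intro D(2,3) eD D(6) as_D a)
      show "0 \<le> ?v" using e \<theta> \<delta> by (intro scaleR_nonneg_nonneg add_nonneg_nonneg) auto
      show "\<bar>R.am.J a s - R.am.I (R.weighted (T a)) s\<bar> \<le> R.am.J ?v s" for s
        by (rule R.weighted_close[OF as_D[OF a] T_close[OF _ a]])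
    qed
    also have "norm ?v \<le> 2 * (\<theta> * E + \<delta> * E)"
    proof -
      have "norm a \<le> norm e" by (rule norm_le_dominated[OF as_le[OF a]])
      then have "norm (\<theta> *\<^sub>R e) + norm (\<delta> *\<^sub>R \<bar>a\<bar>) \<le> \<theta> * E + \<delta> * E"
        using E(2) \<theta> \<delta> by (intro add_mono) (auto simp: norm_abs_eq)
      then show ?thesis using norm_triangle_ineq[of "\<theta> *\<^sub>R e" "\<delta> *\<^sub>R \<bar>a\<bar>"] by simp
    qed
    finally show ?thesis using \<theta>E \<delta>E by simp
  qed
  \<comment> \<open>With these weights the image of a matrix unit is \<open>R.weighted\<close> of
    its rounding, so \<open>close\<close> applies to it.\<close>
  define s where "s k \<kappa> = w k \<kappa> * t \<kappa>" for k \<kappa>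
  let ?\<iota> = "pull m' p (\<lambda>k \<kappa>. fst (pick \<kappa>)) (\<lambda>k \<kappa>. snd (pick \<kappa>)) s"
  have \<iota>_row: "(\<Sum>\<kappa><p. \<bar>?\<iota> x k \<kappa>\<bar>) = (\<Sum>\<kappa><p. w k \<kappa> * ?\<tau> (\<lambda>i j. \<bar>x i j\<bar>) \<kappa>)" if "k < m'" for x k
    using that w t by (intro sum.cong) (auto simp: pull_def s_def abs_mult)
  have "bnorm (linf_l1 m' p) (?\<iota> x) = bnorm (linf_l1 m n) x" for x
  proof (rule antisym)
    have abs_norm: "bnorm (linf_l1 m n) (\<lambda>i j. \<bar>x i j\<bar>) \<le> bnorm (linf_l1 m n) x"
      by (rule linf_l1_norm_mono[OF m]) simp
    show "bnorm (linf_l1 m' p) (?\<iota> x) \<le> bnorm (linf_l1 m n) x"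
      unfolding linf_l1_norm_le_iff[OF m']
    proof (intro allI impI)
      fix k assume k: "k < m'"
      have "(\<Sum>\<kappa><p. w k \<kappa> * ?\<tau> (\<lambda>i j. \<bar>x i j\<bar>) \<kappa>) \<le> bnorm (linf_l1 m n) (\<lambda>i j. \<bar>x i j\<bar>)"
        using w3[rule_format, of "\<lambda>i j. \<bar>x i j\<bar>" k] k by simp
      then show "(\<Sum>\<kappa><p. \<bar>?\<iota> x k \<kappa>\<bar>) \<le> bnorm (linf_l1 m n) x" unfolding \<iota>_row[OF k] using abs_norm by linarith
    qed
    \<comment> \<open>By \<open>w4\<close> every old row sum recurs among the new ones, so the norm
      does not drop.\<close>
    show "bnorm (linf_l1 m n) x \<le> bnorm (linf_l1 m' p) (?\<iota> x)"
      unfolding linf_l1_norm_le_iff[OF m]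
    proof (intro allI impI)
      fix i assume "i < m"
      then obtain k where k: "k < m'" "\<And>x. (\<Sum>\<kappa><p. w k \<kappa> * ?\<tau> x \<kappa>) = (\<Sum>j<n. x i j)" using w4 by blast
      have "(\<Sum>j<n. \<bar>x i j\<bar>) = (\<Sum>\<kappa><p. \<bar>?\<iota> x k \<kappa>\<bar>)" unfolding \<iota>_row[OF k(1)] using k(2)[of "\<lambda>i j. \<bar>x i j\<bar>"] by simp
      also have "\<dots> \<le> bnorm (linf_l1 m' p) (?\<iota> x)" by (rule linf_l1_row_le[OF k(1)])
      finally show "(\<Sum>j<n. \<bar>x i j\<bar>) \<le> bnorm (linf_l1 m' p) (?\<iota> x)" .
    qed
  qed
  moreover have "norm (g (unit_matrix i j) - g' (?\<iota> (unit_matrix i j))) \<le> \<epsilon>" if ij: "i < m" "j < n" for i j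
  proof -
    have q: "(i, j) \<in> ?Q" using ij by simp
    have "?\<iota> (unit_matrix i j) = R.weighted (T (b (i, j)))"
      by (intro ext) (simp add: pull_def R.weighted_def s_def T_unit[OF _ q])
    moreover have "b (i, j) \<in> set as" using q as_set by blast
    ultimately show ?thesis using close[of "b (i, j)"] by (simp add: b_def)
  qed
  moreover have "\<exists>c\<in>bcarrier (linf_l1 m' p). norm (d - g' c) \<le> \<epsilon>"
    using close[of d] as_set by (intro bexI[OF _ wt_mem]) simp
  moreover have "fst (pick \<kappa>) < m \<and> snd (pick \<kappa>) < n \<and> 0 \<le> s k \<kappa>" for k \<kappa>
    using pick_mem[of \<kappa>] w t by (auto simp: s_def)
  ultimately show ?thesis
    using m' p g'
    by (intro exI[of _ m'] exI[of _ p] exI[of _ "\<lambda>k \<kappa>. fst (pick \<kappa>)"] exI[of _ "\<lambda>k \<kappa>. snd (pick \<kappa>)"] exI[of _ s] exI[of _ g'] conjI allI impI)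
      auto
qed

lemma pull_mem: "pull m n \<alpha> \<beta> s x \<in> bcarrier (linf_l1 m n)"
  by (auto simp: pull_def)

lemma unit_norm_le: "0 < m \<Longrightarrow> bnorm (linf_l1 m n) (unit_matrix i j) \<le> 1"
proof -
  assume m: "0 < m"
  have "(\<Sum>l<n. \<bar>unit_matrix i j k l\<bar>) \<le> 1" for k
  proof -
    have "(\<Sum>l<n. \<bar>unit_matrix i j k l\<bar>) \<le> (\<Sum>l<n. if l = j then 1 else 0)"
      by (rule sum_mono) (simp add: unit_matrix_def)
    also have "\<dots> \<le> (1 :: real)" by simp
    finally show ?thesis .
  qed
  then show ?thesis by (simp add: linf_l1_norm_le_iff[OF m])
qed

text \<open>A vanishing weight is replaced by a small share of a non-vanishing one in the same row, so that the
  row sums do not change.\<close>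

lemma full_support:
  assumes m: "0 < m" and n: "0 < n" and m': "0 < m'" and n': "0 < n'"
    and range_all: "\<forall>k<m'. \<forall>l<n'. \<alpha> k l < m \<and> \<beta> k l < n \<and> 0 \<le> s k l"
    and iso_all: "\<forall>x. bnorm (linf_l1 m' n') (pull m' n' \<alpha> \<beta> s x) = bnorm (linf_l1 m n) x"
    and \<epsilon>: "0 < \<epsilon>"
  shows "\<exists>\<alpha>' \<beta>' s'. (\<forall>k<m'. \<forall>l<n'. \<alpha>' k l < m \<and> \<beta>' k l < n \<and> 0 < s' k l) \<and>
    (\<forall>x. bnorm (linf_l1 m' n') (pull m' n' \<alpha>' \<beta>' s' x) = bnorm (linf_l1 m n) x) \<and>
    (\<forall>i j. bnorm (linf_l1 m' n') (\<lambda>k l. pull m' n' \<alpha> \<beta> s (unit_matrix i j) k l - pull m' n' \<alpha>' \<beta>' s' (unit_matrix i j) k l) \<le> \<epsilon>)"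
proof -
  note range = range_all[rule_format] and iso = iso_all[rule_format]
  have s_le: "s k l \<le> 1" if "k < m'" "l < n'" for k l
  proof -
    have "s k l \<le> \<bar>pull m' n' \<alpha> \<beta> s (unit_matrix (\<alpha> k l) (\<beta> k l)) k l\<bar>"
      using that by (simp add: pull_def unit_matrix_def)
    also have "\<dots> \<le> bnorm (linf_l1 m' n') (pull m' n' \<alpha> \<beta> s (unit_matrix (\<alpha> k l) (\<beta> k l)))"
      by (rule linf_l1_entry_le[OF that])
    also have "\<dots> \<le> 1" unfolding iso by (rule unit_norm_le[OF m])
    finally show ?thesis .
  qed
  \<comment> \<open>\<open>\<eta> \<le> 1 / 2\<close> keeps the reduced weight positive, and
    \<open>2 \<eta> \<le> \<epsilon>\<close> bounds the total change in a row.\<close>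
  define \<eta> where "\<eta> = min (\<epsilon> / 2) (1 / 2)"
  have \<eta>: "0 < \<eta>" "\<eta> \<le> \<epsilon> / 2" "\<eta> \<le> 1 / 2" using \<epsilon> by (auto simp: \<eta>_def)
  define pos where "pos k \<longleftrightarrow> (\<exists>l<n'. 0 < s k l)" for k
  define l0 where "l0 k = (SOME l. l < n' \<and> 0 < s k l)" for k
  have l0: "l0 k < n'" "0 < s k (l0 k)" if "pos k" for k
  proof -
    have "\<exists>l. l < n' \<and> 0 < s k l" using that by (auto simp: pos_def)
    from someI_ex[OF this] show "l0 k < n'" "0 < s k (l0 k)" by (auto simp: l0_def)
  qed
  define z where "z k l = (if s k l = 0 then 1 else 0 :: real)" for k l
  define N where "N k = (\<Sum>l<n'. z k l)" for k
  have N: "0 \<le> N k" "N k \<le> real n'" for k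
  proof -
    show "0 \<le> N k" unfolding N_def by (rule sum_nonneg) (simp add: z_def)
    have "N k \<le> (\<Sum>l<n'. 1)" unfolding N_def by (rule sum_mono) (simp add: z_def)
    then show "N k \<le> real n'" by simp
  qed
  define \<alpha>' where "\<alpha>' k l = (if pos k then if s k l = 0 then \<alpha> k (l0 k) else \<alpha> k l else 0)" for k l
  define \<beta>' where "\<beta>' k l = (if pos k then if s k l = 0 then \<beta> k (l0 k) else \<beta> k l else 0)" for k l
  \<comment> \<open>\<open>N k\<close> counts the vanishing weights in row \<open>k\<close>. Each of
    them receives the share \<open>\<eta> / n'\<close> of the weight at \<open>l0 k\<close>,
    together with the index pair there, and that weight gives up \<open>N k\<close> such shares. A
    row without positive weights copies the entry \<open>(0, 0)\<close> with total weight
    \<open>\<eta>\<close>, too little to exceed the norm.\<close>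
  define s' where "s' k l = (if pos k then if s k l = 0 then \<eta> * s k (l0 k) / real n'
      else if l = l0 k then (1 - \<eta> * N k / real n') * s k l else s k l else \<eta> / real n')" for k l
  have factor: "0 < 1 - \<eta> * N k / real n'" for k
  proof -
    have "\<eta> * N k \<le> 1 / 2 * real n'" using \<eta> N by (intro mult_mono) auto
    also have "\<dots> < real n'" using n' by simp
    finally show ?thesis using n' by simp
  qed
  have s'_pos: "0 < s' k l" if "k < m'" "l < n'" for k l
    using range[OF that] l0[of k] \<eta> n' factor[of k] by (auto simp: s'_def)
  have range': "\<alpha>' k l < m \<and> \<beta>' k l < n" if "k < m'" "l < n'" for k l
    using range[OF that] range[OF that(1) l0(1)] m n by (auto simp: \<alpha>'_def \<beta>'_def)
  let ?p = "pull m' n' \<alpha> \<beta> s" and ?p' = "pull m' n' \<alpha>' \<beta>' s'"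
  have entry: "s' k l * y (\<alpha>' k l) (\<beta>' k l) - s k l * y (\<alpha> k l) (\<beta> k l) =
      z k l * (\<eta> * s k (l0 k) / real n' * y (\<alpha> k (l0 k)) (\<beta> k (l0 k)))
      - (if l = l0 k then \<eta> * N k / real n' * s k (l0 k) * y (\<alpha> k (l0 k)) (\<beta> k (l0 k)) else 0)"
    if "pos k" for y k l
    using l0[OF that] that by (auto simp: s'_def \<alpha>'_def \<beta>'_def z_def algebra_simps)
  have row: "(\<Sum>l<n'. \<bar>?p' x k l\<bar>) = (\<Sum>l<n'. \<bar>?p x k l\<bar>)" if k: "k < m'" and "pos k" for x k
  proof -
    let ?y = "\<lambda>i j. \<bar>x i j\<bar>"
    let ?Y = "?y (\<alpha> k (l0 k)) (\<beta> k (l0 k))"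
    have "(\<Sum>l<n'. \<bar>?p' x k l\<bar>) - (\<Sum>l<n'. \<bar>?p x k l\<bar>)
      = (\<Sum>l<n'. s' k l * ?y (\<alpha>' k l) (\<beta>' k l) - s k l * ?y (\<alpha> k l) (\<beta> k l))"
      unfolding sum_subtractf[symmetric] using k s'_pos[OF k] range[OF k]
      by (intro sum.cong refl) (simp add: pull_def abs_mult less_imp_le)
    also have "\<dots> = (\<Sum>l<n'. z k l * (\<eta> * s k (l0 k) / real n' * ?Y)
        - (if l = l0 k then \<eta> * N k / real n' * s k (l0 k) * ?Y else 0))"
      by (rule sum.cong[OF refl]) (rule entry[OF \<open>pos k\<close>])
    also have "\<dots> = N k * (\<eta> * s k (l0 k) / real n' * ?Y) - \<eta> * N k / real n' * s k (l0 k) * ?Y"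
      unfolding sum_subtractf N_def[of k] sum_distrib_right using l0(1)[OF \<open>pos k\<close>] by simp
    also have "\<dots> = 0" by simp
    finally show ?thesis by simp
  qed
  have row0: "(\<Sum>l<n'. \<bar>?p x k l\<bar>) = 0" "(\<Sum>l<n'. \<bar>?p' x k l\<bar>) \<le> bnorm (linf_l1 m n) x"
    if k: "k < m'" and "\<not> pos k" for x k
  proof -
    have "s k l = 0" if "l < n'" for l using range[OF k that] \<open>\<not> pos k\<close> that by (auto simp: pos_def)
    then show "(\<Sum>l<n'. \<bar>?p x k l\<bar>) = 0" using k by (simp add: pull_def)
    have "(\<Sum>l<n'. \<bar>?p' x k l\<bar>) = (\<Sum>l<n'. \<eta> / real n' * \<bar>x 0 0\<bar>)"
      using \<open>\<not> pos k\<close> k \<eta> by (intro sum.cong) (simp_all add: pull_def s'_def \<alpha>'_def \<beta>'_def abs_mult)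
    also have "\<dots> = \<eta> * \<bar>x 0 0\<bar>" using n' by simp
    also have "\<dots> \<le> 1 * bnorm (linf_l1 m n) x"
      using \<eta> linf_l1_entry_le[OF m n, of x] by (intro mult_mono) auto
    finally show "(\<Sum>l<n'. \<bar>?p' x k l\<bar>) \<le> bnorm (linf_l1 m n) x" by simp
  qed
  have iso': "bnorm (linf_l1 m' n') (?p' x) = bnorm (linf_l1 m n) x" for x
  proof (rule antisym)
    show "bnorm (linf_l1 m' n') (?p' x) \<le> bnorm (linf_l1 m n) x"
      unfolding linf_l1_norm_le_iff[OF m']
    proof (intro allI impI)
      fix k assume k: "k < m'"
      show "(\<Sum>l<n'. \<bar>?p' x k l\<bar>) \<le> bnorm (linf_l1 m n) x"
      proof (cases "pos k")
        case True
        have "(\<Sum>l<n'. \<bar>?p x k l\<bar>) \<le> bnorm (linf_l1 m' n') (?p x)" by (rule linf_l1_row_le[OF k])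
        then show ?thesis unfolding row[OF k True] iso .
      qed (rule row0(2)[OF k])
    qed
    \<comment> \<open>Rows with a positive weight keep their sums, and the other rows of
      \<open>?p x\<close> are 0.\<close>
    have "bnorm (linf_l1 m' n') (?p x) \<le> bnorm (linf_l1 m' n') (?p' x)"
      unfolding linf_l1_norm_le_iff[OF m']
    proof (intro allI impI)
      fix k assume k: "k < m'"
      show "(\<Sum>l<n'. \<bar>?p x k l\<bar>) \<le> bnorm (linf_l1 m' n') (?p' x)"
      proof (cases "pos k")
        case True
        then show ?thesis unfolding row[OF k True, symmetric] by (intro linf_l1_row_le[OF k])
      next
        case False
        then show ?thesis unfolding row0(1)[OF k False] by (intro linf_l1_norm_nonneg m')
      qed
    qed
    then show "bnorm (linf_l1 m n) x \<le> bnorm (linf_l1 m' n') (?p' x)" unfolding iso .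
  qed
  have diff: "bnorm (linf_l1 m' n') (\<lambda>k l. ?p (unit_matrix i j) k l - ?p' (unit_matrix i j) k l) \<le> \<epsilon>" for i j
    unfolding linf_l1_norm_le_iff[OF m']
  proof (intro allI impI)
    fix k assume k: "k < m'"
    let ?u = "unit_matrix i j"
    have u: "0 \<le> ?u a b" "?u a b \<le> 1" for a b by (simp_all add: unit_matrix_def)
    have "(\<Sum>l<n'. \<bar>?p ?u k l - ?p' ?u k l\<bar>) \<le> (\<Sum>l<n'. \<eta> / real n' + (if l = l0 k then \<eta> else 0))"
    proof (rule sum_mono)
      fix l assume "l \<in> {..<n'}"
      then have l: "l < n'" by simp
      show "\<bar>?p ?u k l - ?p' ?u k l\<bar> \<le> \<eta> / real n' + (if l = l0 k then \<eta> else 0)"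
      proof (cases "pos k")
        case True
        define c where "c = s k (l0 k) * ?u (\<alpha> k (l0 k)) (\<beta> k (l0 k))"
        have c: "0 \<le> c" "c \<le> 1"
          unfolding c_def using l0[OF True] s_le[OF k l0(1)[OF True]] u by (auto intro: mult_le_one)
        have eq: "?p' ?u k l - ?p ?u k l = z k l * (\<eta> / real n') * c - (if l = l0 k then \<eta> * (N k / real n') * c else 0)"
          using entry[OF True, of l ?u] k l by (simp add: pull_def c_def mult.assoc)
        have "\<bar>?p ?u k l - ?p' ?u k l\<bar> = \<bar>?p' ?u k l - ?p ?u k l\<bar>" by (rule abs_minus_commute)
        also have "\<dots> = \<bar>z k l * (\<eta> / real n') * c - (if l = l0 k then \<eta> * (N k / real n') * c else 0)\<bar>"
          by (simp only: eq)
        also have "\<dots> \<le> \<bar>z k l * (\<eta> / real n') * c\<bar> + \<bar>if l = l0 k then \<eta> * (N k / real n') * c else 0\<bar>"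
          by (rule abs_triangle_ineq4)
        also have "\<bar>z k l * (\<eta> / real n') * c\<bar> \<le> \<eta> / real n'"
        proof -
          have "z k l * (\<eta> / real n') * c \<le> 1 * (\<eta> / real n') * 1"
            using c \<eta> by (intro mult_mono) (auto simp: z_def)
          moreover have "0 \<le> z k l * (\<eta> / real n') * c" using c \<eta> by (intro mult_nonneg_nonneg) (auto simp: z_def)
          ultimately show ?thesis by simp
        qed
        also have "\<bar>if l = l0 k then \<eta> * (N k / real n') * c else 0\<bar> \<le> (if l = l0 k then \<eta> else 0)"
        proof -
          have "N k / real n' \<le> 1" using N[of k] n' by simp
          then have "\<eta> * (N k / real n') * c \<le> \<eta> * 1 * 1"
            using c \<eta> N[of k] by (intro mult_mono) auto
          moreover have "0 \<le> \<eta> * (N k / real n') * c" using c \<eta> N[of k] by (intro mult_nonneg_nonneg) auto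
          ultimately show ?thesis by simp
        qed
        finally show ?thesis by simp
      next
        case False
        have "s k l = 0" using range[OF k l] False l by (auto simp: pos_def)
        then have "\<bar>?p ?u k l - ?p' ?u k l\<bar> = \<eta> / real n' * ?u 0 0"
          using k l False \<eta> u by (simp add: pull_def s'_def \<alpha>'_def \<beta>'_def abs_mult)
        also have "\<dots> \<le> \<eta> / real n' * 1" using \<eta> u by (intro mult_left_mono) auto
        also have "\<dots> \<le> \<eta> / real n' + (if l = l0 k then \<eta> else 0)" using \<eta> by simp
        finally show ?thesis .
      qed
    qed
    also have "\<dots> \<le> 2 * \<eta>" using n' \<eta> by (simp add: sum.distrib)
    also have "\<dots> \<le> \<epsilon>" using \<eta> by simp
    finally show "(\<Sum>l<n'. \<bar>?p ?u k l - ?p' ?u k l\<bar>) \<le> \<epsilon>" .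
  qed
  have "\<forall>k<m'. \<forall>l<n'. \<alpha>' k l < m \<and> \<beta>' k l < n \<and> 0 < s' k l"
    by (intro allI impI) (simp add: range' s'_pos)
  then show ?thesis
    by (intro exI[of _ \<alpha>'] exI[of _ \<beta>'] exI[of _ s'] conjI) (assumption, (rule allI)+, rule iso', (rule allI)+, rule diff)
qed

lemma extension_step_full:
  fixes g :: "(nat \<Rightarrow> nat \<Rightarrow> real) \<Rightarrow> 'a::banach_lattice"
  assumes BL: "is_BL TYPE('a)" and m: "0 < m" and n: "0 < n"
    and g: "bl_embedding (linf_l1 m n) (blat_of UNIV) g" and \<epsilon>: "0 < \<epsilon>"
  shows "\<exists>m' n' \<alpha> \<beta> s g'. 0 < m' \<and> 0 < n' \<and> bl_embedding (linf_l1 m' n') (blat_of (UNIV :: 'a set)) g' \<and>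
    (\<forall>k<m'. \<forall>l<n'. \<alpha> k l < m \<and> \<beta> k l < n \<and> 0 < s k l) \<and>
    (\<forall>x. bnorm (linf_l1 m' n') (pull m' n' \<alpha> \<beta> s x) = bnorm (linf_l1 m n) x) \<and>
    (\<forall>i<m. \<forall>j<n. norm (g (unit_matrix i j) - g' (pull m' n' \<alpha> \<beta> s (unit_matrix i j))) \<le> \<epsilon>) \<and>
    (\<exists>c\<in>bcarrier (linf_l1 m' n'). norm (d - g' c) \<le> \<epsilon>)"
proof -
  have \<epsilon>2: "0 < \<epsilon> / 2" using \<epsilon> by simp
  obtain m' n' \<alpha> \<beta> s g' where m': "0 < m'" and n': "0 < n'"
    and g': "bl_embedding (linf_l1 m' n') (blat_of (UNIV :: 'a set)) g'"
    and range: "\<forall>k<m'. \<forall>l<n'. \<alpha> k l < m \<and> \<beta> k l < n \<and> 0 \<le> s k l"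
    and iso: "\<forall>x. bnorm (linf_l1 m' n') (pull m' n' \<alpha> \<beta> s x) = bnorm (linf_l1 m n) x"
    and close: "\<forall>i<m. \<forall>j<n. norm (g (unit_matrix i j) - g' (pull m' n' \<alpha> \<beta> s (unit_matrix i j))) \<le> \<epsilon> / 2"
    and dc: "\<exists>c\<in>bcarrier (linf_l1 m' n'). norm (d - g' c) \<le> \<epsilon> / 2"
    using extension_step[OF BL m n g \<epsilon>2, of d] by (elim exE conjE) (rule that)
  obtain \<alpha>' \<beta>' s' where range': "\<forall>k<m'. \<forall>l<n'. \<alpha>' k l < m \<and> \<beta>' k l < n \<and> 0 < s' k l"
    and iso': "\<forall>x. bnorm (linf_l1 m' n') (pull m' n' \<alpha>' \<beta>' s' x) = bnorm (linf_l1 m n) x"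
    and diff: "\<forall>i j. bnorm (linf_l1 m' n') (\<lambda>k l. pull m' n' \<alpha> \<beta> s (unit_matrix i j) k l - pull m' n' \<alpha>' \<beta>' s' (unit_matrix i j) k l) \<le> \<epsilon> / 2"
    using full_support[OF m n m' n' range iso \<epsilon>2] by (elim exE conjE) (rule that)
  have close': "norm (g (unit_matrix i j) - g' (pull m' n' \<alpha>' \<beta>' s' (unit_matrix i j))) \<le> \<epsilon>" if "i < m" "j < n" for i j
  proof -
    let ?u = "pull m' n' \<alpha> \<beta> s (unit_matrix i j)" and ?v = "pull m' n' \<alpha>' \<beta>' s' (unit_matrix i j)"
    have uv: "(\<lambda>k l. ?u k l - ?v k l) \<in> bcarrier (linf_l1 m' n')" by (auto simp: pull_def)
    have "norm (g' ?u - g' ?v) = bnorm (linf_l1 m' n') (\<lambda>k l. ?u k l - ?v k l)"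
      using embedding_diff[OF g' pull_mem pull_mem] embeddingD(1)[OF g' uv] by simp
    also have "\<dots> \<le> \<epsilon> / 2" using diff by blast
    finally have 1: "norm (g' ?u - g' ?v) \<le> \<epsilon> / 2" .
    have 2: "norm (g (unit_matrix i j) - g' ?u) \<le> \<epsilon> / 2" using close that by blast
    have "norm (g (unit_matrix i j) - g' ?v) \<le> norm (g (unit_matrix i j) - g' ?u) + norm (g' ?u - g' ?v)"
      using norm_triangle_ineq[of "g (unit_matrix i j) - g' ?u" "g' ?u - g' ?v"] by simp
    then show ?thesis using 1 2 by simp
  qed
  obtain c where c: "c \<in> bcarrier (linf_l1 m' n')" "norm (d - g' c) \<le> \<epsilon> / 2" using dc by (rule bexE)
  have dc': "\<exists>c\<in>bcarrier (linf_l1 m' n'). norm (d - g' c) \<le> \<epsilon>"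
    by (rule bexI[OF _ c(1)]) (use c(2) \<epsilon> in simp)
  show ?thesis
    by (intro exI[of _ m'] exI[of _ n'] exI[of _ \<alpha>'] exI[of _ \<beta>'] exI[of _ s'] exI[of _ g'] conjI
      m' n' g' range' iso' dc') (intro allI impI close')
qed

lemma geometric_limit:
  fixes a :: "nat \<Rightarrow> 'a::banach"
  assumes "\<And>j. norm (a (Suc j) - a j) \<le> C * (1 / 2) ^ j"
  shows "\<exists>l. a \<longlonglongrightarrow> l \<and> norm (l - a 0) \<le> 2 * C"
proof -
  let ?d = "\<lambda>j. a (Suc j) - a j"
  have g: "(\<lambda>j. C * (1 / 2) ^ j) sums (C * (1 / (1 - 1 / 2)))"
    by (intro sums_mult geometric_sums) simp
  have sd: "summable ?d" by (rule summable_comparison_test'[OF sums_summable[OF g], of 0]) (rule assms)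
  have "(\<lambda>n. \<Sum>j<n. ?d j) \<longlonglongrightarrow> suminf ?d" by (rule summable_LIMSEQ[OF sd])
  then have "(\<lambda>n. a n - a 0) \<longlonglongrightarrow> suminf ?d" by (simp add: sum_lessThan_telescope)
  then have "(\<lambda>n. (a n - a 0) + a 0) \<longlonglongrightarrow> suminf ?d + a 0" by (intro tendsto_add tendsto_const)
  moreover have "norm (suminf ?d) \<le> suminf (\<lambda>j. C * (1 / 2) ^ j)"
    by (rule norm_suminf_le[OF assms sums_summable[OF g]])
  ultimately show ?thesis using sums_unique[OF g] by (intro exI[of _ "suminf ?d + a 0"]) simp
qed

lemma range_embedding:
  fixes g :: "(nat \<Rightarrow> nat \<Rightarrow> real) \<Rightarrow> 'a::banach_lattice"
  assumes m: "0 < m" and g: "bl_embedding (linf_l1 m n) (blat_of UNIV) g"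
  shows "closed_sublattice (g ` bcarrier (linf_l1 m n))"
    "\<exists>f. lattice_isometry (blat_of (g ` bcarrier (linf_l1 m n))) (linf_l1 m n) f"
proof -
  let ?L = "linf_l1 m n"
  note gD = embeddingD[OF g]
  show "closed_sublattice (g ` bcarrier ?L)"
    unfolding closed_sublattice_def
  proof (intro conjI)
    show "subspace (g ` bcarrier ?L)"
      unfolding subspace_def
    proof (intro conjI ballI allI)
      show "0 \<in> g ` bcarrier ?L" using embedding_zero[OF g] by (intro image_eqI[of _ _ "\<lambda>_ _. 0"]) simp_all
    next
      fix x y assume "x \<in> g ` bcarrier ?L" "y \<in> g ` bcarrier ?L"
      then obtain c d where cd: "c \<in> bcarrier ?L" "x = g c" "d \<in> bcarrier ?L" "y = g d" by blast
      then show "x + y \<in> g ` bcarrier ?L"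
        using gD(3)[OF cd(1,3)] by (intro image_eqI[of _ _ "\<lambda>i j. c i j + d i j"]) auto
    next
      fix r x assume "x \<in> g ` bcarrier ?L"
      then obtain c where c: "c \<in> bcarrier ?L" "x = g c" by blast
      then show "r *\<^sub>R x \<in> g ` bcarrier ?L"
        using gD(2)[OF c(1)] by (intro image_eqI[of _ _ "\<lambda>i j. r * c i j"]) auto
    qed
    show "\<forall>x\<in>g ` bcarrier ?L. \<forall>y\<in>g ` bcarrier ?L. sup x y \<in> g ` bcarrier ?L \<and> inf x y \<in> g ` bcarrier ?L"
    proof (intro ballI)
      fix x y assume "x \<in> g ` bcarrier ?L" "y \<in> g ` bcarrier ?L"
      then obtain c d where cd: "c \<in> bcarrier ?L" "x = g c" "d \<in> bcarrier ?L" "y = g d" by blast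
      have "sup x y \<in> g ` bcarrier ?L"
        using gD(4)[OF cd(1,3)] cd by (intro image_eqI[of _ _ "\<lambda>i j. max (c i j) (d i j)"]) auto
      moreover have "inf x y \<in> g ` bcarrier ?L"
        using gD(5)[OF cd(1,3)] cd by (intro image_eqI[of _ _ "\<lambda>i j. min (c i j) (d i j)"]) auto
      ultimately show "sup x y \<in> g ` bcarrier ?L \<and> inf x y \<in> g ` bcarrier ?L" ..
    qed
    \<comment> \<open>The norm bounds every entry, so the preimages of a convergent sequence
      converge entrywise, and \<open>g\<close> is a finite sum over the entries.\<close>
    show "closed (g ` bcarrier ?L)"
      unfolding closed_sequential_limits
    proof (intro allI impI, elim conjE)
      fix X l assume X: "\<forall>r. X r \<in> g ` bcarrier ?L" and l: "X \<longlonglongrightarrow> l"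
      have "\<forall>r. \<exists>c. c \<in> bcarrier ?L \<and> X r = g c" using X by blast
      then obtain c where c: "\<And>r. c r \<in> bcarrier ?L" "\<And>r. X r = g (c r)" by metis
      have diff: "norm (X r - X r') = bnorm ?L (\<lambda>i j. c r i j - c r' i j)" for r r'
      proof -
        have "(\<lambda>i j. c r i j - c r' i j) \<in> bcarrier ?L" using c(1)[of r] c(1)[of r'] by simp
        then show ?thesis unfolding c(2) embedding_diff[OF g c(1) c(1), symmetric] by (rule gD(1))
      qed
      have "convergent (\<lambda>r. c r i j)" for i j
      proof (cases "i < m \<and> j < n")
        case True
        have "Cauchy (\<lambda>r. c r i j)"
        proof (rule metric_CauchyI)
          fix \<epsilon> :: real assume "0 < \<epsilon>"
          then obtain M where M: "\<And>r r'. r \<ge> M \<Longrightarrow> r' \<ge> M \<Longrightarrow> norm (X r - X r') < \<epsilon>"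
            using LIMSEQ_imp_Cauchy[OF l] unfolding Cauchy_iff by blast
          have "dist (c r i j) (c r' i j) < \<epsilon>" if "r \<ge> M" "r' \<ge> M" for r r'
          proof -
            have "\<bar>c r i j - c r' i j\<bar> \<le> norm (X r - X r')"
              unfolding diff using True by (intro linf_l1_entry_le[of i m j n "\<lambda>i j. c r i j - c r' i j"]) auto
            then show ?thesis using M[OF that] by (simp add: dist_real_def)
          qed
          then show "\<exists>M. \<forall>r\<ge>M. \<forall>r'\<ge>M. dist (c r i j) (c r' i j) < \<epsilon>" by blast
        qed
        then show ?thesis by (rule Cauchy_convergent)
      next
        case False
        then have "(\<lambda>r. c r i j) = (\<lambda>_. 0)" using c(1) by auto
        then show ?thesis by (simp add: convergent_const)
      qed
      then obtain c' where c': "\<And>i j. (\<lambda>r. c r i j) \<longlonglongrightarrow> c' i j" unfolding convergent_def by metis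
      have "c' \<in> bcarrier ?L"
      proof -
        have "c' i j = 0" if "\<not> (i < m \<and> j < n)" for i j
        proof -
          have "(\<lambda>r. c r i j) = (\<lambda>_. 0)" using c(1) that by auto
          then show ?thesis using c'[of i j] by (simp add: LIMSEQ_const_iff)
        qed
        then show ?thesis by simp
      qed
      moreover have "X \<longlonglongrightarrow> g c'"
        unfolding c(2)[abs_def] embedding_eq_sum[OF g c(1)] embedding_eq_sum[OF g \<open>c' \<in> bcarrier ?L\<close>]
        by (intro tendsto_intros c')
      ultimately show "l \<in> g ` bcarrier ?L" using LIMSEQ_unique[OF l] by blast
    qed
  qed
  have inj: "inj_on g (bcarrier ?L)"
  proof (rule inj_onI)
    fix c d assume cd: "c \<in> bcarrier ?L" "d \<in> bcarrier ?L" "g c = g d"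
    have "(\<lambda>i j. c i j - d i j) \<in> bcarrier ?L" using cd by simp
    from gD(1)[OF this] have z: "bnorm ?L (\<lambda>i j. c i j - d i j) = 0"
      using embedding_diff[OF g cd(1,2)] cd(3) by simp
    show "c = d"
    proof (intro ext)
      fix i j
      show "c i j = d i j"
      proof (cases "i < m \<and> j < n")
        case True
        then show ?thesis using linf_l1_entry_le[of i m j n "\<lambda>i j. c i j - d i j"] z by simp
      next
        case False
        then show ?thesis using cd by simp
      qed
    qed
  qed
  let ?f = "inv_into (bcarrier ?L) g"
  have f: "?f (g c) = c" if "c \<in> bcarrier ?L" for c by (rule inv_into_f_f[OF inj that])
  have "lattice_isometry (blat_of (g ` bcarrier ?L)) ?L ?f"
    unfolding lattice_isometry_def bl_embedding_def blat_of_simps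
  proof (intro conjI ballI allI)
    show "?f ` g ` bcarrier ?L = bcarrier ?L" by (rule inv_into_image_cancel[OF inj order_refl])
    fix x and r :: real assume "x \<in> g ` bcarrier ?L"
    then obtain c where c: "c \<in> bcarrier ?L" "x = g c" by blast
    show "?f x \<in> bcarrier ?L" "bnorm ?L (?f x) = norm x" unfolding c(2) f[OF c(1)] using c(1) gD(1) by auto
    have mem: "(\<lambda>i j. r * c i j) \<in> bcarrier ?L" using c(1) by simp
    show "?f (r *\<^sub>R x) = bscale ?L r (?f x)" unfolding c(2) f[OF c(1)] gD(2)[OF c(1), symmetric] f[OF mem] by simp
    fix y assume "y \<in> g ` bcarrier ?L"
    then obtain d where d: "d \<in> bcarrier ?L" "y = g d" by blast
    have mem: "(\<lambda>i j. c i j + d i j) \<in> bcarrier ?L" "(\<lambda>i j. max (c i j) (d i j)) \<in> bcarrier ?L"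
      "(\<lambda>i j. min (c i j) (d i j)) \<in> bcarrier ?L" using c(1) d(1) by auto
    show "?f (x + y) = badd ?L (?f x) (?f y)"
      unfolding c(2) d(2) f[OF c(1)] f[OF d(1)] gD(3)[OF c(1) d(1), symmetric] f[OF mem(1)] by simp
    show "?f (sup x y) = bsup ?L (?f x) (?f y)"
      unfolding c(2) d(2) f[OF c(1)] f[OF d(1)] gD(4)[OF c(1) d(1), symmetric] f[OF mem(2)] by simp
    show "?f (inf x y) = binf ?L (?f x) (?f y)"
      unfolding c(2) d(2) f[OF c(1)] f[OF d(1)] gD(5)[OF c(1) d(1), symmetric] f[OF mem(3)] by simp
  qed
  then show "\<exists>f. lattice_isometry (blat_of (g ` bcarrier ?L)) ?L f" by blast
qed

text \<open>Starts the tower. The zero ideal is amalgamated with the one-dimensional lattice over a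
  single point; the ideal weight there is 0, so no real homomorphism is demanded.\<close>

lemma exists_line:
  assumes BL: "is_BL TYPE('a::banach_lattice)"
  shows "\<exists>g. bl_embedding (linf_l1 1 1) (blat_of (UNIV :: 'a set)) g"
proof -
  have z: "x = 0" if "x \<in> principal_ideal (0 :: 'a)" for x using that by (auto simp: principal_ideal_def)
  interpret amalgam "0 :: 'a" 1 1 "\<lambda>_ :: unit. 0" "\<lambda>_ _. 0" "\<lambda>_. 1" "\<lambda>_. 0" "\<lambda>_. 0"
  proof
    fix v :: 'a and c d :: "nat \<Rightarrow> nat \<Rightarrow> real"
    assume d: "\<And>i j. 0 \<le> d i j" and le: "\<And>s :: unit. 1 * d 0 0 \<le> 0 * (0 :: real) + 1 * c 0 0"
    have "\<bar>d 0 0\<bar> \<le> \<bar>c 0 0\<bar>" using d[of 0 0] le by simp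
    then have "bnorm (linf_l1 1 1) d \<le> bnorm (linf_l1 1 1) c" by (intro linf_l1_norm_mono) auto
    then show "bnorm (linf_l1 1 1) d \<le> norm v + bnorm (linf_l1 1 1) c" by (rule add_increasing[OF norm_ge_zero])
  qed (auto simp: linf_l1_norm_nonneg dest!: z)
  show ?thesis using embed_in_BL[OF BL, of "[]" 1] by auto
qed

section \<open>The limit of a tower of matrix lattices\<close>

lemma pull_add: "pull m n \<alpha> \<beta> s (\<lambda>i j. x i j + y i j) = (\<lambda>i j. pull m n \<alpha> \<beta> s x i j + pull m n \<alpha> \<beta> s y i j)"
  by (auto simp: pull_def fun_eq_iff algebra_simps)

lemma pull_scale: "pull m n \<alpha> \<beta> s (\<lambda>i j. r * x i j) = (\<lambda>i j. r * pull m n \<alpha> \<beta> s x i j)"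
  by (auto simp: pull_def fun_eq_iff algebra_simps)

lemma pull_max:
  assumes "\<And>k l. k < m \<Longrightarrow> l < n \<Longrightarrow> 0 \<le> s k l"
  shows "pull m n \<alpha> \<beta> s (\<lambda>i j. max (x i j) (y i j)) = (\<lambda>i j. max (pull m n \<alpha> \<beta> s x i j) (pull m n \<alpha> \<beta> s y i j))"
  using assms by (auto simp: pull_def fun_eq_iff max_mult_distrib_left not_le dest: leD)

lemma pull_min:
  assumes "\<And>k l. k < m \<Longrightarrow> l < n \<Longrightarrow> 0 \<le> s k l"
  shows "pull m n \<alpha> \<beta> s (\<lambda>i j. min (x i j) (y i j)) = (\<lambda>i j. min (pull m n \<alpha> \<beta> s x i j) (pull m n \<alpha> \<beta> s y i j))"
  using assms by (auto simp: pull_def fun_eq_iff min_mult_distrib_left not_le dest: leD)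

lemma pair_index_less: "i < m \<Longrightarrow> j < n \<Longrightarrow> i * n + j < m * (n :: nat)"
proof -
  assume "i < m" "j < n"
  then have "i * n + j < Suc i * n" by simp
  also have "\<dots> \<le> m * n" using \<open>i < m\<close> by (intro mult_le_mono1) simp
  finally show ?thesis .
qed

lemma sum_pair_index:
  fixes n :: nat
  assumes "0 < n"
  shows "(\<Sum>q\<in>{..<m} \<times> {..<n}. f q) = (\<Sum>b<m * n. f (b div n, b mod n))"
  by (rule sum.reindex_bij_witness[of _ "\<lambda>b. (b div n, b mod n)" "\<lambda>(i, j). i * n + j"])
    (use assms in \<open>auto simp: pair_index_less less_mult_imp_div_less\<close>)

text \<open>The inclusions are exact isometries, while the embeddings \<open>g k\<close> commute
  with them only up to \<open>(1 / 2) ^ k\<close>. The sequence \<open>d\<close> comes near every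
  point at arbitrarily late stages, where these errors are negligible.\<close>

locale tower =
  fixes M N :: "nat \<Rightarrow> nat" and \<alpha> \<beta> :: "nat \<Rightarrow> nat \<Rightarrow> nat \<Rightarrow> nat" and s :: "nat \<Rightarrow> nat \<Rightarrow> nat \<Rightarrow> real"
    and g :: "nat \<Rightarrow> (nat \<Rightarrow> nat \<Rightarrow> real) \<Rightarrow> 'a::banach_lattice" and d :: "nat \<Rightarrow> 'a"
  assumes M_pos: "0 < M k" and N_pos: "0 < N k"
    and emb: "bl_embedding (linf_l1 (M k) (N k)) (blat_of UNIV) (g k)"
    and range: "i < M (Suc k) \<Longrightarrow> j < N (Suc k) \<Longrightarrow> \<alpha> k i j < M k \<and> \<beta> k i j < N k \<and> 0 < s k i j"
    and iso: "bnorm (linf_l1 (M (Suc k)) (N (Suc k))) (pull (M (Suc k)) (N (Suc k)) (\<alpha> k) (\<beta> k) (s k) x)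
        = bnorm (linf_l1 (M k) (N k)) x"
    and close: "x \<in> bcarrier (linf_l1 (M k) (N k)) \<Longrightarrow>
       norm (g k x - g (Suc k) (pull (M (Suc k)) (N (Suc k)) (\<alpha> k) (\<beta> k) (s k) x))
       \<le> (1 / 2) ^ k * bnorm (linf_l1 (M k) (N k)) x"
    and hit: "\<exists>c\<in>bcarrier (linf_l1 (M (Suc k)) (N (Suc k))). norm (d k - g (Suc k) c) \<le> (1 / 2) ^ k"
    and dense: "0 < \<epsilon> \<Longrightarrow> \<exists>k\<ge>K. norm (y - d k) < \<epsilon>"
begin

abbreviation "L k \<equiv> linf_l1 (M k) (N k)"
abbreviation "inc k \<equiv> pull (M (Suc k)) (N (Suc k)) (\<alpha> k) (\<beta> k) (s k)"

fun iter :: "nat \<Rightarrow> nat \<Rightarrow> (nat \<Rightarrow> nat \<Rightarrow> real) \<Rightarrow> nat \<Rightarrow> nat \<Rightarrow> real" where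
  "iter k 0 x = x"
| "iter k (Suc j) x = inc (k + j) (iter k j x)"

lemma s_nonneg: "i < M (Suc k) \<Longrightarrow> j < N (Suc k) \<Longrightarrow> 0 \<le> s k i j"
  using range[of i k j] by simp

lemma iter_mem: "x \<in> bcarrier (L k) \<Longrightarrow> iter k j x \<in> bcarrier (L (k + j))"
  by (cases j) (simp_all add: pull_mem del: linf_l1_simps)

lemma iter_norm: "bnorm (L (k + j)) (iter k j x) = bnorm (L k) x"
proof (induction j)
  case (Suc j)
  then show ?case using iso[of "k + j" "iter k j x"] by simp
qed simp

lemma iter_hom:
  "iter k j (\<lambda>a b. x a b + y a b) = (\<lambda>a b. iter k j x a b + iter k j y a b)"
  "iter k j (\<lambda>a b. r * x a b) = (\<lambda>a b. r * iter k j x a b)"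
  "iter k j (\<lambda>a b. max (x a b) (y a b)) = (\<lambda>a b. max (iter k j x a b) (iter k j y a b))"
  "iter k j (\<lambda>a b. min (x a b) (y a b)) = (\<lambda>a b. min (iter k j x a b) (iter k j y a b))"
proof (induction j)
  case (Suc j)
  show "iter k (Suc j) (\<lambda>a b. x a b + y a b) = (\<lambda>a b. iter k (Suc j) x a b + iter k (Suc j) y a b)"
    using Suc(1) by (simp add: pull_add)
  show "iter k (Suc j) (\<lambda>a b. r * x a b) = (\<lambda>a b. r * iter k (Suc j) x a b)"
    using Suc(2) by (simp add: pull_scale)
  show "iter k (Suc j) (\<lambda>a b. max (x a b) (y a b)) = (\<lambda>a b. max (iter k (Suc j) x a b) (iter k (Suc j) y a b))"
    using Suc(3) pull_max[OF s_nonneg] by simp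
  show "iter k (Suc j) (\<lambda>a b. min (x a b) (y a b)) = (\<lambda>a b. min (iter k (Suc j) x a b) (iter k (Suc j) y a b))"
    using Suc(4) pull_min[OF s_nonneg] by simp
qed simp_all

lemma iter_inc: "iter (Suc k) j (inc k x) = iter k (Suc j) x"
  by (induction j) simp_all

text \<open>The errors along the tower are summable, so the limit exists. Norm and lattice
  operations are continuous, hence the limits are embeddings, and they commute with the inclusions
  exactly.\<close>

definition h :: "nat \<Rightarrow> (nat \<Rightarrow> nat \<Rightarrow> real) \<Rightarrow> 'a" where
  "h k x = lim (\<lambda>j. g (k + j) (iter k j x))"

lemma h_lim:
  assumes "x \<in> bcarrier (L k)"
  shows "(\<lambda>j. g (k + j) (iter k j x)) \<longlonglongrightarrow> h k x" "norm (h k x - g k x) \<le> 2 * ((1 / 2) ^ k * bnorm (L k) x)"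
proof -
  let ?a = "\<lambda>j. g (k + j) (iter k j x)"
  have "norm (?a (Suc j) - ?a j) \<le> ((1 / 2) ^ k * bnorm (L k) x) * (1 / 2) ^ j" for j
    using close[OF iter_mem[OF assms], of j] unfolding iter_norm
    by (simp add: norm_minus_commute power_add mult_ac)
  from geometric_limit[of ?a, OF this] obtain l where l: "?a \<longlonglongrightarrow> l" "norm (l - ?a 0) \<le> 2 * ((1 / 2) ^ k * bnorm (L k) x)"
    by blast
  have "h k x = l" unfolding h_def by (rule limI[OF l(1)])
  then show "?a \<longlonglongrightarrow> h k x" "norm (h k x - g k x) \<le> 2 * ((1 / 2) ^ k * bnorm (L k) x)" using l by simp_all
qed

lemma h_inc:
  assumes "x \<in> bcarrier (L k)"
  shows "h (Suc k) (inc k x) = h k x"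
proof -
  have "(\<lambda>j. g (Suc k + j) (iter (Suc k) j (inc k x))) \<longlonglongrightarrow> h (Suc k) (inc k x)" by (rule h_lim(1)[OF pull_mem])
  moreover have "(\<lambda>j. g (Suc k + j) (iter (Suc k) j (inc k x))) \<longlonglongrightarrow> h k x"
    unfolding iter_inc using LIMSEQ_Suc[OF h_lim(1)[OF assms]] by simp
  ultimately show ?thesis by (rule LIMSEQ_unique)
qed

lemma h_emb: "bl_embedding (L k) (blat_of UNIV) (h k)"
  unfolding bl_embedding_def blat_of_simps
proof (intro conjI ballI allI)
  fix x and r :: real assume x: "x \<in> bcarrier (L k)"
  note gD = embeddingD[OF emb]
  note X = iter_mem[OF x]
  have "(\<lambda>j. norm (g (k + j) (iter k j x))) \<longlonglongrightarrow> norm (h k x)" by (intro tendsto_norm h_lim(1) x)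
  then show "norm (h k x) = bnorm (L k) x"
    unfolding gD(1)[OF X] iter_norm by (simp add: LIMSEQ_const_iff)
  have mem: "(\<lambda>i j. r * x i j) \<in> bcarrier (L k)" using x by simp
  have "(\<lambda>j. g (k + j) (iter k j (\<lambda>i j. r * x i j))) \<longlonglongrightarrow> r *\<^sub>R h k x"
    unfolding iter_hom gD(2)[OF X] by (intro tendsto_intros h_lim(1) x)
  from LIMSEQ_unique[OF h_lim(1)[OF mem] this] show "h k (bscale (L k) r x) = r *\<^sub>R h k x" by simp
  fix y assume y: "y \<in> bcarrier (L k)"
  note Y = iter_mem[OF y]
  have mem: "(\<lambda>i j. x i j + y i j) \<in> bcarrier (L k)" "(\<lambda>i j. max (x i j) (y i j)) \<in> bcarrier (L k)"
    "(\<lambda>i j. min (x i j) (y i j)) \<in> bcarrier (L k)" using x y by auto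
  have "(\<lambda>j. g (k + j) (iter k j (\<lambda>i j. x i j + y i j))) \<longlonglongrightarrow> h k x + h k y"
    unfolding iter_hom gD(3)[OF X Y] by (intro tendsto_intros h_lim(1) x y)
  from LIMSEQ_unique[OF h_lim(1)[OF mem(1)] this] show "h k (badd (L k) x y) = h k x + h k y" by simp
  have "(\<lambda>j. g (k + j) (iter k j (\<lambda>i j. max (x i j) (y i j)))) \<longlonglongrightarrow> sup (h k x) (h k y)"
    unfolding iter_hom gD(4)[OF X Y] by (intro tendsto_sup_lattice h_lim(1) x y)
  from LIMSEQ_unique[OF h_lim(1)[OF mem(2)] this] show "h k (bsup (L k) x y) = sup (h k x) (h k y)" by simp
  have "(\<lambda>j. g (k + j) (iter k j (\<lambda>i j. min (x i j) (y i j)))) \<longlonglongrightarrow> inf (h k x) (h k y)"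
    unfolding iter_hom gD(5)[OF X Y] by (intro tendsto_inf_lattice h_lim(1) x y)
  from LIMSEQ_unique[OF h_lim(1)[OF mem(3)] this] show "h k (binf (L k) x y) = inf (h k x) (h k y)" by simp
qed simp

definition layer :: "nat \<Rightarrow> 'a set" where "layer k = h k ` bcarrier (L k)"

lemma layer_mono: "layer k \<subseteq> layer (Suc k)"
  unfolding layer_def using h_inc pull_mem by (metis (no_types, lifting) image_eqI image_subsetI)

text \<open>At a late stage \<open>d k\<close> is near \<open>y\<close> and
  \<open>g (Suc k) c\<close> is near \<open>d k\<close>; moreover \<open>h\<close> differs from
  \<open>g\<close> at \<open>c\<close> by at most \<open>(1 / 2) ^ k\<close> times the norm of
  \<open>c\<close>, which is bounded in terms of \<open>y\<close>.\<close>

lemma closure_layers: "closure (\<Union>k. layer k) = UNIV"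
proof -
  have "\<exists>z\<in>(\<Union>k. layer k). dist z y < \<epsilon>" if \<epsilon>: "0 < \<epsilon>" for y \<epsilon>
  proof -
    \<comment> \<open>Bounds the norm of \<open>c\<close>: the distances from \<open>y\<close> to
      \<open>d k\<close> and from there to \<open>g (Suc k) c\<close> are at most 1 each.\<close>
    define B where "B = norm y + 3"
    have B: "0 < B" by (simp add: B_def add_nonneg_pos)
    obtain K where K: "(1 / 2 :: real) ^ K < min 1 (\<epsilon> / (2 * (B + 1)))"
      using real_arch_pow_inv[of "min 1 (\<epsilon> / (2 * (B + 1)))" "1 / 2"] \<epsilon> B by auto
    obtain k where k: "k \<ge> K" "norm (y - d k) < min 1 (\<epsilon> / 2)" using dense[of "min 1 (\<epsilon> / 2)" K y] \<epsilon> by auto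
    have small: "(1 / 2 :: real) ^ k < min 1 (\<epsilon> / (2 * (B + 1)))"
      by (rule le_less_trans[OF power_decreasing[OF k(1)] K]) simp_all
    obtain c where c: "c \<in> bcarrier (L (Suc k))" "norm (d k - g (Suc k) c) \<le> (1 / 2) ^ k" using hit by blast
    have "bnorm (L (Suc k)) c = norm (g (Suc k) c)" by (rule embeddingD(1)[OF emb c(1), symmetric])
    also have "\<dots> \<le> norm y + norm (y - d k) + norm (d k - g (Suc k) c)"
      using norm_triangle_ineq4[of y "(y - d k) + (d k - g (Suc k) c)"]
        norm_triangle_ineq[of "y - d k" "d k - g (Suc k) c"] by simp
    also have "\<dots> \<le> B" using k(2) c(2) small by (simp add: B_def)
    finally have cB: "bnorm (L (Suc k)) c \<le> B" .
    have "norm (h (Suc k) c - g (Suc k) c) \<le> 2 * ((1 / 2) ^ Suc k * bnorm (L (Suc k)) c)" by (rule h_lim(2)[OF c(1)])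
    also have "\<dots> = (1 / 2) ^ k * bnorm (L (Suc k)) c" by simp
    also have "\<dots> \<le> (1 / 2) ^ k * B" using cB by (intro mult_left_mono) auto
    finally have 1: "norm (h (Suc k) c - g (Suc k) c) \<le> (1 / 2) ^ k * B" .
    have eq: "h (Suc k) c - y = (h (Suc k) c - g (Suc k) c) - ((y - d k) + (d k - g (Suc k) c))" by simp
    have "norm (h (Suc k) c - y) \<le> norm (h (Suc k) c - g (Suc k) c) + norm ((y - d k) + (d k - g (Suc k) c))"
      by (subst eq) (rule norm_triangle_ineq4)
    also have "\<dots> \<le> norm (h (Suc k) c - g (Suc k) c) + (norm (y - d k) + norm (d k - g (Suc k) c))"
      by (intro add_left_mono norm_triangle_ineq)
    also have "\<dots> < (1 / 2) ^ k * B + (\<epsilon> / 2 + (1 / 2) ^ k)" using 1 k(2) c(2) by simp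
    also have "\<dots> = (1 / 2) ^ k * (B + 1) + \<epsilon> / 2" by (simp add: algebra_simps)
    also have "\<dots> \<le> \<epsilon> / (2 * (B + 1)) * (B + 1) + \<epsilon> / 2"
      using small B by (intro add_right_mono mult_right_mono) auto
    also have "\<dots> = \<epsilon>" using B by (simp add: field_simps)
    finally have "dist (h (Suc k) c) y < \<epsilon>" by (simp add: dist_norm)
    moreover have "h (Suc k) c \<in> (\<Union>k. layer k)" using c(1) unfolding layer_def by blast
    ultimately show ?thesis by blast
  qed
  then show ?thesis by (auto simp: closure_approachable)
qed

section \<open>The branching tree\<close>

definition atom :: "nat \<Rightarrow> nat \<Rightarrow> 'a" where
  "atom k b = h k (unit_matrix (b div N k) (b mod N k))"

text \<open>Positions are numbered row by row. Each entry of a \<open>pull\<close> is a multiple of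
  one entry, so an atom at level \<open>k + 1\<close> occurs in the splitting of just one atom at
  level \<open>k\<close>.\<close>

definition parent :: "nat \<Rightarrow> nat \<Rightarrow> nat" where
  "parent k b = \<alpha> k (b div N (Suc k)) (b mod N (Suc k)) * N k + \<beta> k (b div N (Suc k)) (b mod N (Suc k))"

definition weight :: "nat \<Rightarrow> nat \<Rightarrow> nat \<Rightarrow> real" where
  "weight k a b = (if parent k b = a then s k (b div N (Suc k)) (b mod N (Suc k)) else 0)"

lemma index: "b < M k * N k \<Longrightarrow> b div N k < M k" "b mod N k < N k"
  using N_pos by (auto simp: less_mult_imp_div_less)

lemma parent_less: "b < M (Suc k) * N (Suc k) \<Longrightarrow> parent k b < M k * N k"
  unfolding parent_def using range[OF index] by (intro pair_index_less) blast+

lemma weight_pos: "b < M (Suc k) * N (Suc k) \<Longrightarrow> 0 < weight k (parent k b) b"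
  unfolding weight_def using range[OF index] by simp

lemma weight_nonneg: "b < M (Suc k) * N (Suc k) \<Longrightarrow> 0 \<le> weight k a b"
  unfolding weight_def using range[OF index, of b] by (simp add: less_imp_le)

lemma unit_mem: "b < M k * N k \<Longrightarrow> unit_matrix (b div N k) (b mod N k) \<in> bcarrier (L k)"
  by (intro unit_matrix_mem index)

lemma atom_nonneg: "b < M k * N k \<Longrightarrow> 0 \<le> atom k b"
  unfolding atom_def by (rule embedding_nonneg[OF h_emb unit_mem]) (simp_all add: unit_matrix_def)

lemma atom_disjoint:
  assumes "b < M k * N k" "c < M k * N k" "b \<noteq> c"
  shows "inf (atom k b) (atom k c) = 0"
proof -
  have "b div N k \<noteq> c div N k \<or> b mod N k \<noteq> c mod N k" using assms(3) by (metis div_mult_mod_eq)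
  then have "(\<lambda>i j. min (unit_matrix (b div N k) (b mod N k) i j) (unit_matrix (c div N k) (c mod N k) i j)) = (\<lambda>_ _. 0)"
    by (auto simp: unit_matrix_def fun_eq_iff)
  then show ?thesis
    unfolding atom_def embeddingD(5)[OF h_emb unit_mem[OF assms(1)] unit_mem[OF assms(2)], symmetric]
    using embedding_zero[OF h_emb] by simp
qed

lemma h_eq_atoms:
  assumes "c \<in> bcarrier (L k)"
  shows "h k c = (\<Sum>b<M k * N k. c (b div N k) (b mod N k) *\<^sub>R atom k b)"
  unfolding embedding_eq_sum[OF h_emb assms] sum_pair_index[OF N_pos] atom_def by simp

lemma atom_split:
  assumes a: "a < M k * N k"
  shows "atom k a = (\<Sum>b<M (Suc k) * N (Suc k). weight k a b *\<^sub>R atom (Suc k) b)"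
proof -
  let ?u = "unit_matrix (a div N k) (a mod N k)"
  have "atom k a = h (Suc k) (inc k ?u)" unfolding atom_def by (rule h_inc[OF unit_mem[OF a], symmetric])
  also have "\<dots> = (\<Sum>b<M (Suc k) * N (Suc k). inc k ?u (b div N (Suc k)) (b mod N (Suc k)) *\<^sub>R atom (Suc k) b)"
    by (rule h_eq_atoms[OF pull_mem])
  also have "\<dots> = (\<Sum>b<M (Suc k) * N (Suc k). weight k a b *\<^sub>R atom (Suc k) b)"
  proof (rule sum.cong[OF refl])
    fix b assume "b \<in> {..<M (Suc k) * N (Suc k)}"
    then have b: "b < M (Suc k) * N (Suc k)" by simp
    let ?i = "b div N (Suc k)" and ?j = "b mod N (Suc k)"
    have r: "\<alpha> k ?i ?j < M k" "\<beta> k ?i ?j < N k" using range[OF index(1)[OF b] index(2)] by auto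
    have "parent k b = a \<longleftrightarrow> \<alpha> k ?i ?j = a div N k \<and> \<beta> k ?i ?j = a mod N k"
      unfolding parent_def using r(2) by (auto simp: div_mult_mod_eq)
    then have "inc k ?u ?i ?j = weight k a b"
      using index(1)[OF b] index(2)[of b "Suc k"] by (simp add: pull_def weight_def unit_matrix_def)
    then show "inc k ?u ?i ?j *\<^sub>R atom (Suc k) b = weight k a b *\<^sub>R atom (Suc k) b" by simp
  qed
  finally show ?thesis .
qed

abbreviation "branches k \<equiv> {..<M k * N k}"

text \<open>The product over consecutive letters vanishes as soon as one step of the word does not
  lead from a parent to its child.\<close>

definition path_weight :: "nat list \<Rightarrow> real" where
  "path_weight \<sigma> = (\<Prod>i<length \<sigma> - 1. weight i (\<sigma> ! i) (\<sigma> ! Suc i))"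

text \<open>
  The nodes at level \<open>k + 1\<close> are indexed by all words, but only those following the parent relation
  are non-zero.
\<close>

definition node :: "nat list \<Rightarrow> 'a" where
  "node \<sigma> = (if \<sigma> = [] then \<Sum>b\<in>branches 0. atom 0 b
     else path_weight \<sigma> *\<^sub>R atom (length \<sigma> - 1) (last \<sigma>))"

lemma path_weight_single [simp]: "path_weight [b] = 1"
  by (simp add: path_weight_def)

lemma path_weight_snoc:
  assumes "\<sigma> \<noteq> []"
  shows "path_weight (\<sigma> @ [b]) = path_weight \<sigma> * weight (length \<sigma> - 1) (last \<sigma>) b"
proof -
  obtain k where k: "length \<sigma> = Suc k" using assms by (cases \<sigma>) auto
  have "path_weight (\<sigma> @ [b]) = (\<Prod>i<k. weight i (\<sigma> ! i) (\<sigma> ! Suc i)) * weight k (\<sigma> ! k) b"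
    unfolding path_weight_def by (simp add: k nth_append)
  then show ?thesis using assms k by (simp add: path_weight_def last_conv_nth)
qed

lemma tree_level_snoc:
  "\<sigma> @ [b] \<in> tree_level A (Suc k) \<longleftrightarrow> \<sigma> \<in> tree_level A k \<and> b \<in> A k"
proof (cases "length \<sigma> = k")
  case True
  then show ?thesis by (auto simp: tree_level_def nth_append less_Suc_eq)
qed (simp add: tree_level_def)

lemma tree_level_SucE:
  assumes "\<sigma> \<in> tree_level A (Suc k)"
  obtains \<tau> b where "\<sigma> = \<tau> @ [b]" "\<tau> \<in> tree_level A k" "b \<in> A k"
proof -
  have "\<sigma> \<noteq> []" using assms by (auto simp: tree_level_def)
  then obtain \<tau> b where "\<sigma> = \<tau> @ [b]" by (metis append_butlast_last_id)
  then show ?thesis using assms that tree_level_snoc by metis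
qed

lemma last_tree_level: "\<sigma> \<in> tree_level branches (Suc k) \<Longrightarrow> last \<sigma> < M k * N k"
  by (elim tree_level_SucE) simp

lemma length_tree_level: "\<sigma> \<in> tree_level A k \<Longrightarrow> length \<sigma> = k"
  by (simp add: tree_level_def)

lemma node_Suc:
  "\<sigma> \<in> tree_level branches (Suc k) \<Longrightarrow> node \<sigma> = path_weight \<sigma> *\<^sub>R atom k (last \<sigma>)"
  by (auto simp: node_def dest: length_tree_level)

lemma path_weight_nonneg: "\<sigma> \<in> tree_level branches (Suc k) \<Longrightarrow> 0 \<le> path_weight \<sigma>"
proof (induction k arbitrary: \<sigma>)
  case 0
  then show ?case by (auto simp: tree_level_def length_Suc_conv)
next
  case (Suc k)
  obtain \<tau> b where \<sigma>: "\<sigma> = \<tau> @ [b]" and \<tau>: "\<tau> \<in> tree_level branches (Suc k)" and b: "b < M (Suc k) * N (Suc k)"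
    using Suc.prems by (auto elim: tree_level_SucE)
  have len: "length \<tau> = Suc k" by (rule length_tree_level[OF \<tau>])
  then have "\<tau> \<noteq> []" by auto
  then show ?case
    unfolding \<sigma> path_weight_snoc[OF \<open>\<tau> \<noteq> []\<close>] len using Suc.IH[OF \<tau>] weight_nonneg[OF b] by simp
qed

text \<open>A branch has one parent, so a path of non-zero weight can be traced back from its end.
  Hence of two different words ending in the same atom one gives the node 0, as disjointness
  requires.\<close>

lemma path_unique:
  assumes "\<sigma> \<in> tree_level branches (Suc k)" "\<tau> \<in> tree_level branches (Suc k)" "last \<sigma> = last \<tau>"
    "path_weight \<sigma> \<noteq> 0" "path_weight \<tau> \<noteq> 0"
  shows "\<sigma> = \<tau>"
  using assms
proof (induction k arbitrary: \<sigma> \<tau>)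
  case 0
  then show ?case by (auto simp: tree_level_def length_Suc_conv)
next
  case (Suc k)
  obtain \<sigma>' b where \<sigma>: "\<sigma> = \<sigma>' @ [b]" and \<sigma>': "\<sigma>' \<in> tree_level branches (Suc k)"
    using Suc.prems(1) by (auto elim: tree_level_SucE)
  obtain \<tau>' c where \<tau>: "\<tau> = \<tau>' @ [c]" and \<tau>': "\<tau>' \<in> tree_level branches (Suc k)"
    using Suc.prems(2) by (auto elim: tree_level_SucE)
  have ne: "\<sigma>' \<noteq> []" "\<tau>' \<noteq> []" using \<sigma>' \<tau>' by (auto simp: tree_level_def)
  have bc: "b = c" using Suc.prems(3) by (simp add: \<sigma> \<tau>)
  have "path_weight \<sigma>' \<noteq> 0" "weight k (last \<sigma>') b \<noteq> 0" "path_weight \<tau>' \<noteq> 0" "weight k (last \<tau>') c \<noteq> 0"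
    using Suc.prems(4,5) length_tree_level[OF \<sigma>'] length_tree_level[OF \<tau>']
    by (simp_all add: \<sigma> \<tau> path_weight_snoc ne)
  moreover from this have "last \<sigma>' = last \<tau>'" by (simp add: weight_def bc split: if_splits)
  ultimately have "\<sigma>' = \<tau>'" using Suc.IH[OF \<sigma>' \<tau>'] by blast
  then show ?case by (simp add: \<sigma> \<tau> bc)
qed

text \<open>The strict positivity of the inclusion weights enters here. It makes every atom a
  multiple of some node, so that the nodes span all layers.\<close>

lemma path_exists:
  assumes "b < M k * N k"
  shows "\<exists>\<sigma>\<in>tree_level branches (Suc k). last \<sigma> = b \<and> path_weight \<sigma> \<noteq> 0"
  using assms
proof (induction k arbitrary: b)
  case 0
  then show ?case by (intro bexI[of _ "[b]"]) (auto simp: tree_level_def)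
next
  case (Suc k)
  obtain \<sigma> where \<sigma>: "\<sigma> \<in> tree_level branches (Suc k)" "last \<sigma> = parent k b" "path_weight \<sigma> \<noteq> 0"
    using Suc.IH[OF parent_less[OF Suc.prems]] by blast
  have ne: "\<sigma> \<noteq> []" using \<sigma>(1) by (auto simp: tree_level_def)
  have "path_weight (\<sigma> @ [b]) \<noteq> 0"
    using weight_pos[OF Suc.prems] \<sigma>(2,3) length_tree_level[OF \<sigma>(1)] by (simp add: path_weight_snoc[OF ne])
  moreover have "\<sigma> @ [b] \<in> tree_level branches (Suc (Suc k))" using \<sigma>(1) Suc.prems by (simp add: tree_level_snoc)
  ultimately show ?case by (intro bexI[of _ "\<sigma> @ [b]"]) simp_all
qed

lemma node_nonneg: "\<sigma> \<in> tree_level branches k \<Longrightarrow> 0 \<le> node \<sigma>"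
proof (cases k)
  case 0
  assume "\<sigma> \<in> tree_level branches k"
  then have "\<sigma> = []" using 0 by (simp add: tree_level_def)
  then show ?thesis by (auto simp: node_def intro!: sum_nonneg atom_nonneg)
next
  case (Suc k')
  assume "\<sigma> \<in> tree_level branches k"
  then have \<sigma>: "\<sigma> \<in> tree_level branches (Suc k')" using Suc by simp
  show ?thesis
    unfolding node_Suc[OF \<sigma>] by (intro scaleR_nonneg_nonneg path_weight_nonneg[OF \<sigma>] atom_nonneg last_tree_level[OF \<sigma>])
qed

lemma node_disjoint:
  assumes \<sigma>: "\<sigma> \<in> tree_level branches (Suc k)" and \<tau>: "\<tau> \<in> tree_level branches (Suc k)" and "\<sigma> \<noteq> \<tau>"
  shows "inf \<bar>node \<sigma>\<bar> \<bar>node \<tau>\<bar> = 0"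
proof -
  note pos = node_nonneg[OF \<sigma>] node_nonneg[OF \<tau>]
  note l = last_tree_level[OF \<sigma>] last_tree_level[OF \<tau>]
  have "inf (node \<sigma>) (node \<tau>) = 0"
  proof (cases "path_weight \<sigma> = 0 \<or> path_weight \<tau> = 0")
    case True
    then have "node \<sigma> = 0 \<or> node \<tau> = 0" by (auto simp: node_Suc[OF \<sigma>] node_Suc[OF \<tau>])
    then show ?thesis using pos by (auto simp: inf_absorb1 inf_absorb2)
  next
    case False
    then have "last \<sigma> \<noteq> last \<tau>" using path_unique[OF \<sigma> \<tau>] \<open>\<sigma> \<noteq> \<tau>\<close> by blast
    then have "inf (atom k (last \<sigma>)) (atom k (last \<tau>)) = 0" by (rule atom_disjoint[OF l])
    then have "inf (atom k (last \<sigma>)) (path_weight \<tau> *\<^sub>R atom k (last \<tau>)) = 0"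
      by (intro inf_scaleR_eq_0 atom_nonneg l path_weight_nonneg[OF \<tau>])
    then have "inf (node \<tau>) (atom k (last \<sigma>)) = 0" by (simp add: node_Suc[OF \<tau>] inf_commute)
    then have "inf (node \<tau>) (path_weight \<sigma> *\<^sub>R atom k (last \<sigma>)) = 0"
      by (intro inf_scaleR_eq_0 atom_nonneg l path_weight_nonneg[OF \<sigma>] pos)
    then show ?thesis by (simp add: node_Suc[OF \<sigma>] inf_commute)
  qed
  then show ?thesis using pos by simp
qed

lemma node_split:
  assumes \<sigma>: "\<sigma> \<in> tree_level branches k"
  shows "node \<sigma> = (\<Sum>b\<in>branches k. node (\<sigma> @ [b]))"
proof (cases k)
  case 0
  then have "\<sigma> = []" using \<sigma> by (simp add: tree_level_def)
  then show ?thesis using 0 by (simp add: node_def)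
next
  case (Suc k')
  then have \<sigma>': "\<sigma> \<in> tree_level branches (Suc k')" using \<sigma> by simp
  have ne: "\<sigma> \<noteq> []" and len: "length \<sigma> = Suc k'" using \<sigma>' by (auto simp: tree_level_def)
  have "node \<sigma> = path_weight \<sigma> *\<^sub>R (\<Sum>b\<in>branches (Suc k'). weight k' (last \<sigma>) b *\<^sub>R atom (Suc k') b)"
    unfolding node_Suc[OF \<sigma>'] by (subst atom_split[OF last_tree_level[OF \<sigma>']]) (rule refl)
  also have "\<dots> = (\<Sum>b\<in>branches (Suc k'). node (\<sigma> @ [b]))"
    unfolding scaleR_sum_right by (rule sum.cong[OF refl]) (simp add: node_def path_weight_snoc[OF ne] len)
  finally show ?thesis using Suc by simp
qed

lemma layer_subset_span: "layer k \<subseteq> span (node ` (\<Union>k. tree_level branches k))"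
proof -
  let ?S = "span (node ` (\<Union>k. tree_level branches k))"
  have atom: "atom k b \<in> ?S" if b: "b < M k * N k" for b
  proof -
    obtain \<sigma> where \<sigma>: "\<sigma> \<in> tree_level branches (Suc k)" "last \<sigma> = b" "path_weight \<sigma> \<noteq> 0"
      using path_exists[OF b] by blast
    have "node \<sigma> \<in> ?S" using \<sigma>(1) by (intro span_base) blast
    then have "inverse (path_weight \<sigma>) *\<^sub>R node \<sigma> \<in> ?S" by (rule span_scale)
    then show ?thesis using \<sigma> by (simp add: node_Suc[OF \<sigma>(1)])
  qed
  show ?thesis
  proof
    fix x assume "x \<in> layer k"
    then obtain c where c: "c \<in> bcarrier (L k)" "x = h k c" unfolding layer_def by blast
    show "x \<in> ?S" unfolding c(2) h_eq_atoms[OF c(1)] by (intro span_sum span_scale atom) simp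
  qed
qed

lemma finitely_branchable_tower: "finitely_branchable TYPE('a)"
  unfolding finitely_branchable_def
proof (intro exI[of _ branches] exI[of _ node] conjI allI ballI impI)
  fix k
  show "finite (branches k)" by simp
  show "branches k \<noteq> {}" using M_pos[of k] N_pos[of k] by (auto simp: lessThan_empty_iff)
  show "0 \<le> node \<sigma>" if "\<sigma> \<in> tree_level branches k" for \<sigma> by (rule node_nonneg[OF that])
  show "inf \<bar>node \<sigma>\<bar> \<bar>node \<tau>\<bar> = 0"
    if "\<sigma> \<in> tree_level branches (Suc k)" "\<tau> \<in> tree_level branches (Suc k)" "\<sigma> \<noteq> \<tau>" for \<sigma> \<tau>
    by (rule node_disjoint[OF that])
  show "node \<sigma> = (\<Sum>b\<in>branches k. node (\<sigma> @ [b]))" if "\<sigma> \<in> tree_level branches k" for \<sigma>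
    by (rule node_split[OF that])
next
  have "(\<Union>k. layer k) \<subseteq> span (node ` (\<Union>k. tree_level branches k))" using layer_subset_span by blast
  then have "closure (\<Union>k. layer k) \<subseteq> closure (span (node ` (\<Union>k. tree_level branches k)))" by (rule closure_mono)
  then show "closure (span (node ` (\<Union>k. tree_level branches k))) = UNIV" unfolding closure_layers by blast
qed

end

text \<open>By linearity: there are \<open>m * n\<close> matrix units, and the norm bounds each
  coefficient.\<close>

lemma embedding_map_diff_le:
  fixes g :: "(nat \<Rightarrow> nat \<Rightarrow> real) \<Rightarrow> 'a::banach_lattice"
  assumes g: "bl_embedding (linf_l1 m n) (blat_of UNIV) g" and g': "bl_embedding (linf_l1 m' n') (blat_of UNIV) g'"
    and close: "\<forall>i<m. \<forall>j<n. norm (g (unit_matrix i j) - g' (pull m' n' \<alpha> \<beta> s (unit_matrix i j))) \<le> \<epsilon>"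
    and x: "x \<in> bcarrier (linf_l1 m n)" and \<epsilon>: "0 \<le> \<epsilon>"
  shows "norm (g x - g' (pull m' n' \<alpha> \<beta> s x)) \<le> real (m * n) * \<epsilon> * bnorm (linf_l1 m n) x"
proof -
  let ?Q = "{..<m} \<times> {..<n}" and ?p = "pull m' n' \<alpha> \<beta> s" and ?u = "\<lambda>q. unit_matrix (fst q) (snd q)"
  have "?p x = ?p (\<lambda>a b. \<Sum>q\<in>?Q. x (fst q) (snd q) * ?u q a b)" by (rule arg_cong[OF matrix_sum_units[OF x]])
  also have "\<dots> = (\<lambda>k l. \<Sum>q\<in>?Q. x (fst q) (snd q) * ?p (?u q) k l)"
  proof (intro ext)
    fix k l
    show "?p (\<lambda>a b. \<Sum>q\<in>?Q. x (fst q) (snd q) * ?u q a b) k l = (\<Sum>q\<in>?Q. x (fst q) (snd q) * ?p (?u q) k l)"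
      by (cases "k < m'"; cases "l < n'") (simp_all add: pull_def sum_distrib_left mult.left_commute)
  qed
  finally have px: "?p x = (\<lambda>k l. \<Sum>q\<in>?Q. x (fst q) (snd q) * ?p (?u q) k l)" .
  have "g' (?p x) = (\<Sum>q\<in>?Q. g' (\<lambda>k l. x (fst q) (snd q) * ?p (?u q) k l))"
    unfolding px by (rule embedding_sum[OF g']) (simp_all add: pull_def)
  also have "\<dots> = (\<Sum>q\<in>?Q. x (fst q) (snd q) *\<^sub>R g' (?p (?u q)))"
    by (rule sum.cong[OF refl], rule embeddingD(2)[OF g' pull_mem])
  finally have diff: "g x - g' (?p x) = (\<Sum>q\<in>?Q. x (fst q) (snd q) *\<^sub>R (g (?u q) - g' (?p (?u q))))"
    unfolding embedding_eq_sum[OF g x] by (simp only: sum_subtractf scaleR_diff_right)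
  have "norm (g x - g' (?p x)) \<le> (\<Sum>q\<in>?Q. bnorm (linf_l1 m n) x * \<epsilon>)"
    unfolding diff
  proof (rule sum_norm_le)
    fix q assume q: "q \<in> ?Q"
    then have "\<bar>x (fst q) (snd q)\<bar> \<le> bnorm (linf_l1 m n) x" by (intro linf_l1_entry_le) (simp_all add: mem_Times_iff)
    moreover have "norm (g (?u q) - g' (?p (?u q))) \<le> \<epsilon>" using close q by (simp add: mem_Times_iff)
    ultimately show "norm (x (fst q) (snd q) *\<^sub>R (g (?u q) - g' (?p (?u q)))) \<le> bnorm (linf_l1 m n) x * \<epsilon>"
      unfolding norm_scaleR by (intro mult_mono) auto
  qed
  also have "\<dots> = real (m * n) * \<epsilon> * bnorm (linf_l1 m n) x"
    unfolding sum_constant card_cartesian_product card_lessThan by (simp only: mult.assoc mult.commute[of \<epsilon> "bnorm (linf_l1 m n) x"])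
  finally show ?thesis .
qed

text \<open>Step \<open>k\<close> is taken with tolerance \<open>(1 / 2) ^ k / (m n)\<close>, which
  \<open>embedding_map_diff_le\<close> turns into \<open>(1 / 2) ^ k\<close> relative to the norm.
  Dependent choice runs over the lattices and their embeddings; the inclusions are selected
  afterwards.\<close>

lemma exists_tower:
  assumes BL: "is_BL TYPE('a::banach_lattice)"
  shows "\<exists>M N \<alpha> \<beta> s g (d :: nat \<Rightarrow> 'a). tower M N \<alpha> \<beta> s g d"
proof -
  obtain U :: "'a set" where U: "countable U" "closure U = UNIV"
    using BL unfolding is_BL_def separable_space_def by auto
  have U_ne: "U \<noteq> {}" using U(2) by auto
  \<comment> \<open>Decoding \<open>k\<close> as a pair and dropping one component repeats every
    member of the dense set infinitely often.\<close>
  define d where "d k = from_nat_into U (fst (prod_decode k))" for k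
  define good where "good = (\<lambda>(m, n, g :: (nat \<Rightarrow> nat \<Rightarrow> real) \<Rightarrow> 'a).
    0 < m \<and> 0 < n \<and> bl_embedding (linf_l1 m n) (blat_of UNIV) g)"
  define next_to where "next_to k = (\<lambda>(m, n, g :: (nat \<Rightarrow> nat \<Rightarrow> real) \<Rightarrow> 'a) (m', n', g' :: (nat \<Rightarrow> nat \<Rightarrow> real) \<Rightarrow> 'a).
    \<exists>\<alpha> \<beta> s. (\<forall>k<m'. \<forall>l<n'. \<alpha> k l < m \<and> \<beta> k l < n \<and> 0 < s k l) \<and>
      (\<forall>x. bnorm (linf_l1 m' n') (pull m' n' \<alpha> \<beta> s x) = bnorm (linf_l1 m n) x) \<and>
      (\<forall>i<m. \<forall>j<n. norm (g (unit_matrix i j) - g' (pull m' n' \<alpha> \<beta> s (unit_matrix i j))) \<le> (1 / 2) ^ k / real (m * n)) \<and>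
      (\<exists>c\<in>bcarrier (linf_l1 m' n'). norm (d k - g' c) \<le> (1 / 2) ^ k / real (m * n)))" for k
  have "\<exists>f. \<forall>k. good (f k) \<and> next_to k (f k) (f (Suc k))"
  proof (rule dependent_nat_choice)
    obtain g where "bl_embedding (linf_l1 1 1) (blat_of (UNIV :: 'a set)) g" using exists_line[OF BL] by blast
    then have "good (1, 1, g)" by (simp only: good_def case_prod_conv zero_less_one simp_thms)
    then show "\<exists>x. good x" by blast
  next
    fix x k assume "good x"
    obtain m n g where x: "x = (m, n, g)" by (cases x)
    have m: "0 < m" and n: "0 < n" and g: "bl_embedding (linf_l1 m n) (blat_of UNIV) g"
      using \<open>good x\<close> unfolding x good_def case_prod_conv by blast+
    have \<epsilon>: "0 < (1 / 2) ^ k / real (m * n)" using m n by simp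
    obtain m' n' \<alpha> \<beta> s g' where m': "0 < m'" and n': "0 < n'"
      and g': "bl_embedding (linf_l1 m' n') (blat_of (UNIV :: 'a set)) g'"
      and *: "\<forall>k<m'. \<forall>l<n'. \<alpha> k l < m \<and> \<beta> k l < n \<and> 0 < s k l"
        "\<forall>x. bnorm (linf_l1 m' n') (pull m' n' \<alpha> \<beta> s x) = bnorm (linf_l1 m n) x"
        "\<forall>i<m. \<forall>j<n. norm (g (unit_matrix i j) - g' (pull m' n' \<alpha> \<beta> s (unit_matrix i j))) \<le> (1 / 2) ^ k / real (m * n)"
        "\<exists>c\<in>bcarrier (linf_l1 m' n'). norm (d k - g' c) \<le> (1 / 2) ^ k / real (m * n)"
      using extension_step_full[OF BL m n g \<epsilon>, of "d k"] by (elim exE conjE) (rule that)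
    have "good (m', n', g')" unfolding good_def case_prod_conv by (intro conjI m' n' g')
    moreover have "next_to k x (m', n', g')"
      unfolding x next_to_def case_prod_conv by (intro exI conjI) (rule *)+
    ultimately show "\<exists>y. good y \<and> next_to k x y" by blast
  qed
  then obtain f where f: "\<And>k. good (f k)" "\<And>k. next_to k (f k) (f (Suc k))" by blast
  define M where "M k = fst (f k)" for k
  define N where "N k = fst (snd (f k))" for k
  define g where "g k = snd (snd (f k))" for k
  have f_eq: "f k = (M k, N k, g k)" for k by (simp add: M_def N_def g_def)
  have good: "0 < M k" "0 < N k" "bl_embedding (linf_l1 (M k) (N k)) (blat_of UNIV) (g k)" for k
    using f(1)[of k] unfolding f_eq good_def case_prod_conv by blast+
  define P where "P k \<alpha> \<beta> s \<longleftrightarrow> (\<forall>i<M (Suc k). \<forall>l<N (Suc k). \<alpha> i l < M k \<and> \<beta> i l < N k \<and> 0 < s i l) \<and>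
      (\<forall>x. bnorm (linf_l1 (M (Suc k)) (N (Suc k))) (pull (M (Suc k)) (N (Suc k)) \<alpha> \<beta> s x) = bnorm (linf_l1 (M k) (N k)) x) \<and>
      (\<forall>i<M k. \<forall>j<N k. norm (g k (unit_matrix i j) - g (Suc k) (pull (M (Suc k)) (N (Suc k)) \<alpha> \<beta> s (unit_matrix i j)))
         \<le> (1 / 2) ^ k / real (M k * N k)) \<and>
      (\<exists>c\<in>bcarrier (linf_l1 (M (Suc k)) (N (Suc k))). norm (d k - g (Suc k) c) \<le> (1 / 2) ^ k / real (M k * N k))" for k \<alpha> \<beta> s
  have "\<exists>\<alpha> \<beta> s. P k \<alpha> \<beta> s" for k
    using f(2)[of k] unfolding f_eq next_to_def case_prod_conv P_def .
  then obtain \<alpha> \<beta> s where F: "\<And>k. P k (\<alpha> k) (\<beta> k) (s k)" by metis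
  note PF = F[unfolded P_def]
  have MN: "1 \<le> real (M k * N k)" for k
  proof -
    have "0 < M k * N k" using good by simp
    then show ?thesis by linarith
  qed
  have "tower M N \<alpha> \<beta> s g d"
  proof
    fix k
    show "0 < M k" "0 < N k" "bl_embedding (linf_l1 (M k) (N k)) (blat_of UNIV) (g k)" by (fact good)+
    show "\<alpha> k i j < M k \<and> \<beta> k i j < N k \<and> 0 < s k i j" if "i < M (Suc k)" "j < N (Suc k)" for i j
      using conjunct1[OF PF[of k]] that by blast
    show "bnorm (linf_l1 (M (Suc k)) (N (Suc k))) (pull (M (Suc k)) (N (Suc k)) (\<alpha> k) (\<beta> k) (s k) x)
        = bnorm (linf_l1 (M k) (N k)) x" for x
      using conjunct1[OF conjunct2[OF PF[of k]]] by blast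
    show "norm (g k x - g (Suc k) (pull (M (Suc k)) (N (Suc k)) (\<alpha> k) (\<beta> k) (s k) x))
       \<le> (1 / 2) ^ k * bnorm (linf_l1 (M k) (N k)) x" if "x \<in> bcarrier (linf_l1 (M k) (N k))" for x
    proof -
      have "norm (g k x - g (Suc k) (pull (M (Suc k)) (N (Suc k)) (\<alpha> k) (\<beta> k) (s k) x))
        \<le> real (M k * N k) * ((1 / 2) ^ k / real (M k * N k)) * bnorm (linf_l1 (M k) (N k)) x"
        by (rule embedding_map_diff_le[OF good(3) good(3) conjunct1[OF conjunct2[OF conjunct2[OF PF[of k]]]] that]) simp
      moreover have "a * (b / a) = b" if "1 \<le> a" for a b :: real using that by simp
      ultimately show ?thesis by (simp only: MN)
    qed
    obtain c where c: "c \<in> bcarrier (linf_l1 (M (Suc k)) (N (Suc k)))"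
      "norm (d k - g (Suc k) c) \<le> (1 / 2) ^ k / real (M k * N k)"
      using conjunct2[OF conjunct2[OF conjunct2[OF PF[of k]]]] by (rule bexE)
    have "(1 / 2) ^ k / real (M k * N k) \<le> (1 / 2) ^ k / 1"
      using MN[of k] by (intro divide_left_mono) auto
    then show "\<exists>c\<in>bcarrier (linf_l1 (M (Suc k)) (N (Suc k))). norm (d k - g (Suc k) c) \<le> (1 / 2) ^ k"
      using c by (intro bexI[OF _ c(1)]) simp
  next
    fix \<epsilon> :: real and K y assume "0 < \<epsilon>"
    moreover have "y \<in> closure U" using U(2) by simp
    ultimately obtain z where z: "z \<in> U" "dist z y < \<epsilon>" unfolding closure_approachable by blast
    define k where "k = prod_encode (to_nat_on U z, K)"
    have "d k = z" using U(1) z(1) by (simp add: d_def k_def)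
    moreover have "K \<le> k" unfolding k_def by (rule le_prod_encode_2)
    ultimately show "\<exists>k\<ge>K. norm (y - d k) < \<epsilon>"
      using z(2) by (intro exI[of _ k]) (simp add: dist_norm norm_minus_commute)
  qed
  then show ?thesis by blast
qed

theorem theorem4p3:
  assumes "is_BL TYPE('a::banach_lattice)"
  shows "(\<exists>(\<A> :: nat \<Rightarrow> 'a set) m n.
            (\<forall>k. closed_sublattice (\<A> k)) \<and>
            (\<forall>k. \<A> k \<subseteq> \<A> (Suc k)) \<and>
            (\<forall>k. 0 < m k \<and> 0 < n k \<and>
                 (\<exists>f. lattice_isometry (blat_of (\<A> k)) (linf_l1 (m k) (n k)) f)) \<and>
            closure (\<Union>k. \<A> k) = UNIV) \<and>
         finitely_branchable TYPE('a)"
proof -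
  obtain M N \<alpha> \<beta> s g and d :: "nat \<Rightarrow> 'a" where "tower M N \<alpha> \<beta> s g d"
    using exists_tower[OF assms] by blast
  then interpret tower M N \<alpha> \<beta> s g d .
  have "closed_sublattice (layer k)" "\<exists>f. lattice_isometry (blat_of (layer k)) (linf_l1 (M k) (N k)) f" for k
    unfolding layer_def by (rule range_embedding[OF M_pos h_emb])+
  then show ?thesis
    by (intro conjI exI[of _ layer] exI[of _ M] exI[of _ N] allI
      layer_mono closure_layers M_pos N_pos finitely_branchable_tower)
qed

end
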